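(* Let $\Sigma:\ \dot{x}=f(x,u)$ be the infinite network on $X=\ell_\infty(\mathbb{N},(n_i))$ with input value space $U=\ell_\infty(\mathbb{N},(m_i))$ composed of the subsystems $\Sigma_i:\ \dot{x}_i=f_i(x_i,\bar{x}_i,u_i)$, $i\in\mathbb{N}$, as described in the context. Suppose: (a) $\Sigma$ is well-posed and satisfies the boundedness-implies-continuation property. (b) For each $i\in\mathbb{N}$ there is a continuous function $V_i:\mathbb{R}^{n_i}\to\mathbb{R}_+$, which is $C^1$ outside of $x_i=0$, such that: (L1) there exist $\psi_{i1},\psi_{i2}\in\mathcal{K}_\infty$ with $\psi_{i1}(|x_i|)\le V_i(x_i)\le\psi_{i2}(|x_i|)$ for all $x_i\in\mathbb{R}^{n_i}$; (L2) there exist a monotone, homogeneous aggregation function $\mu_i$, numbers $\gamma_{ij}\in\mathbb{R}_+$ ($j\in\mathbb{N}$) with $\gamma_{ij}=0$ for all $j\notin I_i$, and functions $\gamma_{iu}\in\mathcal{K}$, $\alpha_i\in\mathcal{P}$ such that for all $x=(x_j)_{j\in\mathbb{N}}\in X$ and $u=(u_j)_{j\in\mathbb{N}}\in U$, $$V_i(x_i)>\max\Big\{\mu_i\big((\gamma_{ij}V_j(x_j))_{j\in\mathbb{N}}\big),\ \gamma_{iu}(|u_i|)\Big\}\ \Rightarrow\ \nabla V_i(x_i)f_i(x_i,\bar{x}_i,u_i)\le-\alpha_i(V_i(x_i)).$$ Moreover, there exist $\psi_1,\psi_2\in\mathcal{K}_\infty$ such that $\psi_1\le\psi_{i1}$ and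 $\psi_{i2}\le\psi_2$ for all $i\in\mathbb{N}$. (c) The gain operator $\Gamma_\mu:\ell_\infty^+\to\ell_\infty^+$, $\Gamma_\mu(s):=\big(\mu_i((\gamma_{ij}s_j)_{j\in\mathbb{N}})\big)_{i\in\mathbb{N}}$, is well-defined, equivalently $\|\Gamma_\mu(\mathbf{1})\|_{\ell_\infty}<\infty$; and there is $\gamma^u_{\max}\in\mathcal{K}$ such that $\gamma_{iu}\le\gamma^u_{\max}$ for all $i\in\mathbb{N}$. (d) The spectral radius condition $r(\Gamma_\mu)<1$ holds. (e) For each $R>0$ there is $L(R)>0$ such that $|V_i(x_i)-V_i(y_i)|\le L(R)|x_i-y_i|$ for all $i\in\mathbb{N}$ and all $x_i,y_i\in B_R(0)\subset\mathbb{R}^{n_i}$. (f) There exists $\tilde\alpha\in\mathcal{P}$ such that $\alpha_i\ge\tilde\alpha$ for all $i\in\mathbb{N}$. Additionally, suppose: (i) $f$ maps $X\times U$ into $X$, $f:X\times U\to X$ is continuous, and for every $R>0$ $$C(R):=\sup_{\max\{\|x\|_X,\|u\|_U\}\le R}\|f(x,u)\|_X<\infty.$$ (ii) The functions $V_i$, $i\in\mathbb{N}$, are continuously differentiable at the origin, and the constants $L(R)$ in (e) can be chosen as continuous functions of $R$ satisfying $L(R)\to0$ as $R\to0$. Then there exist $s^0\in\mathrm{int}(\ell_\infty^+)$, for which $$V(x):=\sup_{i\in\mathbb{N}}\frac{1}{s^0_i}V_i(x_i),\qquad x=(x_i)_{i\in\mathbb{N}}\in X,$$ is an ISS Lyapunov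 function in an implication form for $\Sigma$, and a nonlinear scaling $\xi\in\mathcal{K}_\infty$ such that $W:=\xi\circ V$ is an ISS Lyapunov function for $\Sigma$ in a dissipative form.
   Context: **Notation.** $\mathbb{R}_+=[0,\infty)$. $\ell_\infty$ is the Banach space of bounded real sequences with norm $\|x\|_{\ell_\infty}=\sup_i|x_i|$; $\ell_\infty^+$ is the cone of sequences in $\ell_\infty$ with all $x_i\ge0$; $\mathrm{int}(\ell_\infty^+)$ is its interior; $x\le y$ in $\ell_\infty$ means $x_i\le y_i$ for all $i$; $\mathbf{1}=(1,1,1,\ldots)$. $B_R(0)$ is the open ball of radius $R$ around $0$. Gradients $\nabla V_i$ are row vectors. Inequalities between functions are pointwise. **Comparison functions.** $\mathcal{P}$: continuous $\alpha:\mathbb{R}_+\to\mathbb{R}_+$ with $\alpha(0)=0$ and $\alpha(r)>0$ for $r>0$. $\mathcal{K}$: strictly increasing functions in $\mathcal{P}$. $\mathcal{K}_\infty$: unbounded functions in $\mathcal{K}$. **Nonlinear scaling.** A function $\xi\in\mathcal{K}_\infty$ which is continuously differentiable on $(0,\infty)$ with $\xi'(s)>0$ for all $s>0$ and such that $\xi'(0):=\lim_{s\to0}\xi'(s)$ exists and is finite. **Monotone, homogeneous aggregation function.** A function $\mu:\ell_\infty^+\to[0,\infty]$ such that $\mu(cs)=c\mu(s)$ for all $s\in\ell_\infty^+$, $c\ge0$ (with $0\cdot\infty=0$); $\mu(r)\le\mu(s)$ whenever $r\le s$; and $\mu(r+s)\le\mu(r)+\mu(s)$ for all $r,s\in\ell_\infty^+$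 (with $\infty+\infty=\infty$). **Network.** Given are sequences $(n_i),(m_i)$ of positive integers and finite (possibly empty) sets $I_i\subset\mathbb{N}$ with $i\notin I_i$. The subsystem $\Sigma_i:\ \dot{x}_i=f_i(x_i,\bar{x}_i,u_i)$ has state $x_i\in\mathbb{R}^{n_i}$, internal input $\bar{x}_i=(x_j)_{j\in I_i}\in\mathbb{R}^{N_i}$ with $N_i=\sum_{j\in I_i}n_j$, external input $u_i\in\mathbb{R}^{m_i}$, and continuous right-hand side $f_i:\mathbb{R}^{n_i}\times\mathbb{R}^{N_i}\times\mathbb{R}^{m_i}\to\mathbb{R}^{n_i}$. For every initial state and all essentially bounded inputs $\bar{x}_i(\cdot),u_i(\cdot)$, $\Sigma_i$ has a unique local solution. Arbitrary norms, all denoted $|\cdot|$, are fixed on the spaces $\mathbb{R}^{n_i}$, $\mathbb{R}^{m_i}$. Put $X=\ell_\infty(\mathbb{N},(n_i))=\{(x_i)_{i\in\mathbb{N}}: x_i\in\mathbb{R}^{n_i},\ \sup_i|x_i|<\infty\}$ with $\|x\|_X=\sup_i|x_i|$, and $U=\ell_\infty(\mathbb{N},(m_i))$ with $\|u\|_U=\sup_i|u_i|$. A function on $\mathbb{R}_+$ is piecewise right-continuous if $\mathbb{R}_+$ is the disjoint union of intervals $[0,a_1),[a_1,a_2),[a_2,a_3),\ldots$ on each of which the function is continuous. The class of input functions is $\mathcal{U}=\{u\in L_\infty(\mathbb{R}_+,U): u\text{ piecewise right-continuous}\}$, with $\|u\|_{\mathcal{U}}=\mathrm{ess\,sup}_{t\ge0}\|u(t)\|_U$.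 The right-hand side of $\Sigma$ is $f:X\times U\to\prod_i\mathbb{R}^{n_i}$, $f(x,u)=(f_i(x_i,\bar{x}_i,u_i))_{i\in\mathbb{N}}$. **Solutions.** For $x^0\in X$, $u\in\mathcal{U}$, a solution of $\dot{x}(t)=f(x(t),u(t))$, $x(0)=x^0$ is a function $\lambda:J\to X$, $J=[0,T)$, $0<T\le\infty$, such that $s\mapsto f(\lambda(s),u(s))$ is a locally Bochner-integrable $X$-valued function and $\lambda(t)=x^0+\int_0^tf(\lambda(s),u(s))\,ds$ for all $t\in J$. $\Sigma$ is *well-posed* if local solutions exist and are unique (for all $x^0\in X$, $u\in\mathcal{U}$); the solution is then denoted $\phi(t,x^0,u)$. $\Sigma$ has the *boundedness-implies-continuation property* if every bounded solution defined on a bounded time interval $[0,T)$ can be extended to a solution on a larger time interval. **ISS Lyapunov functions.** For $V:X\to\mathbb{R}_+$ put $\mathrm{D}^+V_u(x)=\limsup_{t\to0^+}\frac{V(\phi(t,x,u))-V(x)}{t}$. Consider the conditions: (A) $V$ is continuous; (B) there are $\psi_1,\psi_2\in\mathcal{K}_\infty$ with $\psi_1(\|x\|_X)\le V(x)\le\psi_2(\|x\|_X)$ for all $x\in X$ (not necessarily the $\psi_1,\psi_2$ of the claim). $V$ is an ISS Lyapunov function *in an implication form* if (A), (B) hold and there are $\gamma\in\mathcal{K}$, $\alpha\in\mathcal{P}$ such that for all $x\in X$, $u\in\mathcal{U}$: $V(x)>\gamma(\|u\|_{\mathcal{U}})$ implies $\mathrm{D}^+V_u(x)\le-\alpha(V(x))$.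 $V$ is an ISS Lyapunov function *in a dissipative form* if (A), (B) hold and there are $\alpha\in\mathcal{K}_\infty$, $\rho\in\mathcal{K}$ such that $\mathrm{D}^+V_u(x)\le-\alpha(V(x))+\rho(\|u\|_{\mathcal{U}})$ for all $x\in X$, $u\in\mathcal{U}$. **Spectral radius.** $r(\Gamma)=\lim_{n\to\infty}\sup_{s\in\ell_\infty^+,\ \|s\|_{\ell_\infty}=1}\|\Gamma^n(s)\|_{\ell_\infty}^{1/n}$, where $\Gamma^n$ is the $n$-fold composition. *)

theory Defs
  imports "HOL-Analysis.Analysis" "HOL-Probability.Essential_Supremum"
begin

subsection \<open>Comparison functions\<close>

text \<open>Comparison functions are functions on the nonnegative reals; their values at negative
  arguments are irrelevant.\<close>

definition class_P :: "(real \<Rightarrow> real) \<Rightarrow> bool" where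
  "class_P \<alpha> \<longleftrightarrow> continuous_on {0..} \<alpha> \<and> \<alpha> 0 = 0 \<and> (\<forall>r>0. \<alpha> r > 0)"

definition class_K :: "(real \<Rightarrow> real) \<Rightarrow> bool" where
  "class_K \<alpha> \<longleftrightarrow> class_P \<alpha> \<and> strict_mono_on {0..} \<alpha>"

definition class_K_inf :: "(real \<Rightarrow> real) \<Rightarrow> bool" where
  "class_K_inf \<alpha> \<longleftrightarrow> class_K \<alpha> \<and> \<not> bdd_above (\<alpha> ` {0..})"

definition nonlinear_scaling :: "(real \<Rightarrow> real) \<Rightarrow> bool" where
  "nonlinear_scaling \<xi> \<longleftrightarrow> class_K_inf \<xi> \<and>
     (\<forall>s>0. \<xi> differentiable (at s) \<and> deriv \<xi> s > 0) \<and>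
     continuous_on {0<..} (deriv \<xi>) \<and>
     (\<exists>L. (deriv \<xi> \<longlongrightarrow> L) (at_right 0))"

subsection \<open>Bounded real sequences\<close>

text \<open>As \<^typ>\<open>nat\<close> carries the discrete topology, the bounded continuous functions on it are
  exactly the bounded real sequences, and the norm is the supremum norm. The function
  \<^const>\<open>Bcontfun\<close> is only meaningful on bounded sequences.\<close>

type_synonym linf = "nat \<Rightarrow>\<^sub>C real"

lemma apply_Bcontfun_nat:
  fixes g :: "nat \<Rightarrow> real"
  assumes "bounded (range g)"
  shows "apply_bcontfun (Bcontfun g) = g"
  using assms by (simp add: Bcontfun_inverse bcontfun_def)

definition linf_pos :: "linf set" where
  "linf_pos = {s::linf. \<forall>i. 0 \<le> s i}"

subsection \<open>Aggregation functions, gain operator, spectral radius\<close>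

definition aggregation_function :: "(linf \<Rightarrow> ennreal) \<Rightarrow> bool" where
  "aggregation_function \<mu> \<longleftrightarrow>
     (\<forall>s\<in>linf_pos. \<forall>c\<ge>0. \<mu> (c *\<^sub>R s) = ennreal c * \<mu> s) \<and>
     (\<forall>r\<in>linf_pos. \<forall>s\<in>linf_pos. (\<forall>i. apply_bcontfun r i \<le> apply_bcontfun s i) \<longrightarrow> \<mu> r \<le> \<mu> s) \<and>
     (\<forall>r\<in>linf_pos. \<forall>s\<in>linf_pos. \<mu> (r + s) \<le> \<mu> r + \<mu> s)"

definition weighted :: "(nat \<Rightarrow> real) \<Rightarrow> (nat \<Rightarrow> real) \<Rightarrow> linf" where
  "weighted g s = Bcontfun (\<lambda>j. g j * s j)"

definition gain_well_defined :: "(nat \<Rightarrow> linf \<Rightarrow> ennreal) \<Rightarrow> (nat \<Rightarrow> nat \<Rightarrow> real) \<Rightarrow> bool" where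
  "gain_well_defined \<mu> \<gamma> \<longleftrightarrow> (\<forall>s\<in>linf_pos. (SUP i. \<mu> i (weighted (\<gamma> i) (apply_bcontfun s))) < \<infinity>)"

definition gain_operator :: "(nat \<Rightarrow> linf \<Rightarrow> ennreal) \<Rightarrow> (nat \<Rightarrow> nat \<Rightarrow> real) \<Rightarrow> linf \<Rightarrow> linf" where
  "gain_operator \<mu> \<gamma> s = Bcontfun (\<lambda>i. enn2real (\<mu> i (weighted (\<gamma> i) (apply_bcontfun s))))"

definition cone_spectral_radius :: "(linf \<Rightarrow> linf) \<Rightarrow> real" where
  "cone_spectral_radius G =
     lim (\<lambda>k. SUP s\<in>{s \<in> linf_pos. norm s = 1}. root k (norm ((G ^^ k) s)))"

subsection \<open>Euclidean spaces of varying dimension\<close>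

text \<open>The space of real \<open>n\<close>-vectors is encoded as the \<open>n\<close>-dimensional subspace of sequences
  supported in \<open>{..<n}\<close>. All norms on it being equivalent, the ambient topology and the
  Frechet derivatives relative to this subspace are the usual ones.\<close>

definition Rn :: "nat \<Rightarrow> linf set" where
  "Rn n = {v::linf. \<forall>k\<ge>n. v k = 0}"

definition is_norm_on :: "linf set \<Rightarrow> (linf \<Rightarrow> real) \<Rightarrow> bool" where
  "is_norm_on S N \<longleftrightarrow>
     (\<forall>v\<in>S. 0 \<le> N v \<and> (N v = 0 \<longleftrightarrow> v = 0)) \<and>
     (\<forall>v\<in>S. \<forall>c. N (c *\<^sub>R v) = \<bar>c\<bar> * N v) \<and>
     (\<forall>v\<in>S. \<forall>w\<in>S. N (v + w) \<le> N v + N w)"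

text \<open>The row vector \<open>\<nabla>V(x)\<close> applied to the column vector \<open>v\<close>. It is uniquely determined for
  \<open>v \<in> Rn n\<close> if \<open>V\<close> is differentiable at \<open>x\<close> relative to \<open>Rn n\<close>.\<close>

definition grad_app :: "nat \<Rightarrow> (linf \<Rightarrow> real) \<Rightarrow> linf \<Rightarrow> linf \<Rightarrow> real" where
  "grad_app n V x v = frechet_derivative V (at x within Rn n) v"

text \<open>To be used for relatively open subsets \<open>S\<close> of \<open>Rn n\<close>; by finite dimensionality, continuity
  of \<open>\<nabla>V\<close> is the same as continuity of \<open>\<nabla>V(\<cdot>)v\<close> for every \<open>v\<close>.\<close>

definition C1_on :: "nat \<Rightarrow> linf set \<Rightarrow> (linf \<Rightarrow> real) \<Rightarrow> bool" where
  "C1_on n S V \<longleftrightarrow>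
     (\<forall>x\<in>S. V differentiable (at x within Rn n)) \<and>
     (\<forall>v\<in>Rn n. continuous_on S (\<lambda>x. grad_app n V x v))"

subsection \<open>The spaces of bounded vector sequences\<close>

definition lsup_space :: "(nat \<Rightarrow> nat) \<Rightarrow> (nat \<Rightarrow> linf \<Rightarrow> real) \<Rightarrow> (nat \<Rightarrow> linf) set" where
  "lsup_space n N = {x. (\<forall>i. x i \<in> Rn (n i)) \<and> bdd_above (range (\<lambda>i. N i (x i)))}"

definition lsup_norm :: "(nat \<Rightarrow> linf \<Rightarrow> real) \<Rightarrow> (nat \<Rightarrow> linf) \<Rightarrow> real" where
  "lsup_norm N x = (SUP i. N i (x i))"

text \<open>The value outside the space is set to \<open>0\<close> because \<^locale>\<open>Metric_space\<close> requires a
  nonnegative symmetric function on the whole type.\<close>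

definition lsup_dist ::
  "(nat \<Rightarrow> nat) \<Rightarrow> (nat \<Rightarrow> linf \<Rightarrow> real) \<Rightarrow> (nat \<Rightarrow> linf) \<Rightarrow> (nat \<Rightarrow> linf) \<Rightarrow> real" where
  "lsup_dist n N x y =
     (if x \<in> lsup_space n N \<and> y \<in> lsup_space n N then lsup_norm N (\<lambda>i. x i - y i) else 0)"

definition lsup_topology ::
  "(nat \<Rightarrow> nat) \<Rightarrow> (nat \<Rightarrow> linf \<Rightarrow> real) \<Rightarrow> (nat \<Rightarrow> linf) topology" where
  "lsup_topology n N = Metric_space.mtopology (lsup_space n N) (lsup_dist n N)"

lemma Rn_diff: "v \<in> Rn n \<Longrightarrow> w \<in> Rn n \<Longrightarrow> v - w \<in> Rn n"
  by (simp add: Rn_def)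

lemma is_norm_on_diff_commute:
  assumes "is_norm_on (Rn n) N" "v \<in> Rn n" "w \<in> Rn n"
  shows "N (v - w) = N (w - v)"
proof -
  have "N ((-1) *\<^sub>R (v - w)) = \<bar>-1\<bar> * N (v - w)"
    using assms(1)[unfolded is_norm_on_def, THEN conjunct2, THEN conjunct1]
      Rn_diff[OF assms(2,3)] by (rule bspec[where P = "\<lambda>v. \<forall>c. N (c *\<^sub>R v) = \<bar>c\<bar> * N v", THEN spec])
  then show ?thesis by simp
qed

lemma is_norm_on_diff_triangle:
  assumes N: "is_norm_on (Rn n) N" and v: "v \<in> Rn n" and w: "w \<in> Rn n" and z: "z \<in> Rn n"
  shows "N (v - z) \<le> N (v - w) + N (w - z)"
proof -
  have "N ((v - w) + (w - z)) \<le> N (v - w) + N (w - z)"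
    using N Rn_diff[OF v w] Rn_diff[OF w z] unfolding is_norm_on_def by (metis (no_types, lifting))
  then show ?thesis by simp
qed

lemma lsup_Metric_space:
  assumes N: "\<And>i. is_norm_on (Rn (n i)) (N i)"
  shows "Metric_space (lsup_space n N) (lsup_dist n N)"
proof -
  have pos: "0 \<le> N i v" if "v \<in> Rn (n i)" for i v
    using N[of i] that by (simp add: is_norm_on_def)
  have zero_in: "(0::linf) \<in> Rn k" for k by (simp add: Rn_def)
  have bdd: "bdd_above (range (\<lambda>i. N i (x i - y i)))"
    if x: "x \<in> lsup_space n N" and y: "y \<in> lsup_space n N" for x y
  proof -
    obtain A where A: "\<And>i. N i (x i) \<le> A"
      using x unfolding lsup_space_def bdd_above_def by blast
    obtain B where B: "\<And>i. N i (y i) \<le> B"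
      using y unfolding lsup_space_def bdd_above_def by blast
    have "N i (x i - y i) \<le> A + B" for i
    proof -
      have xi: "x i \<in> Rn (n i)" and yi: "y i \<in> Rn (n i)"
        using x y unfolding lsup_space_def by auto
      show ?thesis
        using is_norm_on_diff_triangle[OF N xi zero_in yi]
          is_norm_on_diff_commute[OF N zero_in yi] A[of i] B[of i] by simp
    qed
    then show ?thesis unfolding bdd_above_def by auto
  qed
  have le: "N i (x i - y i) \<le> lsup_norm N (\<lambda>i. x i - y i)"
    if "x \<in> lsup_space n N" "y \<in> lsup_space n N" for x y i
    unfolding lsup_norm_def by (rule cSUP_upper[OF _ bdd[OF that]]) simp
  have mem: "x i \<in> Rn (n i)" if "x \<in> lsup_space n N" for x i
    using that unfolding lsup_space_def by auto
  show ?thesis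
  proof
    fix x y
    show "0 \<le> lsup_dist n N x y"
    proof (cases "x \<in> lsup_space n N \<and> y \<in> lsup_space n N")
      case True
      then have "0 \<le> N 0 (x 0 - y 0)" "N 0 (x 0 - y 0) \<le> lsup_norm N (\<lambda>i. x i - y i)"
        by (blast intro: pos Rn_diff mem, blast intro: le)
      with True show ?thesis by (simp add: lsup_dist_def)
    qed (auto simp: lsup_dist_def)
    show "lsup_dist n N x y = lsup_dist n N y x"
    proof (cases "x \<in> lsup_space n N \<and> y \<in> lsup_space n N")
      case True
      then have "N i (x i - y i) = N i (y i - x i)" for i
        by (intro is_norm_on_diff_commute[OF N] mem) auto
      with True show ?thesis by (simp add: lsup_dist_def lsup_norm_def)
    qed (auto simp: lsup_dist_def)
  next
    fix x y assume xy: "x \<in> lsup_space n N" "y \<in> lsup_space n N"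
    show "lsup_dist n N x y = 0 \<longleftrightarrow> x = y"
    proof
      assume eq: "lsup_dist n N x y = 0"
      have "x i - y i = 0" for i
      proof -
        have m: "x i - y i \<in> Rn (n i)" by (intro Rn_diff mem xy)
        have "N i (x i - y i) \<le> 0"
          using le[OF xy] eq xy by (simp add: lsup_dist_def)
        with pos[OF m] have "N i (x i - y i) = 0" by linarith
        with m N[of i] show ?thesis by (simp add: is_norm_on_def)
      qed
      then show "x = y" by (intro ext) simp
    next
      assume "x = y"
      moreover have "N i 0 = 0" for i
        using N[of i] zero_in[of "n i"] by (simp add: is_norm_on_def)
      ultimately show "lsup_dist n N x y = 0"
        unfolding lsup_dist_def lsup_norm_def by simp
    qed
  next
    fix x y z
    assume xyz: "x \<in> lsup_space n N" "y \<in> lsup_space n N" "z \<in> lsup_space n N"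
    have "N i (x i - z i) \<le> lsup_norm N (\<lambda>i. x i - y i) + lsup_norm N (\<lambda>i. y i - z i)" for i
      using is_norm_on_diff_triangle[OF N mem[OF xyz(1)] mem[OF xyz(2)] mem[OF xyz(3)], of i]
        le[OF xyz(1,2), of i] le[OF xyz(2,3), of i] by linarith
    then show "lsup_dist n N x z \<le> lsup_dist n N x y + lsup_dist n N y z"
      using xyz unfolding lsup_dist_def lsup_norm_def[of N "\<lambda>i. x i - z i"]
      by (auto intro: cSUP_least)
  qed
qed

subsection \<open>The network\<close>

text \<open>Essentially bounded measurable real function on the nonnegative half-line.\<close>

definition ess_bounded :: "(real \<Rightarrow> real) \<Rightarrow> bool" where
  "ess_bounded h \<longleftrightarrow> h \<in> borel_measurable (lebesgue_on {0..}) \<and>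
     (\<exists>C. AE t in lebesgue_on {0..}. \<bar>h t\<bar> \<le> C)"

text \<open>Solution of the subsystem \<open>z' = g z (w t) (v t)\<close>, \<open>z 0 = z0\<close>, on \<open>[0,T)\<close> in the sense of
  Caratheodory; the state space is \<open>Rn d\<close>.\<close>

definition subsystem_solution ::
  "nat \<Rightarrow> (linf \<Rightarrow> (nat \<Rightarrow> linf) \<Rightarrow> linf \<Rightarrow> linf) \<Rightarrow> linf \<Rightarrow> (real \<Rightarrow> nat \<Rightarrow> linf) \<Rightarrow> (real \<Rightarrow> linf) \<Rightarrow>
   ereal \<Rightarrow> (real \<Rightarrow> linf) \<Rightarrow> bool" where
  "subsystem_solution d g z0 w v T z \<longleftrightarrow> 0 < T \<and>
     (\<forall>t. 0 \<le> t \<and> ereal t < T \<longrightarrow> z t \<in> Rn d \<and>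
        (\<forall>k<d. set_integrable lebesgue {0..t} (\<lambda>s. g (z s) (w s) (v s) k) \<and>
           z t k = z0 k + (LINT s:{0..t}|lebesgue. g (z s) (w s) (v s) k)))"

text \<open>The internal input of subsystem \<open>i\<close> is a family \<open>(x\<^sub>j)\<close>, \<open>j \<in> I i\<close>, i.e.\ an element of
  an extensional product. The parameters \<open>nx i\<close> and \<open>nu i\<close> are the norms on \<open>Rn (n i)\<close> and
  \<open>Rn (m i)\<close>.\<close>

definition network ::
  "(nat \<Rightarrow> nat) \<Rightarrow> (nat \<Rightarrow> nat) \<Rightarrow> (nat \<Rightarrow> nat set) \<Rightarrow> (nat \<Rightarrow> linf \<Rightarrow> real) \<Rightarrow> (nat \<Rightarrow> linf \<Rightarrow> real) \<Rightarrow>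
   (nat \<Rightarrow> linf \<Rightarrow> (nat \<Rightarrow> linf) \<Rightarrow> linf \<Rightarrow> linf) \<Rightarrow> bool" where
  "network n m I nx nu f \<longleftrightarrow> (\<forall>i.
     0 < n i \<and> 0 < m i \<and> finite (I i) \<and> i \<notin> I i \<and>
     is_norm_on (Rn (n i)) (nx i) \<and> is_norm_on (Rn (m i)) (nu i) \<and>
     (\<forall>a\<in>Rn (n i). \<forall>b\<in>(\<Pi>\<^sub>E j\<in>I i. Rn (n j)). \<forall>c\<in>Rn (m i). f i a b c \<in> Rn (n i)) \<and>
     continuous_on (Rn (n i) \<times> (\<Pi>\<^sub>E j\<in>I i. Rn (n j)) \<times> Rn (m i)) (\<lambda>(a, b, c). f i a b c) \<and>
     (\<forall>z0\<in>Rn (n i). \<forall>w v.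
        (\<forall>t\<ge>0. w t \<in> (\<Pi>\<^sub>E j\<in>I i. Rn (n j)) \<and> v t \<in> Rn (m i)) \<and>
        (\<forall>j\<in>I i. \<forall>k<n j. ess_bounded (\<lambda>t. apply_bcontfun (w t j) k)) \<and> (\<forall>k<m i. ess_bounded (\<lambda>t. apply_bcontfun (v t) k)) \<longrightarrow>
        (\<exists>T z. subsystem_solution (n i) (f i) z0 w v T z) \<and>
        (\<forall>T1 z1 T2 z2. subsystem_solution (n i) (f i) z0 w v T1 z1 \<and>
           subsystem_solution (n i) (f i) z0 w v T2 z2 \<longrightarrow>
           (\<forall>t. 0 \<le> t \<and> ereal t < T1 \<and> ereal t < T2 \<longrightarrow> z1 t = z2 t))))"

definition network_rhs ::
  "(nat \<Rightarrow> nat set) \<Rightarrow> (nat \<Rightarrow> linf \<Rightarrow> (nat \<Rightarrow> linf) \<Rightarrow> linf \<Rightarrow> linf) \<Rightarrow>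
   (nat \<Rightarrow> linf) \<Rightarrow> (nat \<Rightarrow> linf) \<Rightarrow> (nat \<Rightarrow> linf)" where
  "network_rhs I f x u = (\<lambda>i. f i (x i) (restrict x (I i)) (u i))"

text \<open>Input functions. As functions that are continuous on countably many intervals covering the
  half-line they are strongly measurable. Finitely many intervals are covered by subdividing the
  last one.\<close>

definition inputs ::
  "(nat \<Rightarrow> nat) \<Rightarrow> (nat \<Rightarrow> linf \<Rightarrow> real) \<Rightarrow> (real \<Rightarrow> nat \<Rightarrow> linf) set" where
  "inputs m nu = {u.
     (\<forall>t\<ge>0. u t \<in> lsup_space m nu) \<and>
     esssup (lebesgue_on {0..}) (\<lambda>t. ereal (lsup_norm nu (u t))) < \<infinity> \<and>
     (\<exists>a::nat \<Rightarrow> real. a 0 = 0 \<and> strict_mono a \<and> filterlim a at_top sequentially \<and>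
        (\<forall>k. continuous_map (top_of_set {a k..<a (Suc k)}) (lsup_topology m nu) u))}"

definition input_norm :: "(nat \<Rightarrow> linf \<Rightarrow> real) \<Rightarrow> (real \<Rightarrow> nat \<Rightarrow> linf) \<Rightarrow> real" where
  "input_norm nu u = real_of_ereal (esssup (lebesgue_on {0..}) (\<lambda>t. ereal (lsup_norm nu (u t))))"

subsection \<open>Bochner integral and solutions\<close>

text \<open>The Bochner integral of the library requires a second countable type, whereas the spaces
  considered here are not separable; hence the usual definition by simple functions is repeated.
  \<open>S\<close> is meant to be a compact interval. The almost everywhere convergence of simple functions
  is strong measurability.\<close>

definition simple_integral_on ::
  "real set \<Rightarrow> (real \<Rightarrow> nat \<Rightarrow> linf) \<Rightarrow> nat \<Rightarrow> linf" where
  "simple_integral_on S s =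
     (\<lambda>i. \<Sum>v\<in>s ` S. measure (lebesgue_on S) {t \<in> S. s t = v} *\<^sub>R v i)"

definition has_bochner_integral_on ::
  "(nat \<Rightarrow> nat) \<Rightarrow> (nat \<Rightarrow> linf \<Rightarrow> real) \<Rightarrow> real set \<Rightarrow> (real \<Rightarrow> nat \<Rightarrow> linf) \<Rightarrow> (nat \<Rightarrow> linf) \<Rightarrow> bool"
  where
  "has_bochner_integral_on n N S g y \<longleftrightarrow>
     (\<forall>t\<in>S. g t \<in> lsup_space n N) \<and>
     (\<exists>s. (\<forall>k. simple_function (lebesgue_on S) (s k) \<and> (\<forall>t\<in>S. s k t \<in> lsup_space n N)) \<and>
        (AE t in lebesgue_on S. limitin (lsup_topology n N) (\<lambda>k. s k t) (g t) sequentially) \<and>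
        (\<lambda>k. \<integral>\<^sup>+t. ennreal (lsup_dist n N (s k t) (g t)) \<partial>lebesgue_on S) \<longlonglongrightarrow> 0 \<and>
        limitin (lsup_topology n N) (\<lambda>k. simple_integral_on S (s k)) y sequentially)"

text \<open>Solution on \<open>[0,T)\<close> of \<open>x' = F x (u t)\<close>, \<open>x 0 = x0\<close>.\<close>

definition is_solution ::
  "(nat \<Rightarrow> nat) \<Rightarrow> (nat \<Rightarrow> linf \<Rightarrow> real) \<Rightarrow> ((nat \<Rightarrow> linf) \<Rightarrow> (nat \<Rightarrow> linf) \<Rightarrow> (nat \<Rightarrow> linf)) \<Rightarrow>
   (nat \<Rightarrow> linf) \<Rightarrow> (real \<Rightarrow> nat \<Rightarrow> linf) \<Rightarrow> ereal \<Rightarrow> (real \<Rightarrow> nat \<Rightarrow> linf) \<Rightarrow> bool" where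
  "is_solution n nx F x0 u T x \<longleftrightarrow> 0 < T \<and>
     (\<forall>t. 0 \<le> t \<and> ereal t < T \<longrightarrow> x t \<in> lsup_space n nx \<and>
        has_bochner_integral_on n nx {0..t} (\<lambda>s. F (x s) (u s)) (\<lambda>i. x t i - x0 i))"

definition well_posed ::
  "(nat \<Rightarrow> nat) \<Rightarrow> (nat \<Rightarrow> linf \<Rightarrow> real) \<Rightarrow> (nat \<Rightarrow> nat) \<Rightarrow> (nat \<Rightarrow> linf \<Rightarrow> real) \<Rightarrow>
   ((nat \<Rightarrow> linf) \<Rightarrow> (nat \<Rightarrow> linf) \<Rightarrow> (nat \<Rightarrow> linf)) \<Rightarrow> bool" where
  "well_posed n nx m nu F \<longleftrightarrow> (\<forall>x0\<in>lsup_space n nx. \<forall>u\<in>inputs m nu.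
     (\<exists>T x. is_solution n nx F x0 u T x) \<and>
     (\<forall>T1 x1 T2 x2. is_solution n nx F x0 u T1 x1 \<and> is_solution n nx F x0 u T2 x2 \<longrightarrow>
        (\<forall>t. 0 \<le> t \<and> ereal t < T1 \<and> ereal t < T2 \<longrightarrow> x1 t = x2 t)))"

definition flow ::
  "(nat \<Rightarrow> nat) \<Rightarrow> (nat \<Rightarrow> linf \<Rightarrow> real) \<Rightarrow> ((nat \<Rightarrow> linf) \<Rightarrow> (nat \<Rightarrow> linf) \<Rightarrow> (nat \<Rightarrow> linf)) \<Rightarrow>
   real \<Rightarrow> (nat \<Rightarrow> linf) \<Rightarrow> (real \<Rightarrow> nat \<Rightarrow> linf) \<Rightarrow> (nat \<Rightarrow> linf)" where
  "flow n nx F t x0 u = (THE y. \<exists>T x. is_solution n nx F x0 u T x \<and> ereal t < T \<and> x t = y)"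

definition boundedness_implies_continuation ::
  "(nat \<Rightarrow> nat) \<Rightarrow> (nat \<Rightarrow> linf \<Rightarrow> real) \<Rightarrow> (nat \<Rightarrow> nat) \<Rightarrow> (nat \<Rightarrow> linf \<Rightarrow> real) \<Rightarrow>
   ((nat \<Rightarrow> linf) \<Rightarrow> (nat \<Rightarrow> linf) \<Rightarrow> (nat \<Rightarrow> linf)) \<Rightarrow> bool" where
  "boundedness_implies_continuation n nx m nu F \<longleftrightarrow>
     (\<forall>x0\<in>lsup_space n nx. \<forall>u\<in>inputs m nu. \<forall>T::real. \<forall>x.
        is_solution n nx F x0 u (ereal T) x \<and> (\<exists>C. \<forall>t\<in>{0..<T}. lsup_norm nx (x t) \<le> C) \<longrightarrow>
        (\<exists>T' x'. ereal T < T' \<and> is_solution n nx F x0 u T' x' \<and> (\<forall>t\<in>{0..<T}. x' t = x t)))"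

subsection \<open>ISS Lyapunov functions\<close>

definition upper_dini ::
  "(nat \<Rightarrow> nat) \<Rightarrow> (nat \<Rightarrow> linf \<Rightarrow> real) \<Rightarrow> ((nat \<Rightarrow> linf) \<Rightarrow> (nat \<Rightarrow> linf) \<Rightarrow> (nat \<Rightarrow> linf)) \<Rightarrow>
   ((nat \<Rightarrow> linf) \<Rightarrow> real) \<Rightarrow> (real \<Rightarrow> nat \<Rightarrow> linf) \<Rightarrow> (nat \<Rightarrow> linf) \<Rightarrow> ereal" where
  "upper_dini n nx F V u x =
     Limsup (at_right 0) (\<lambda>t. ereal ((V (flow n nx F t x u) - V x) / t))"

definition lyapunov_candidate ::
  "(nat \<Rightarrow> nat) \<Rightarrow> (nat \<Rightarrow> linf \<Rightarrow> real) \<Rightarrow> ((nat \<Rightarrow> linf) \<Rightarrow> real) \<Rightarrow> bool" where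
  "lyapunov_candidate n nx V \<longleftrightarrow>
     (\<forall>x\<in>lsup_space n nx. 0 \<le> V x) \<and>
     continuous_map (lsup_topology n nx) euclideanreal V \<and>
     (\<exists>\<psi>1 \<psi>2. class_K_inf \<psi>1 \<and> class_K_inf \<psi>2 \<and>
        (\<forall>x\<in>lsup_space n nx. \<psi>1 (lsup_norm nx x) \<le> V x \<and> V x \<le> \<psi>2 (lsup_norm nx x)))"

definition ISS_Lyapunov_implication ::
  "(nat \<Rightarrow> nat) \<Rightarrow> (nat \<Rightarrow> linf \<Rightarrow> real) \<Rightarrow> (nat \<Rightarrow> nat) \<Rightarrow> (nat \<Rightarrow> linf \<Rightarrow> real) \<Rightarrow>
   ((nat \<Rightarrow> linf) \<Rightarrow> (nat \<Rightarrow> linf) \<Rightarrow> (nat \<Rightarrow> linf)) \<Rightarrow> ((nat \<Rightarrow> linf) \<Rightarrow> real) \<Rightarrow> bool" where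
  "ISS_Lyapunov_implication n nx m nu F V \<longleftrightarrow> lyapunov_candidate n nx V \<and>
     (\<exists>\<gamma> \<alpha>. class_K \<gamma> \<and> class_P \<alpha> \<and>
        (\<forall>x\<in>lsup_space n nx. \<forall>u\<in>inputs m nu.
           V x > \<gamma> (input_norm nu u) \<longrightarrow> upper_dini n nx F V u x \<le> ereal (- \<alpha> (V x))))"

definition ISS_Lyapunov_dissipative ::
  "(nat \<Rightarrow> nat) \<Rightarrow> (nat \<Rightarrow> linf \<Rightarrow> real) \<Rightarrow> (nat \<Rightarrow> nat) \<Rightarrow> (nat \<Rightarrow> linf \<Rightarrow> real) \<Rightarrow>
   ((nat \<Rightarrow> linf) \<Rightarrow> (nat \<Rightarrow> linf) \<Rightarrow> (nat \<Rightarrow> linf)) \<Rightarrow> ((nat \<Rightarrow> linf) \<Rightarrow> real) \<Rightarrow> bool" where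
  "ISS_Lyapunov_dissipative n nx m nu F V \<longleftrightarrow> lyapunov_candidate n nx V \<and>
     (\<exists>\<alpha> \<rho>. class_K_inf \<alpha> \<and> class_K \<rho> \<and>
        (\<forall>x\<in>lsup_space n nx. \<forall>u\<in>inputs m nu.
           upper_dini n nx F V u x \<le> ereal (- \<alpha> (V x) + \<rho> (input_norm nu u))))"

definition sup_lyapunov :: "linf \<Rightarrow> (nat \<Rightarrow> linf \<Rightarrow> real) \<Rightarrow> (nat \<Rightarrow> linf) \<Rightarrow> real" where
  "sup_lyapunov s0 V x = (SUP i. 1 / s0 i * V i (x i))"

end

theory Submission
  imports Defs
begin

text \<open>Write \<open>\<Gamma>\<close> for the gain operator and \<open>V(x) = sup\<^sub>i V\<^sub>i(x\<^sub>i) / s\<^sub>i\<close>. Everything rests on a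
weight sequence \<open>s \<ge> 1\<close> with \<open>\<Gamma> s \<le> c s\<close> for some \<open>c < 1\<close>. Such a sequence exists because
\<open>r(\<Gamma>) < 1\<close>: if \<open>r(\<Gamma>) < c\<close>, then \<open>\<parallel>\<Gamma>\<^sup>N 1\<parallel> \<le> c\<^sup>N\<close> for some \<open>N \<ge> 1\<close>, and \<open>s = \<Sum>\<^sub>k\<^sub><\<^sub>N c\<^sup>-\<^sup>k \<Gamma>\<^sup>k 1\<close>
has the required property, since \<open>\<Gamma>\<close> is subadditive and the sum telescopes
(\<open>cone_operator.strict_decay_point\<close>). With these weights
\<open>\<mu>\<^sub>i((\<gamma>\<^sub>i\<^sub>j V\<^sub>j(x\<^sub>j))\<^sub>j) \<le> c V(x) s\<^sub>i\<close>, so a component dissipates as soon as \<open>V\<^sub>i(x\<^sub>i) / s\<^sub>i\<close>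
exceeds \<open>c V(x)\<close> and the input gain. Let \<open>\<gamma>\<close> be a common bound of the input gains. If
\<open>V(x) > \<gamma>(\<parallel>u\<parallel>)\<close>, then all components dissipate whose weighted value is close to the supremum.

To pass from components to the supremum over infinitely many of them, every estimate has to be
uniform in \<open>i\<close>. The trajectory is continuous in the supremum norm and the \<open>V\<^sub>i\<close> are
equi-Lipschitz on balls, so there is one time interval on which the components that start
clearly below \<open>V(x)\<close> stay below it, while each of the remaining ones dissipates and decreases
at a common rate by the mean value theorem (\<open>flow_decay\<close>). This gives
\<open>V(\<phi>(t)) \<le> V(x) - t b(V(x))\<close> for small \<open>t\<close> whenever \<open>V(x) > \<gamma>(\<parallel>u\<parallel>)\<close>, and hence the implication
form. Both properties of trajectories that enter, continuity in the supremum norm and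
differentiability of the components, follow from one estimate for increments of Bochner
primitives (\<open>bochner_increment\<close>), which is proved directly with simple functions.

For the dissipative form, \<open>b\<close> is chosen 1-Lipschitz. Then the solution \<open>\<xi>\<close> of \<open>\<xi>' b = \<xi>\<close> has a
nondecreasing derivative, so that \<open>\<xi>'(0)\<close> exists, \<open>\<xi>\<close> is unbounded, and the decay of \<open>V\<close> turns
into \<open>D\<^sup>+(\<xi> \<circ> V) \<le> - \<xi> \<circ> V\<close> (\<open>scaling_exists\<close>). It remains to bound \<open>D\<^sup>+(\<xi> \<circ> V)\<close> on the region
\<open>V(x) \<le> \<gamma>(\<parallel>u\<parallel>)\<close> by a function of class \<open>K\<close> in \<open>\<parallel>u\<parallel>\<close>. There \<open>\<parallel>x\<parallel>\<close> is controlled by \<open>\<parallel>u\<parallel>\<close>, and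
\<open>V\<close> grows at most at the rate \<open>L C\<close>, where \<open>L\<close> is the common Lipschitz constant and \<open>C\<close> bounds
\<open>f\<close>. Since \<open>L(R) \<rightarrow> 0\<close> as \<open>R \<rightarrow> 0\<close> while \<open>C\<close> stays bounded, the product tends to \<open>0\<close> with \<open>\<parallel>u\<parallel>\<close>,
and \<open>class_K_majorant\<close> applies.\<close>

section \<open>Comparison functions and scalings\<close>

lemma class_P_nonneg: "class_P a \<Longrightarrow> 0 \<le> r \<Longrightarrow> 0 \<le> a r"
  unfolding class_P_def by (metis less_eq_real_def order_refl)

lemma class_K_inf_D:
  assumes "class_K_inf \<psi>"
  shows "class_K \<psi>" "class_P \<psi>" "continuous_on {0..} \<psi>" "\<psi> 0 = 0" "strict_mono_on {0..} \<psi>"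
  using assms unfolding class_K_inf_def class_K_def class_P_def by auto

lemma class_K_D:
  assumes "class_K \<psi>"
  shows "class_P \<psi>" "continuous_on {0..} \<psi>" "\<psi> 0 = 0" "strict_mono_on {0..} \<psi>"
  using assms unfolding class_K_def class_P_def by auto

lemma class_K_mono: "class_K \<psi> \<Longrightarrow> 0 \<le> r \<Longrightarrow> r \<le> s \<Longrightarrow> \<psi> r \<le> \<psi> s"
  using strict_mono_on_leD[OF class_K_D(4)] by auto

lemma class_K_less_iff: "class_K \<psi> \<Longrightarrow> 0 \<le> r \<Longrightarrow> 0 \<le> s \<Longrightarrow> \<psi> r < \<psi> s \<longleftrightarrow> r < s"
  using strict_mono_on_less[OF class_K_D(4)] by auto

lemma class_K_inf_unbounded:
  assumes "class_K_inf \<psi>"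
  obtains r where "0 \<le> r" "b < \<psi> r"
proof -
  have "\<not> bdd_above (\<psi> ` {0..})" using assms unfolding class_K_inf_def by blast
  then have "\<not> (\<forall>r\<ge>0. \<psi> r \<le> b)" unfolding bdd_above_def by blast
  then show ?thesis using that by (meson not_le)
qed

lemma class_K_small:
  assumes "class_K \<psi>" "0 < \<epsilon>"
  obtains \<delta> where "0 < \<delta>" "\<And>r. 0 \<le> r \<Longrightarrow> r \<le> \<delta> \<Longrightarrow> \<psi> r < \<epsilon>"
proof -
  from class_K_D(2)[OF assms(1)] obtain d where d: "0 < d"
    "\<And>r. r \<in> {0..} \<Longrightarrow> dist r 0 < d \<Longrightarrow> dist (\<psi> r) (\<psi> 0) < \<epsilon>"
    unfolding continuous_on_iff using assms(2) by (metis atLeast_iff order_refl)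
  show ?thesis
  proof (rule that[of "d/2"])
    show "0 < d/2" using d by simp
    fix r :: real assume "0 \<le> r" "r \<le> d/2"
    with d(2)[of r] d(1) class_K_D(3)[OF assms(1)] show "\<psi> r < \<epsilon>"
      by (simp add: dist_real_def)
  qed
qed

lemma class_K_inf_id: "class_K_inf (\<lambda>r. r)"
  unfolding class_K_inf_def class_K_def class_P_def
proof (intro conjI)
  show "\<not> bdd_above ((\<lambda>r. r) ` {0::real..})"
  proof
    assume "bdd_above ((\<lambda>r. r) ` {0::real..})"
    then obtain B :: real where "\<And>r. 0 \<le> r \<Longrightarrow> r \<le> B" unfolding bdd_above_def by auto
    from this[of "\<bar>B\<bar> + 1"] show False by simp
  qed
qed (auto simp: strict_mono_on_def)

lemma class_K_inf_scale:
  assumes "class_K_inf \<psi>" "0 < c"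
  shows "class_K_inf (\<lambda>r. c * \<psi> r)"
proof -
  note D = class_K_inf_D[OF assms(1)]
  have "\<not> bdd_above ((\<lambda>r. c * \<psi> r) ` {0..})"
  proof
    assume "bdd_above ((\<lambda>r. c * \<psi> r) ` {0..})"
    then obtain B where B: "\<And>r. 0 \<le> r \<Longrightarrow> c * \<psi> r \<le> B" unfolding bdd_above_def by auto
    obtain r where "0 \<le> r" "B / c < \<psi> r" using class_K_inf_unbounded[OF assms(1)] by blast
    with B[of r] assms(2) show False by (simp add: field_simps)
  qed
  with D assms(2) show ?thesis
    unfolding class_K_inf_def class_K_def class_P_def strict_mono_on_def
    by (auto intro!: continuous_intros)
qed

lemma class_K_inf_compose:
  assumes "class_K_inf \<xi>" "class_K_inf \<psi>"
  shows "class_K_inf (\<xi> \<circ> \<psi>)"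
proof -
  note X = class_K_inf_D[OF assms(1)] and D = class_K_inf_D[OF assms(2)]
  have im: "\<psi> ` {0..} \<subseteq> {0..}" using class_P_nonneg[OF D(2)] by auto
  have "\<not> bdd_above ((\<xi> \<circ> \<psi>) ` {0..})"
  proof
    assume "bdd_above ((\<xi> \<circ> \<psi>) ` {0..})"
    then obtain B where B: "\<And>r. 0 \<le> r \<Longrightarrow> \<xi> (\<psi> r) \<le> B" unfolding bdd_above_def by auto
    obtain s where s: "0 \<le> s" "B < \<xi> s" using class_K_inf_unbounded[OF assms(1)] by blast
    obtain r where r: "0 \<le> r" "s < \<psi> r" using class_K_inf_unbounded[OF assms(2)] by blast
    have "\<xi> s \<le> \<xi> (\<psi> r)" using class_K_mono[OF X(1)] s r by simp
    with B[of r] s r show False by simp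
  qed
  moreover have "continuous_on {0..} (\<xi> \<circ> \<psi>)"
    using continuous_on_compose[OF D(3)] continuous_on_subset[OF X(3) im] by blast
  ultimately show ?thesis
    using X D im unfolding class_K_inf_def class_K_def class_P_def strict_mono_on_def
    by (auto simp: image_subset_iff)
qed

text \<open>The infimal convolution of \<open>p \<mapsto> a (\<theta> * p)\<close> with the distance, minimised over \<open>\<theta>\<close> as well.
An infimum of 1-Lipschitz functions is 1-Lipschitz. It is positive at \<open>r > 0\<close> because
\<open>a (\<theta> * p)\<close> is bounded away from \<open>0\<close> as long as \<open>p\<close> is within \<open>r / 2\<close> of \<open>r\<close>. The factor \<open>\<theta>\<close>
absorbs the ratio between the value of one component and the weighted supremum.\<close>

lemma class_P_lipschitz_minorant:
  assumes a: "class_P a" and c: "0 < c" and d: "c \<le> d"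
  obtains b where "class_P b" "\<And>r s. \<bar>b r - b s\<bar> \<le> \<bar>r - s\<bar>"
    "\<And>r \<theta>. 0 \<le> r \<Longrightarrow> \<theta> \<in> {c..d} \<Longrightarrow> b r \<le> a (\<theta> * r)"
proof -
  define P where "P = {0::real..} \<times> {c..d}"
  define g where "g r = (\<lambda>(p, \<theta>). a (\<theta> * p) + \<bar>p - r\<bar>)" for r
  define b where "b r = (INF z\<in>P. g r z)" for r
  have P_ne: "P \<noteq> {}" using d unfolding P_def by auto
  have g0: "0 \<le> g r z" if z: "z \<in> P" for r z
  proof -
    obtain p \<theta> where p: "z = (p, \<theta>)" "0 \<le> p" "c \<le> \<theta>" using z unfolding P_def by auto
    then have "0 \<le> a (\<theta> * p)" using c by (intro class_P_nonneg[OF a]) simp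
    then show ?thesis using p unfolding g_def by simp
  qed
  have bdd: "bdd_below (g r ` P)" for r
    using g0 by (meson bdd_belowI2)
  have le: "b r \<le> g r z" if "z \<in> P" for r z
    unfolding b_def by (rule cINF_lower[OF bdd that])
  have lip1: "b r \<le> b s + \<bar>r - s\<bar>" for r s
  proof -
    have "b r - \<bar>r - s\<bar> \<le> g s z" if "z \<in> P" for z
      using le[OF that, of r] unfolding g_def by (auto split: prod.splits)
    then have "b r - \<bar>r - s\<bar> \<le> b s"
      unfolding b_def[of s] by (rule cINF_greatest[OF P_ne])
    then show ?thesis by simp
  qed
  have lip: "\<bar>b r - b s\<bar> \<le> \<bar>r - s\<bar>" for r s
    using lip1[of r s] lip1[of s r] by (simp add: abs_minus_commute abs_le_iff)
  have minor: "b r \<le> a (\<theta> * r)" if "0 \<le> r" "\<theta> \<in> {c..d}" for r \<theta>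
    using le[of "(r, \<theta>)" r] that unfolding P_def g_def by simp
  have b_nonneg: "0 \<le> b r" for r
    unfolding b_def by (rule cINF_greatest[OF P_ne g0])
  have b0: "b 0 = 0"
    using minor[of 0 c] b_nonneg[of 0] d a unfolding class_P_def by simp
  have pos: "0 < b r" if r: "0 < r" for r
  proof -
    have "compact {c*(r/2)..d*(3/2*r)}" by simp
    moreover have "{c*(r/2)..d*(3/2*r)} \<noteq> {}"
      using c d r mult_mono[of c d "r/2" "3/2*r"] by auto
    moreover have "continuous_on {c*(r/2)..d*(3/2*r)} a"
    proof (rule continuous_on_subset[of "{0..}"])
      have "0 \<le> c * (r/2)" using c r by simp
      then show "{c*(r/2)..d*(3/2*r)} \<subseteq> {0..}" by (simp add: subset_iff)
    qed (use a class_P_def in blast)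
    ultimately obtain q where q: "q \<in> {c*(r/2)..d*(3/2*r)}"
      "\<And>p. p \<in> {c*(r/2)..d*(3/2*r)} \<Longrightarrow> a q \<le> a p"
      using continuous_attains_inf[of "{c*(r/2)..d*(3/2*r)}" a] by blast
    have "0 < c * (r/2)" using c r by simp
    then have "0 < q" using q(1) by simp
    then have aq: "0 < a q" using a unfolding class_P_def by simp
    have "min (r/2) (a q) \<le> g r z" if z: "z \<in> P" for z
    proof -
      obtain p \<theta> where p: "z = (p, \<theta>)" "0 \<le> p" "c \<le> \<theta>" "\<theta> \<le> d" using z unfolding P_def by auto
      have a0: "0 \<le> a (\<theta> * p)" using class_P_nonneg[OF a] p c by simp
      show ?thesis
      proof (cases "\<bar>p - r\<bar> \<ge> r/2")
        case True then show ?thesis using a0 p unfolding g_def by (auto simp: min_le_iff_disj)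
      next
        case False
        then have "r/2 \<le> p" "p \<le> 3/2*r" by linarith+
        then have "\<theta> * p \<in> {c*(r/2)..d*(3/2*r)}"
          using mult_mono[of c \<theta> "r/2" p] mult_mono[of \<theta> d p "3/2*r"] p c r
            \<open>r/2 \<le> p\<close> by simp
        from q(2)[OF this] show ?thesis using p unfolding g_def by simp
      qed
    qed
    then have "min (r/2) (a q) \<le> b r" unfolding b_def by (rule cINF_greatest[OF P_ne])
    then show ?thesis using aq r by auto
  qed
  have "continuous_on {0..} b"
    unfolding continuous_on_iff dist_real_def using lip
    by (metis abs_minus_commute order_le_less_trans)
  then have "class_P b" using b0 pos unfolding class_P_def by simp
  from that[OF this lip minor] show ?thesis .
qed

text \<open>The average of a nondecreasing \<open>M\<close> over \<open>[r, 2r]\<close> is continuous, nondecreasing and lies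
between \<open>M r\<close> and \<open>M (2r)\<close>. Adding \<open>r\<close> makes it strictly increasing.\<close>

lemma mono_class_K_majorant:
  assumes mono: "mono_on {0..} M" and M0: "\<And>r. 0 \<le> r \<Longrightarrow> (0::real) \<le> M r"
    and small: "\<And>\<epsilon>. 0 < \<epsilon> \<Longrightarrow> \<exists>\<delta>>0. M \<delta> \<le> \<epsilon>"
  obtains \<rho> where "class_K \<rho>" "\<And>r. 0 \<le> r \<Longrightarrow> M r \<le> \<rho> r"
proof -
  have Mm: "M r \<le> M s" if "0 \<le> r" "r \<le> s" for r s
    using mono that unfolding mono_on_def by auto
  define J where "J r = integral {1..2} (\<lambda>s. M (r * s))" for r
  have int1: "(\<lambda>s. M (r * s)) integrable_on {1..2}" if "0 \<le> r" for r
    using that by (intro integrable_on_mono_on mono_onI Mm) (auto intro: mult_left_mono)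
  have Jmono: "J r \<le> J s" if "0 \<le> r" "r \<le> s" for r s
    unfolding J_def using that by (intro integral_le int1 Mm) (auto intro: mult_right_mono)
  have Jge: "M r \<le> J r" if "0 \<le> r" for r
  proof -
    have "integral {1..2} (\<lambda>s::real. M r) \<le> J r"
      unfolding J_def using that
      by (intro integral_le int1 Mm) (auto simp: mult_le_cancel_left1)
    then show ?thesis by simp
  qed
  have Jle: "J r \<le> M (2 * r)" if "0 \<le> r" for r
  proof -
    have "J r \<le> integral {1..2} (\<lambda>s::real. M (2*r))"
      unfolding J_def using that
      by (intro integral_le int1 Mm) (auto simp: mult.commute[of r] intro: mult_right_mono)
    then show ?thesis by simp
  qed
  have M00: "M 0 = 0"
  proof (rule ccontr)
    assume "M 0 \<noteq> 0"
    then have "0 < M 0 / 2" using M0[of 0] by simp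
    from small[OF this] obtain d where "0 < d" "M d \<le> M 0 / 2" by blast
    with Mm[of 0 d] \<open>0 < M 0 / 2\<close> show False by simp
  qed
  have J0: "J 0 = 0" unfolding J_def by (simp add: M00)
  have Jcont: "continuous (at r within {0..}) J" if r: "0 \<le> r" for r
  proof (cases "r = 0")
    case True
    show ?thesis unfolding continuous_within_eps_delta True J0 dist_real_def
    proof (intro allI impI)
      fix e :: real assume "0 < e"
      then obtain d where d: "0 < d" "M d \<le> e/2" using small[of "e/2"] by auto
      show "\<exists>\<delta>>0. \<forall>x\<in>{0..}. \<bar>x - 0\<bar> < \<delta> \<longrightarrow> \<bar>J x - 0\<bar> < e"
      proof (intro exI[of _ "d/2"] conjI ballI impI)
        show "0 < d/2" using d by simp
        fix x :: real assume "x \<in> {0..}" "\<bar>x - 0\<bar> < d/2"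
        then have "0 \<le> x" "2 * x \<le> d" by auto
        then have "J x \<le> e/2" "0 \<le> J x"
          using Jle[of x] Mm[of "2*x" d] d(2) Jge[of x] M0[of x] by auto
        then show "\<bar>J x - 0\<bar> < e" using \<open>0 < e\<close> by simp
      qed
    qed
  next
    case False
    then have r: "0 < r" using r by simp
    define G where "G x = integral {0..x} M" for x
    have intM: "M integrable_on {x..y}" if "0 \<le> x" for x y
      using that by (intro integrable_on_mono_on mono_onI Mm) auto
    have Gc: "continuous_on {0..4*r} G"
      unfolding G_def by (rule indefinite_integral_continuous_1[OF intM]) simp
    have GJ: "J x = (G (2*x) - G x) / x" if "0 < x" for x
    proof -
      have "(M has_integral (G (2*x) - G x)) {x..2*x}"
      proof -
        have "G x + integral {x..2*x} M = G (2*x)"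
          unfolding G_def using that
          by (intro Henstock_Kurzweil_Integration.integral_combine intM) auto
        then have "G (2*x) - G x = integral {x..2*x} M" by simp
        then show ?thesis using integrable_integral[OF intM[of x "2*x"]] that by simp
      qed
      then have "(M has_integral (G (2*x) - G x)) (cbox x (2*x))" by simp
      from has_integral_affinity[OF this, of x 0] that
      have "((\<lambda>s. M (x * s)) has_integral ((G (2*x) - G x) / x)) ((\<lambda>y. inverse x * y) ` {x..2*x})"
        by (simp add: field_simps)
      moreover have "(\<lambda>y. inverse x * y) ` {x..2*x} = {1..2}"
        using that by (simp add: image_mult_atLeastAtMost field_simps)
      ultimately show ?thesis unfolding J_def by (simp add: integral_unique)
    qed
    have "continuous_on {r/2<..<2*r} (\<lambda>x. (G (2*x) - G x) / x)"
      using r by (intro continuous_intros continuous_on_subset[OF Gc]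
        continuous_on_compose2[OF Gc, of _ "\<lambda>x. 2*x"]) auto
    then have "isCont (\<lambda>x. (G (2*x) - G x) / x) r"
      using r by (auto simp: continuous_on_eq_continuous_at)
    moreover have "\<forall>\<^sub>F x in nhds r. x > 0"
      using r eventually_nhds_in_open[of "{0<..}" r] by simp
    then have "\<forall>\<^sub>F x in nhds r. (G (2*x) - G x) / x = J x"
      by eventually_elim (simp add: GJ)
    ultimately have "isCont J r" by (simp add: isCont_cong)
    then show ?thesis by (rule continuous_at_imp_continuous_within)
  qed
  have "class_K (\<lambda>r. r + J r)"
    unfolding class_K_def class_P_def
  proof (intro conjI allI impI)
    show "continuous_on {0..} (\<lambda>r. r + J r)"
      using Jcont by (intro continuous_intros) (auto simp: continuous_on_eq_continuous_within)
    show "0 < r + J r" if "0 < r" for r using that Jge[of r] M0[of r] by simp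
    show "strict_mono_on {0..} (\<lambda>r. r + J r)"
      unfolding strict_mono_on_def using Jmono by (auto intro!: add_less_le_mono)
  qed (simp add: J0)
  then show ?thesis using that Jge by (metis add_increasing order.refl)
qed

text \<open>Bounds that depend on a point only through its size can be collected in one function of
class \<open>K\<close>, provided that they are locally bounded and tend to \<open>0\<close> with the size.\<close>

lemma class_K_majorant:
  fixes D :: "'a \<Rightarrow> ereal" and size :: "'a \<Rightarrow> real"
  assumes size0: "\<And>a. a \<in> A \<Longrightarrow> 0 \<le> size a"
    and bounded: "\<And>R. 0 < R \<Longrightarrow> \<exists>B. \<forall>a\<in>A. size a \<le> R \<longrightarrow> D a \<le> ereal B"
    and small: "\<And>\<epsilon>. 0 < \<epsilon> \<Longrightarrow> \<exists>\<delta>>0. \<forall>a\<in>A. size a \<le> \<delta> \<longrightarrow> D a \<le> ereal \<epsilon>"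
  obtains \<rho> where "class_K \<rho>" "\<And>a. a \<in> A \<Longrightarrow> D a \<le> ereal (\<rho> (size a))"
proof -
  define B where "B r = insert 0 {b. \<exists>a\<in>A. size a \<le> r \<and> ereal b \<le> D a}" for r
  define M where "M r = Sup (B r)" for r
  have bdd: "bdd_above (B r)" for r
  proof -
    obtain b where b: "\<forall>a\<in>A. size a \<le> max r 1 \<longrightarrow> D a \<le> ereal b"
      using bounded[of "max r 1"] by (auto simp: less_max_iff_disj)
    have "x \<le> max b 0" if x: "x \<in> B r" for x
    proof (cases "x = 0")
      case False
      then obtain a where "a \<in> A" "size a \<le> r" "ereal x \<le> D a" using x unfolding B_def by blast
      with b have "ereal x \<le> ereal b" by (meson max.coboundedI1 order_trans)
      then show ?thesis by simp
    qed simp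
    then show ?thesis unfolding bdd_above_def by blast
  qed
  have M0: "0 \<le> M r" for r unfolding M_def by (rule cSup_upper[OF _ bdd]) (simp add: B_def)
  have "mono_on {0..} M"
    unfolding M_def mono_on_def
    by (intro allI impI cSup_subset_mono bdd) (auto simp: B_def intro: order_trans)
  moreover have "\<exists>\<delta>>0. M \<delta> \<le> \<epsilon>" if pos: "0 < \<epsilon>" for \<epsilon>
  proof -
    obtain \<delta> where d: "0 < \<delta>" "\<forall>a\<in>A. size a \<le> \<delta> \<longrightarrow> D a \<le> ereal \<epsilon>" using small[OF pos] by blast
    have "x \<le> \<epsilon>" if "x \<in> B \<delta>" for x
      using that \<open>0 < \<epsilon>\<close> d(2) unfolding B_def by (auto dest: order_trans)
    then have "M \<delta> \<le> \<epsilon>" unfolding M_def by (intro cSup_least) (auto simp: B_def)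
    with d(1) show ?thesis by blast
  qed
  ultimately obtain \<rho> where \<rho>: "class_K \<rho>" "\<And>r. 0 \<le> r \<Longrightarrow> M r \<le> \<rho> r"
    using mono_class_K_majorant[of M] M0 by metis
  have "D a \<le> ereal (\<rho> (size a))" if a: "a \<in> A" for a
  proof (cases "D a")
    case (real x)
    then have "x \<in> B (size a)" unfolding B_def using a by auto
    then have "x \<le> M (size a)" unfolding M_def by (rule cSup_upper[OF _ bdd])
    with \<rho>(2)[OF size0[OF a]] real show ?thesis by simp
  next
    case PInf
    obtain b where "D a \<le> ereal b" using bounded[of "max (size a) 1"] a
      by (metis less_max_iff_disj max.cobounded1 zero_less_one)
    with PInf show ?thesis by simp
  qed simp
  from that[OF \<rho>(1) this] show ?thesis .
qed

text \<open>The equation \<open>\<xi>' b = \<xi>\<close> is solved by \<open>\<xi> = exp A\<close> with \<open>A' = 1 / b\<close>. Its derivative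
\<open>exp A / b\<close> is nondecreasing because \<open>b\<close> is 1-Lipschitz: on \<open>[v, w]\<close> the function \<open>A\<close> grows at
least as much as \<open>ln b\<close>. Monotonicity yields the limit of \<open>\<xi>'\<close> at \<open>0\<close>, the limit
\<open>\<xi>(s) \<le> s \<xi>'(1) \<rightarrow> 0\<close> and the unboundedness of \<open>\<xi>\<close>.\<close>

lemma scaling_exists:
  assumes b: "class_P b" and lip: "\<And>r s. \<bar>b r - b s\<bar> \<le> \<bar>r - s\<bar>"
  obtains \<xi> \<xi>' where "nonlinear_scaling \<xi>"
    "\<And>s. 0 < s \<Longrightarrow> (\<xi> has_real_derivative \<xi>' s) (at s)"
    "\<And>s. 0 < s \<Longrightarrow> 0 < \<xi>' s" "mono_on {0<..} \<xi>'" "\<And>s. 0 < s \<Longrightarrow> \<xi>' s * b s = \<xi> s"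
proof -
  have bpos: "0 < b s" if "0 < s" for s using b that unfolding class_P_def by simp
  have b0: "b 0 = 0" using b unfolding class_P_def by simp
  have bcont: "isCont b s" for s
    unfolding continuous_at_eps_delta dist_real_def using lip by (metis order_le_less_trans)
  have "\<exists>A. \<forall>s. (0::ereal) < ereal s \<longrightarrow> ereal s < \<infinity> \<longrightarrow> (A has_vector_derivative 1 / b s) (at s)"
  proof (rule einterval_antiderivative)
    fix s assume "(0::ereal) < ereal s"
    then show "isCont (\<lambda>s. 1 / b s) s" using bpos[of s] by (intro continuous_intros bcont) auto
  qed simp
  then obtain A where A: "\<And>s. 0 < s \<Longrightarrow> (A has_real_derivative 1 / b s) (at s)"
    by (auto simp: has_real_derivative_iff_has_vector_derivative)
  define \<xi> where "\<xi> s = (if s \<le> 0 then 0 else exp (A s))" for s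
  define \<xi>' where "\<xi>' s = exp (A s) / b s" for s
  have ev: "\<forall>\<^sub>F x in nhds s. \<xi> x = exp (A x)" if "0 < s" for s
    using eventually_nhds_in_open[of "{0<..}" s] that by (auto simp: \<xi>_def elim!: eventually_mono)
  have deriv: "(\<xi> has_real_derivative \<xi>' s) (at s)" if "0 < s" for s
  proof -
    have "((\<lambda>x. exp (A x)) has_real_derivative \<xi>' s) (at s)"
      unfolding \<xi>'_def using that by (auto intro!: derivative_eq_intros A)
    then show ?thesis using DERIV_cong_ev[OF refl ev[OF that] refl] by simp
  qed
  have pos: "0 < \<xi>' s" if "0 < s" for s using bpos[OF that] unfolding \<xi>'_def by simp
  have eq: "\<xi>' s * b s = \<xi> s" if "0 < s" for s using bpos[OF that] that unfolding \<xi>'_def \<xi>_def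
    by simp
  have mono': "\<xi>' v \<le> \<xi>' w" if vw: "0 < v" "v \<le> w" for v w
  proof -
    \<comment> \<open>Since b grows at most with slope 1.\<close>
    have "A v - ln (b v + (v - v)) \<le> A w - ln (b v + (w - v))"
    proof (rule DERIV_nonneg_imp_nondecreasing[OF vw(2)])
      fix s assume s: "v \<le> s" "s \<le> w"
      have p: "0 < b v + (s - v)" "0 < b s" "b s \<le> b v + (s - v)"
        using bpos[of v] bpos[of s] lip[of s v] vw s by auto
      have "((\<lambda>s. A s - ln (b v + (s - v))) has_real_derivative 1 / b s - 1 / (b v + (s - v))) (at s)"
        using p vw s by (auto intro!: derivative_eq_intros A)
      moreover have "0 \<le> 1 / b s - 1 / (b v + (s - v))"
        using p by (simp add: frac_le)
      ultimately show "\<exists>y. ((\<lambda>s. A s - ln (b v + (s - v))) has_real_derivative y) (at s) \<and> 0 \<le> y"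
        by blast
    qed
    moreover have "ln (b w) \<le> ln (b v + (w - v))"
      using bpos[of v] bpos[of w] lip[of w v] vw by (subst ln_le_cancel_iff) auto
    ultimately have "A v - ln (b v) \<le> A w - ln (b w)" by simp
    then have "exp (A v - ln (b v)) \<le> exp (A w - ln (b w))" by simp
    then show ?thesis using bpos[of v] bpos[of w] vw by (simp add: \<xi>'_def exp_diff)
  qed
  have \<xi>_pos: "0 < \<xi> s" if "0 < s" for s using that unfolding \<xi>_def by simp
  have ble: "b s \<le> s" if "0 < s" for s using lip[of s 0] b0 that by simp
  have \<xi>_le: "\<xi> s \<le> s * \<xi>' 1" if "0 < s" "s \<le> 1" for s
    using eq[of s] ble[of s] mono'[of s 1] pos[of s] that bpos[of s]
    by (metis mult.commute mult_mono less_imp_le)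
  have incr: "\<xi> r < \<xi> s" if "0 \<le> r" "r < s" for r s
  proof (cases "r = 0")
    case True then show ?thesis using that \<xi>_pos[of s] by (simp add: \<xi>_def)
  next
    case False
    show ?thesis
    proof (rule DERIV_pos_imp_increasing[OF that(2)])
      fix x assume "r \<le> x"
      then have "0 < x" using that False by simp
      then show "\<exists>y. (\<xi> has_real_derivative y) (at x) \<and> 0 < y" using deriv pos by blast
    qed
  qed
  have \<xi>0: "\<xi> 0 = 0" unfolding \<xi>_def by simp
  have cont: "continuous (at s within {0..}) \<xi>" if "0 \<le> s" for s
  proof (cases "s = 0")
    case True
    show ?thesis unfolding continuous_within True \<xi>0
    proof (rule tendsto_sandwich[of "\<lambda>_. 0" _ _ "\<lambda>s. s * \<xi>' 1"])
      show "\<forall>\<^sub>F x in at 0 within {0..}. 0 \<le> \<xi> x"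
        using \<xi>_pos by (auto simp: \<xi>_def)
      have "\<forall>\<^sub>F x in at 0 within {0..}. x < (1::real)"
        by (rule order_tendstoD(2)[OF tendsto_ident_at]) simp
      moreover have "\<forall>\<^sub>F x in at 0 within {0..}. x \<in> {0::real..}"
        by (simp add: eventually_at_filter)
      ultimately show "\<forall>\<^sub>F x in at 0 within {0..}. \<xi> x \<le> x * \<xi>' 1"
      proof eventually_elim
        case (elim x)
        then show ?case using \<xi>_le[of x] \<xi>0 by (cases "x = 0") auto
      qed
      have "((\<lambda>s. s * \<xi>' 1) \<longlongrightarrow> 0 * \<xi>' 1) (at 0 within {0..})"
        by (intro tendsto_mult tendsto_ident_at tendsto_const)
      then show "((\<lambda>s. s * \<xi>' 1) \<longlongrightarrow> 0) (at 0 within {0..})" by simp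
    qed simp
  next
    case False
    then have "isCont \<xi> s" using deriv[of s] that by (auto intro: DERIV_isCont)
    then show ?thesis by (rule continuous_at_imp_continuous_within)
  qed
  have unb: "\<not> bdd_above (\<xi> ` {0..})"
  proof
    assume "bdd_above (\<xi> ` {0..})"
    then obtain B where B: "\<And>s. 0 \<le> s \<Longrightarrow> \<xi> s \<le> B" unfolding bdd_above_def by auto
    define s where "s = 1 + (\<bar>B\<bar> + 1) / \<xi>' 1"
    have s: "1 < s" using pos[of 1] unfolding s_def by simp
    obtain z where z: "1 < z" "z < s" "\<xi> s - \<xi> 1 = (s - 1) * \<xi>' z"
      using MVT2[OF s, of \<xi> \<xi>'] deriv by auto
    have "(s - 1) * \<xi>' 1 \<le> (s - 1) * \<xi>' z" using s z mono'[of 1 z] by (intro mult_left_mono) auto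
    moreover have "(s - 1) * \<xi>' 1 = \<bar>B\<bar> + 1" using pos[of 1] unfolding s_def by simp
    ultimately show False using z(3) B[of s] s \<xi>_pos[of 1] by simp
  qed
  have Kinf: "class_K_inf \<xi>"
    unfolding class_K_inf_def class_K_def class_P_def
    using cont unb \<xi>_pos incr \<xi>0
    by (auto simp: continuous_on_eq_continuous_within strict_mono_on_def)
  have d': "deriv \<xi> s = \<xi>' s" if "0 < s" for s using deriv[OF that] by (rule DERIV_imp_deriv)
  have c': "continuous_on {0<..} \<xi>'"
    unfolding \<xi>'_def using bpos A
    by (intro continuous_intros)
      (fastforce simp: continuous_on_eq_continuous_at bcont intro: DERIV_isCont)+
  define L where "L = (INF s\<in>{0<..}. \<xi>' s)"
  have bddL: "bdd_below (\<xi>' ` {0<..})" using pos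
    by (intro bdd_belowI2[of _ 0]) (auto intro: less_imp_le)
  have "(\<xi>' \<longlongrightarrow> L) (at_right 0)"
  proof (rule order_tendstoI)
    fix a assume a: "a < L"
    have "a < \<xi>' s" if "0 < s" for s
      using cINF_lower[OF bddL, of s] that a unfolding L_def by simp
    then show "\<forall>\<^sub>F x in at_right 0. a < \<xi>' x" by (auto simp: eventually_at_filter)
  next
    fix a assume "L < a"
    then obtain s where s: "0 < s" "\<xi>' s < a"
      unfolding L_def by (subst (asm) cINF_less_iff[OF _ bddL]) auto
    have "\<forall>\<^sub>F x in at_right 0. x < s" using s(1)
      by (simp add: eventually_at_right_less order_tendstoD(2)[OF tendsto_ident_at])
    moreover have "\<forall>\<^sub>F x in at_right 0. (0::real) < x" by (simp add: eventually_at_filter)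
    ultimately show "\<forall>\<^sub>F x in at_right 0. \<xi>' x < a"
      by eventually_elim (use mono' s(2) in \<open>meson less_imp_le order_le_less_trans\<close>)
  qed
  then have "(deriv \<xi> \<longlongrightarrow> L) (at_right 0)"
    by (rule Lim_transform_eventually) (auto simp: eventually_at_filter d')
  moreover have "continuous_on {0<..} (deriv \<xi>)" using c' by (rule continuous_on_eq) (simp add: d')
  ultimately have "nonlinear_scaling \<xi>"
    unfolding nonlinear_scaling_def using Kinf d' pos deriv
    by (auto simp: real_differentiable_def)
  from that[OF this deriv pos _ eq] mono' show ?thesis by (auto simp: mono_on_def)
qed

section \<open>The spectral radius condition\<close>

text \<open>Fekete's lemma in multiplicative form: if \<open>a N \<le> \<rho>\<^sup>N\<close>, then division with remainder by
\<open>N\<close> gives \<open>a k \<le> \<rho>\<^sup>k B\<close> with a constant \<open>B\<close>, whose roots tend to \<open>1\<close>. Convergence has to be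
known because the spectral radius is defined by \<^const>\<open>lim\<close>, which has no useful value for divergent
sequences.\<close>

lemma submultiplicative_root_convergent:
  fixes a :: "nat \<Rightarrow> real"
  assumes nonneg: "\<And>k. 0 \<le> a k" and submult: "\<And>k l. a (k + l) \<le> a k * a l"
  shows "convergent (\<lambda>k. root k (a k))"
proof -
  define L where "L = (INF k\<in>{1..}. root k (a k))"
  have r0: "0 \<le> root k (a k)" for k using nonneg by (cases "k = 0") simp_all
  have bdd: "bdd_below ((\<lambda>k. root k (a k)) ` {1..})" using r0 by (intro bdd_belowI2)
  have "(\<lambda>k. root k (a k)) \<longlonglongrightarrow> L"
  proof (rule order_tendstoI)
    fix c assume c: "c < L"
    have "c < root k (a k)" if "1 \<le> k" for k
      using cINF_lower[OF bdd, of k] that c unfolding L_def by simp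
    then show "\<forall>\<^sub>F k in sequentially. c < root k (a k)"
      unfolding eventually_sequentially by blast
  next
    fix c assume "L < c"
    then obtain N where N: "1 \<le> N" "root N (a N) < c"
      unfolding L_def by (subst (asm) cINF_less_iff[OF _ bdd]) auto
    define \<rho> where "\<rho> = (root N (a N) + c) / 2"
    have "0 < root N (a N) + c" using N r0[of N] by linarith
    then have \<rho>: "root N (a N) < \<rho>" "\<rho> < c" "0 < \<rho>" using N unfolding \<rho>_def by auto
    have aN: "a N \<le> \<rho> ^ N"
      using \<rho> N nonneg[of N] r0[of N]
      by (metis less_imp_le not_one_le_zero power_mono real_root_pow_pos2 zero_less_iff_neq_zero)
    \<comment> \<open>The summand \<open>1\<close> makes \<open>B\<close> positive, so that its roots converge to \<open>1\<close>.\<close>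
    define B where "B = 1 + (\<Sum>r<N. a r / \<rho> ^ r)"
    have "0 \<le> (\<Sum>r<N. a r / \<rho> ^ r)" using nonneg \<rho> by (intro sum_nonneg) simp
    then have B: "0 < B" unfolding B_def by simp
    have ar: "a r \<le> \<rho> ^ r * B" if "r < N" for r
    proof -
      have "a r / \<rho> ^ r \<le> (\<Sum>r<N. a r / \<rho> ^ r)"
        using that nonneg \<rho> by (intro member_le_sum) auto
      then have "a r / \<rho> ^ r \<le> B" unfolding B_def by simp
      then show ?thesis using \<rho> by (simp add: field_simps)
    qed
    have aq: "a (q * N + r) \<le> \<rho> ^ (q * N + r) * B" if "r < N" for q r
    proof (induction q)
      case 0 then show ?case using ar[OF that] by simp
    next
      case (Suc q)
      have "a (Suc q * N + r) \<le> a N * a (q * N + r)" using submult[of N "q * N + r"]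
        by (simp add: add.assoc)
      also have "\<dots> \<le> \<rho> ^ N * (\<rho> ^ (q * N + r) * B)"
        using aN Suc nonneg \<rho> B by (intro mult_mono) auto
      finally show ?case by (simp add: power_add mult_ac)
    qed
    have "a k \<le> \<rho> ^ k * B" for k
      using aq[of "k mod N" "k div N"] N by simp
    then have le: "root k (a k) \<le> \<rho> * root k B" if "0 < k" for k
    proof -
      have "root k (a k) \<le> root k (\<rho> ^ k * B)" using \<open>\<And>k. a k \<le> _\<close> that by simp
      then show ?thesis using that \<rho> by (simp add: real_root_mult real_root_power_cancel)
    qed
    have ev: "\<forall>\<^sub>F k in sequentially. root k (a k) \<le> \<rho> * root k B"
      by (rule eventually_mono[OF eventually_gt_at_top[of 0] le])
    have "(\<lambda>k. \<rho> * root k B) \<longlonglongrightarrow> \<rho> * 1"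
      using LIMSEQ_root_const[OF B] by (intro tendsto_mult tendsto_const)
    then have "\<forall>\<^sub>F k in sequentially. \<rho> * root k B < c"
      using \<rho> by (intro order_tendstoD(2)) auto
    with ev show "\<forall>\<^sub>F k in sequentially. root k (a k) < c"
      by eventually_elim simp
  qed
  then show ?thesis by (rule convergentI)
qed

lemma sum_apply_bcontfun: "apply_bcontfun (sum f A) i = (\<Sum>k\<in>A. apply_bcontfun (f k) i)"
  for f :: "'k \<Rightarrow> linf"
  by (induction A rule: infinite_finite_induct) simp_all

lemma linf_le_norm: "\<bar>apply_bcontfun s i\<bar> \<le> norm s" for s :: linf
  using norm_bounded[of s i] by simp

lemma interior_linf_posI:
  assumes "\<And>i. 1 \<le> apply_bcontfun s i"
  shows "s \<in> interior linf_pos"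
proof (rule interiorI[of "ball s 1"])
  show "ball s 1 \<subseteq> linf_pos"
  proof
    fix r assume "r \<in> ball s 1"
    then have "norm (s - r) < 1" by (simp add: dist_norm)
    then have "0 \<le> apply_bcontfun r i" for i
      using assms[of i] linf_le_norm[of "s - r" i] by simp
    then show "r \<in> linf_pos" unfolding linf_pos_def by simp
  qed
qed simp_all

text \<open>The order is the pointwise one; the properties are those which the gain operator inherits
from aggregation functions.\<close>

locale cone_operator =
  fixes G :: "linf \<Rightarrow> linf"
  assumes G_pos: "s \<in> linf_pos \<Longrightarrow> G s \<in> linf_pos"
    and G_mono: "r \<in> linf_pos \<Longrightarrow> s \<in> linf_pos \<Longrightarrow> (\<And>i. r i \<le> s i) \<Longrightarrow> G r i \<le> G s i"
    and G_scale: "s \<in> linf_pos \<Longrightarrow> 0 \<le> c \<Longrightarrow> G (c *\<^sub>R s) = c *\<^sub>R G s"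
    and G_add: "r \<in> linf_pos \<Longrightarrow> s \<in> linf_pos \<Longrightarrow> G (r + s) i \<le> G r i + G s i"
begin

definition "ones = (const_bcontfun 1 :: linf)"

lemma ones_apply [simp]: "apply_bcontfun ones i = 1"
  unfolding ones_def by (simp add: const_bcontfun.rep_eq)

lemma ones_pos: "ones \<in> linf_pos" unfolding linf_pos_def by simp

lemma norm_ones: "norm ones = 1"
proof (rule antisym)
  show "norm ones \<le> 1" by (rule norm_bound) simp
  show "1 \<le> norm ones" using linf_le_norm[of ones 0] by simp
qed

lemma pow_pos: "s \<in> linf_pos \<Longrightarrow> (G ^^ k) s \<in> linf_pos"
  by (induction k) (auto intro: G_pos)

lemma pow_mono:
  assumes "r \<in> linf_pos" "s \<in> linf_pos" "\<And>i. r i \<le> s i"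
  shows "(G ^^ k) r i \<le> (G ^^ k) s i"
  using assms by (induction k arbitrary: i) (auto intro!: G_mono pow_pos)

lemma pow_scale: "s \<in> linf_pos \<Longrightarrow> 0 \<le> c \<Longrightarrow> (G ^^ k) (c *\<^sub>R s) = c *\<^sub>R (G ^^ k) s"
  by (induction k) (auto simp: G_scale pow_pos)

lemma scale_pos: "s \<in> linf_pos \<Longrightarrow> 0 \<le> c \<Longrightarrow> c *\<^sub>R s \<in> linf_pos"
  unfolding linf_pos_def by simp

lemma pow_le_norm:
  assumes s: "s \<in> linf_pos"
  shows "(G ^^ k) s i \<le> norm s * (G ^^ k) ones i"
proof -
  have "(G ^^ k) s i \<le> (G ^^ k) (norm s *\<^sub>R ones) i"
    using linf_le_norm[of s]
    by (intro pow_mono s scale_pos ones_pos) (auto intro: order_trans[OF abs_ge_self])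
  then show ?thesis by (simp add: pow_scale ones_pos)
qed

lemma norm_pow_le:
  assumes s: "s \<in> linf_pos"
  shows "norm ((G ^^ k) s) \<le> norm s * norm ((G ^^ k) ones)"
proof (rule norm_bound)
  fix i
  have "0 \<le> (G ^^ k) s i" using pow_pos[OF s] unfolding linf_pos_def by simp
  moreover have "(G ^^ k) ones i \<le> norm ((G ^^ k) ones)" using linf_le_norm[of "(G ^^ k) ones" i]
    by simp
  ultimately show "norm ((G ^^ k) s i) \<le> norm s * norm ((G ^^ k) ones)"
    using pow_le_norm[OF s, of k i] mult_left_mono[of _ _ "norm s"] by fastforce
qed

text \<open>By monotonicity and homogeneity the supremum in the definition of the spectral radius is
attained at the constant sequence, so only the orbit of this sequence matters.\<close>

lemma cone_spectral_radius_less: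
  assumes "cone_spectral_radius G < c" "0 < c"
  obtains N where "0 < N" "norm ((G ^^ N) ones) < c ^ N"
proof -
  define a where "a k = norm ((G ^^ k) ones)" for k
  have sup: "(SUP s\<in>{s \<in> linf_pos. norm s = 1}. root k (norm ((G ^^ k) s))) = root k (a k)" for k
  proof (rule cSup_eq_maximum)
    show "root k (a k) \<in> (\<lambda>s. root k (norm ((G ^^ k) s))) ` {s \<in> linf_pos. norm s = 1}"
      using ones_pos norm_ones unfolding a_def by blast
    fix x assume "x \<in> (\<lambda>s. root k (norm ((G ^^ k) s))) ` {s \<in> linf_pos. norm s = 1}"
    then show "x \<le> root k (a k)"
      using norm_pow_le[of _ k] unfolding a_def by (cases "k = 0") fastforce+
  qed
  have "convergent (\<lambda>k. root k (a k))"
  proof (rule submultiplicative_root_convergent)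
    fix k l
    have "(G ^^ (k + l)) ones = (G ^^ k) ((G ^^ l) ones)" by (simp add: funpow_add)
    then show "a (k + l) \<le> a k * a l"
      using norm_pow_le[OF pow_pos[OF ones_pos, of l], of k] unfolding a_def
      by (simp add: mult.commute)
  qed (simp add: a_def)
  then have "(\<lambda>k. root k (a k)) \<longlonglongrightarrow> cone_spectral_radius G"
    unfolding cone_spectral_radius_def sup by (simp add: convergent_LIMSEQ_iff)
  then have "\<forall>\<^sub>F k in sequentially. root k (a k) < c"
    using assms(1) by (rule order_tendstoD)
  then have "\<forall>\<^sub>F k in sequentially. root k (a k) < c \<and> 0 < k"
    using eventually_gt_at_top[of 0] by eventually_elim simp
  then obtain N where N: "root N (a N) < c" "0 < N" by (auto simp: eventually_sequentially)
  have "a N = root N (a N) ^ N" using N unfolding a_def by simp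
  also have "\<dots> < c ^ N" using N unfolding a_def by (intro power_strict_mono) auto
  finally show ?thesis using that N unfolding a_def by blast
qed

lemma G_sum_le:
  assumes "finite K" "\<And>k. k \<in> K \<Longrightarrow> v k \<in> linf_pos"
  shows "(\<Sum>k\<in>K. v k) \<in> linf_pos \<and> (\<forall>i. G (\<Sum>k\<in>K. v k) i \<le> (\<Sum>k\<in>K. G (v k) i))"
  using assms
proof (induction K rule: finite_induct)
  case empty
  have "G 0 = 0" using G_scale[of 0 0] by (simp add: linf_pos_def)
  then show ?case by (simp add: linf_pos_def)
next
  case (insert k K)
  then have "v k \<in> linf_pos" "(\<Sum>k\<in>K. v k) \<in> linf_pos" by auto
  note pos = this
  have "G (v k + (\<Sum>k\<in>K. v k)) i \<le> G (v k) i + (\<Sum>k\<in>K. G (v k) i)" for i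
    using G_add[OF pos, of i] insert by (auto simp: intro: order_trans)
  moreover have "v k + (\<Sum>k\<in>K. v k) \<in> linf_pos" using pos unfolding linf_pos_def by simp
  ultimately show ?case using insert.hyps by simp
qed

text \<open>The sequence is \<open>\<Sum>\<^sub>k\<^sub><\<^sub>N c\<^sup>-\<^sup>k G\<^sup>k 1\<close>. Applying \<open>G\<close> and dividing by \<open>c\<close> shifts the
summation index by one; the new last term is at most \<open>1\<close>, and the lost first term is \<open>1\<close>.\<close>

lemma strict_decay_point:
  assumes N: "0 < N" "norm ((G ^^ N) ones) \<le> c ^ N" and c: "0 < c"
  obtains s where "\<And>i. 1 \<le> apply_bcontfun s i" "\<And>i. G s i \<le> c * s i"
proof -
  define v where "v k = (1 / c ^ k) *\<^sub>R (G ^^ k) ones" for k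
  have v_pos: "v k \<in> linf_pos" for k unfolding v_def using c
    by (intro scale_pos pow_pos ones_pos) simp
  have v0: "v 0 = ones" unfolding v_def by simp
  have Gv: "G (v k) = c *\<^sub>R v (Suc k)" for k
    unfolding v_def using c by (simp add: G_scale pow_pos ones_pos)
  have vN: "v N i \<le> 1" for i
    using N c linf_le_norm[of "(G ^^ N) ones" i] unfolding v_def by (simp add: divide_le_eq)
  define s where "s = (\<Sum>k<N. v k)"
  have v_ge: "0 \<le> v k i" for k i using v_pos[of k] unfolding linf_pos_def by simp
  have "1 \<le> s i" for i
  proof -
    have "v 0 i \<le> (\<Sum>k<N. v k i)" using N v_ge by (intro member_le_sum) auto
    then show ?thesis unfolding s_def by (simp add: sum_apply_bcontfun v0)
  qed
  moreover have "G s i \<le> c * s i" for i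
  proof -
    have "G s i \<le> (\<Sum>k<N. G (v k) i)" unfolding s_def using G_sum_le[of "{..<N}" v] v_pos by auto
    also have "\<dots> = c * (\<Sum>k<N. v (Suc k) i)" by (simp add: Gv sum_distrib_left)
    also have "(\<Sum>k<N. v (Suc k) i) = (\<Sum>k<N. v k i) + v N i - v 0 i"
      using sum.lessThan_Suc[of "\<lambda>k. v k i" N] sum.lessThan_Suc_shift[of "\<lambda>k. v k i" N] by simp
    also have "\<dots> \<le> (\<Sum>k<N. v k i)" using vN[of i] by (simp add: v0)
    finally show ?thesis using c unfolding s_def by (simp add: sum_apply_bcontfun)
  qed
  ultimately show ?thesis using that by blast
qed

end

lemma bounded_weighted:
  assumes "finite J" "\<And>j. j \<notin> J \<Longrightarrow> g j = 0"
  shows "bounded (range (\<lambda>j. g j * s j :: real))"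
proof -
  have "g j * s j \<in> insert 0 ((\<lambda>j. g j * s j) ` J)" for j using assms(2)[of j]
    by (cases "j \<in> J") auto
  then have "range (\<lambda>j. g j * s j) \<subseteq> insert 0 ((\<lambda>j. g j * s j) ` J)" by blast
  then show ?thesis using assms(1)
    by (meson finite_imageI finite_imp_bounded finite_insert finite_subset)
qed

text \<open>Only finitely many weights are nonzero, so the product is bounded even if \<open>s\<close> is not, and
\<^const>\<open>Bcontfun\<close> returns it.\<close>

lemma weighted_apply:
  assumes "finite J" "\<And>j. j \<notin> J \<Longrightarrow> g j = 0"
  shows "apply_bcontfun (weighted g s) = (\<lambda>j. g j * s j)"
  unfolding weighted_def by (rule apply_Bcontfun_nat[OF bounded_weighted[OF assms]])

locale gain_network =
  fixes \<mu> :: "nat \<Rightarrow> linf \<Rightarrow> ennreal" and \<gamma> :: "nat \<Rightarrow> nat \<Rightarrow> real" and I :: "nat \<Rightarrow> nat set"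
  assumes finI: "finite (I i)" and agg: "aggregation_function (\<mu> i)" and \<gamma>_nonneg: "0 \<le> \<gamma> i j"
    and \<gamma>_zero: "j \<notin> I i \<Longrightarrow> \<gamma> i j = 0" and wd: "gain_well_defined \<mu> \<gamma>"
begin

abbreviation "gain i s \<equiv> \<mu> i (weighted (\<gamma> i) s)"

lemma weighted_apply': "apply_bcontfun (weighted (\<gamma> i) s) = (\<lambda>j. \<gamma> i j * s j)"
  by (rule weighted_apply[OF finI \<gamma>_zero])

lemma weighted_pos: "(\<And>j. 0 \<le> s j) \<Longrightarrow> weighted (\<gamma> i) s \<in> linf_pos"
  unfolding linf_pos_def using \<gamma>_nonneg by (simp add: weighted_apply')

lemma gain_mono:
  assumes "\<And>j. 0 \<le> r j" "\<And>j. r j \<le> s j"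
  shows "gain i r \<le> gain i s"
proof -
  have "0 \<le> s j" for j using assms order_trans by blast
  then have "weighted (\<gamma> i) r \<in> linf_pos" "weighted (\<gamma> i) s \<in> linf_pos"
    using assms(1) by (auto intro: weighted_pos)
  moreover have "weighted (\<gamma> i) r j \<le> weighted (\<gamma> i) s j" for j
    unfolding weighted_apply' by (rule mult_left_mono[OF assms(2) \<gamma>_nonneg])
  ultimately show ?thesis using agg[of i] unfolding aggregation_function_def by blast
qed

lemma gain_scale:
  assumes "\<And>j. 0 \<le> s j" "0 \<le> c"
  shows "gain i (\<lambda>j. c * s j) = ennreal c * gain i s"
proof -
  have "weighted (\<gamma> i) (\<lambda>j. c * s j) = c *\<^sub>R weighted (\<gamma> i) s"
    by (rule bcontfun_eqI) (simp add: weighted_apply' mult_ac)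
  then show ?thesis using agg[of i] weighted_pos[OF assms(1)] assms(2)
    unfolding aggregation_function_def by simp
qed

lemma gain_add:
  assumes "\<And>j. 0 \<le> r j" "\<And>j. 0 \<le> s j"
  shows "gain i (\<lambda>j. r j + s j) \<le> gain i r + gain i s"
proof -
  have "weighted (\<gamma> i) (\<lambda>j. r j + s j) = weighted (\<gamma> i) r + weighted (\<gamma> i) s"
    by (rule bcontfun_eqI) (simp add: weighted_apply' distrib_left)
  then show ?thesis using agg[of i] weighted_pos[OF assms(1)] weighted_pos[OF assms(2)]
    unfolding aggregation_function_def by simp
qed

lemma gain_finite: "s \<in> linf_pos \<Longrightarrow> gain i (apply_bcontfun s) < \<infinity>"
  using wd unfolding gain_well_defined_def by (meson SUP_upper UNIV_I order_le_less_trans)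

lemma gain_operator_apply:
  assumes s: "s \<in> linf_pos"
  shows "ennreal (gain_operator \<mu> \<gamma> s i) = gain i (apply_bcontfun s)"
    and "0 \<le> gain_operator \<mu> \<gamma> s i"
proof -
  define C where "C = (SUP i. gain i (apply_bcontfun s))"
  have C: "C < \<infinity>" using wd s unfolding gain_well_defined_def C_def by blast
  have "enn2real (gain i (apply_bcontfun s)) \<le> enn2real C" for i
    using C unfolding C_def by (intro enn2real_mono SUP_upper) auto
  then have "bounded (range (\<lambda>i. enn2real (gain i (apply_bcontfun s))))"
    by (intro boundedI[of _ "enn2real C"]) auto
  then have "gain_operator \<mu> \<gamma> s i = enn2real (gain i (apply_bcontfun s))"
    unfolding gain_operator_def by (simp add: apply_Bcontfun_nat)
  then show "ennreal (gain_operator \<mu> \<gamma> s i) = gain i (apply_bcontfun s)"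
    "0 \<le> gain_operator \<mu> \<gamma> s i"
    using gain_finite[OF s, of i] by (simp_all add: ennreal_enn2real_if)
qed

sublocale cone_operator "gain_operator \<mu> \<gamma>"
proof
  fix r s :: linf and i :: nat and c :: real
  assume s: "s \<in> linf_pos"
  show Gs: "gain_operator \<mu> \<gamma> s \<in> linf_pos"
    using gain_operator_apply(2)[OF s] unfolding linf_pos_def by blast
  have s0: "\<And>j. 0 \<le> s j" using s unfolding linf_pos_def by blast
  show "gain_operator \<mu> \<gamma> (c *\<^sub>R s) = c *\<^sub>R gain_operator \<mu> \<gamma> s" if c: "0 \<le> c"
  proof (rule bcontfun_eqI)
    fix i
    have cs: "c *\<^sub>R s \<in> linf_pos" using s c unfolding linf_pos_def by simp
    have "ennreal (gain_operator \<mu> \<gamma> (c *\<^sub>R s) i) = ennreal (c * gain_operator \<mu> \<gamma> s i)"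
      using gain_scale[OF s0 c, of i] gain_operator_apply[OF s, of i] c
      by (simp add: gain_operator_apply(1)[OF cs] ennreal_mult)
    then show "gain_operator \<mu> \<gamma> (c *\<^sub>R s) i = (c *\<^sub>R gain_operator \<mu> \<gamma> s) i"
      using gain_operator_apply(2)[OF s, of i] gain_operator_apply(2)[OF cs, of i] c
      by (subst (asm) ennreal_inj) auto
  qed
  assume r: "r \<in> linf_pos"
  have r0: "\<And>j. 0 \<le> r j" using r unfolding linf_pos_def by blast
  have rs: "r + s \<in> linf_pos" using r s unfolding linf_pos_def by simp
  show "gain_operator \<mu> \<gamma> (r + s) i \<le> gain_operator \<mu> \<gamma> r i + gain_operator \<mu> \<gamma> s i"
  proof -
    have "ennreal (gain_operator \<mu> \<gamma> (r + s) i) \<le> ennreal (gain_operator \<mu> \<gamma> r i +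
        gain_operator \<mu> \<gamma> s i)"
      using gain_add[OF r0 s0, of i] gain_operator_apply[OF s, of i] gain_operator_apply[OF r, of i]
      by (simp add: gain_operator_apply(1)[OF rs] plus_bcontfun.rep_eq)
    then show ?thesis
      using gain_operator_apply(2)[OF s, of i] gain_operator_apply(2)[OF r, of i]
      by (subst (asm) ennreal_le_iff) auto
  qed
  show "gain_operator \<mu> \<gamma> r i \<le> gain_operator \<mu> \<gamma> s i" if "\<And>i. r i \<le> s i"
  proof -
    have "ennreal (gain_operator \<mu> \<gamma> r i) \<le> ennreal (gain_operator \<mu> \<gamma> s i)"
      using gain_mono[OF r0 that, of i] by (simp add: gain_operator_apply(1) r s)
    then show ?thesis using gain_operator_apply(2)[OF s, of i] by (subst (asm) ennreal_le_iff) auto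
  qed
qed

text \<open>The gain operator contracts towards \<open>0\<close> in the direction of the weights; in this form the
spectral radius condition enters the estimates for the network.\<close>

lemma contraction_weight:
  assumes "cone_spectral_radius (gain_operator \<mu> \<gamma>) < 1"
  obtains s c where "\<And>i. 1 \<le> apply_bcontfun s i" "0 < c" "c < 1"
    "\<And>i. gain i (apply_bcontfun s) \<le> ennreal (c * s i)"
proof -
  define c where "c = (max (cone_spectral_radius (gain_operator \<mu> \<gamma>)) 0 + 1) / 2"
  have c: "cone_spectral_radius (gain_operator \<mu> \<gamma>) < c" "0 < c" "c < 1"
    using assms unfolding c_def by auto
  obtain N where N: "0 < N" "norm ((gain_operator \<mu> \<gamma> ^^ N) ones) < c ^ N"
    using cone_spectral_radius_less[OF c(1,2)] by blast
  obtain s where s: "\<And>i. 1 \<le> apply_bcontfun s i" "\<And>i. gain_operator \<mu> \<gamma> s i \<le> c * s i"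
    using strict_decay_point[OF N(1) less_imp_le[OF N(2)] c(2)] by blast
  have "0 \<le> s i" for i using s(1)[of i] by simp
  then have pos: "s \<in> linf_pos" unfolding linf_pos_def by simp
  have "gain i (apply_bcontfun s) \<le> ennreal (c * s i)" for i
    unfolding gain_operator_apply(1)[OF pos, symmetric] by (rule ennreal_leI[OF s(2)])
  with that s(1) c show ?thesis by blast
qed

end

section \<open>Norms on the component spaces and the supremum norm\<close>

lemma Rn_zero [simp]: "0 \<in> Rn d"
  and Rn_scaleR: "v \<in> Rn d \<Longrightarrow> c *\<^sub>R v \<in> Rn d"
  and Rn_add: "v \<in> Rn d \<Longrightarrow> w \<in> Rn d \<Longrightarrow> v + w \<in> Rn d"
  by (simp_all add: Rn_def)

lemma Rn_sum: "(\<And>k. k \<in> A \<Longrightarrow> v k \<in> Rn d) \<Longrightarrow> sum v A \<in> Rn d"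
  by (induction A rule: infinite_finite_induct) (auto intro: Rn_add)

definition unit_seq :: "nat \<Rightarrow> linf" where
  "unit_seq k = Bcontfun (\<lambda>j. if j = k then 1 else 0)"

lemma unit_seq_apply [simp]: "apply_bcontfun (unit_seq k) j = (if j = k then 1 else 0)"
proof -
  have "bounded (range (\<lambda>j. if j = k then 1 else 0 :: real))" by (intro boundedI[of _ 1]) auto
  then show ?thesis unfolding unit_seq_def by (simp add: apply_Bcontfun_nat)
qed

lemma unit_seq_Rn: "k < d \<Longrightarrow> unit_seq k \<in> Rn d"
  by (simp add: Rn_def)

lemma Rn_expand: "v \<in> Rn d \<Longrightarrow> (\<Sum>k<d. apply_bcontfun v k *\<^sub>R unit_seq k) = v"
  by (rule bcontfun_eqI) (auto simp: sum_apply_bcontfun Rn_def if_distrib not_less cong: if_cong)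

lemma
  assumes N: "is_norm_on (Rn d) N"
  shows is_norm_on_nonneg: "v \<in> Rn d \<Longrightarrow> 0 \<le> N v"
    and is_norm_on_zero: "N 0 = 0"
    and is_norm_on_eq_0: "v \<in> Rn d \<Longrightarrow> N v = 0 \<Longrightarrow> v = 0"
    and is_norm_on_scale: "v \<in> Rn d \<Longrightarrow> N (c *\<^sub>R v) = \<bar>c\<bar> * N v"
    and is_norm_on_triangle: "v \<in> Rn d \<Longrightarrow> w \<in> Rn d \<Longrightarrow> N (v + w) \<le> N v + N w"
  using N Rn_zero[of d] unfolding is_norm_on_def by (metis (lifting))+

lemma is_norm_on_sum:
  assumes N: "is_norm_on (Rn d) N" and v: "\<And>k. k \<in> A \<Longrightarrow> v k \<in> Rn d"
  shows "N (\<Sum>k\<in>A. c k *\<^sub>R v k) \<le> (\<Sum>k\<in>A. \<bar>c k\<bar> * N (v k))"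
  using v
proof (induction A rule: infinite_finite_induct)
  case (insert a A)
  have "N (c a *\<^sub>R v a + (\<Sum>k\<in>A. c k *\<^sub>R v k)) \<le> N (c a *\<^sub>R v a) + N (\<Sum>k\<in>A. c k *\<^sub>R v k)"
    using insert.prems by (intro is_norm_on_triangle[OF N] Rn_scaleR Rn_sum) auto
  with insert show ?case by (simp add: is_norm_on_scale[OF N])
qed (simp_all add: is_norm_on_zero[OF N])

text \<open>One half of the equivalence of norms in finite dimension. The unit sphere of the maximum
norm is compact as a closed subset of a product of intervals, in the product topology of
coordinates, and a norm attains a positive minimum on it.\<close>

lemma norm_le_is_norm_on:
  assumes N: "is_norm_on (Rn d) N"
  obtains c where "0 < c" "\<And>v. v \<in> Rn d \<Longrightarrow> norm v \<le> c * N v"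
proof -
  define K where "K = (\<Pi>\<^sub>E k\<in>UNIV. if k < d then {-1..1} else {0::real})"
  define K1 where "K1 = K \<inter> (\<Union>k<d. {x. \<bar>x k\<bar> = 1})"
  define g where "g x = N (\<Sum>k<d. x k *\<^sub>R unit_seq k)" for x
  have coord: "continuous_on UNIV (\<lambda>x::nat \<Rightarrow> real. x k)" for k by simp
  have "compactin (product_topology (\<lambda>_. euclidean) UNIV) K"
    unfolding K_def by (subst compactin_PiE) auto
  then have "compact K" by (simp add: euclidean_product_topology)
  moreover have "closed {x::nat \<Rightarrow> real. \<bar>x k\<bar> = 1}" for k
    by (intro closed_Collect_eq continuous_intros coord)
  ultimately have cK1: "compact K1" unfolding K1_def by (intro compact_Int_closed closed_UN) auto
  have g_diff: "\<bar>g y - g x\<bar> \<le> (\<Sum>k<d. \<bar>y k - x k\<bar> * N (unit_seq k))" for x y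
  proof -
    have le: "g y - g x \<le> (\<Sum>k<d. \<bar>y k - x k\<bar> * N (unit_seq k))" for x y
    proof -
      have "(\<Sum>k<d. y k *\<^sub>R unit_seq k) = (\<Sum>k<d. x k *\<^sub>R unit_seq k) +
          (\<Sum>k<d. (y k - x k) *\<^sub>R unit_seq k)"
        by (simp add: sum.distrib[symmetric] scaleR_add_left[symmetric])
      then have "g y \<le> g x + N (\<Sum>k<d. (y k - x k) *\<^sub>R unit_seq k)"
        unfolding g_def by (auto intro!: is_norm_on_triangle[OF N] Rn_sum Rn_scaleR unit_seq_Rn)
      also have "N (\<Sum>k<d. (y k - x k) *\<^sub>R unit_seq k) \<le> (\<Sum>k<d. \<bar>y k - x k\<bar> * N (unit_seq k))"
        by (intro is_norm_on_sum[OF N] unit_seq_Rn) auto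
      finally show ?thesis by simp
    qed
    have "g x - g y \<le> (\<Sum>k<d. \<bar>y k - x k\<bar> * N (unit_seq k))"
      using le[of x y] by (simp add: abs_minus_commute)
    with le[of y x] show ?thesis by linarith
  qed
  have "continuous_on K1 g"
    unfolding continuous_on_def
  proof
    fix x
    have "((\<lambda>y. \<Sum>k<d. \<bar>y k - x k\<bar> * N (unit_seq k)) \<longlongrightarrow> (\<Sum>k<d. \<bar>x k - x k\<bar> * N (unit_seq k))) (at x within K1)"
    proof (intro tendsto_intros)
      fix k show "((\<lambda>y. y k) \<longlongrightarrow> x k) (at x within K1)"
        using coord[of k] continuous_on_subset[of UNIV _ K1]
        by (meson UNIV_I continuous_on_def subset_UNIV tendsto_within_subset)
    qed
    then have "((\<lambda>y. \<Sum>k<d. \<bar>y k - x k\<bar> * N (unit_seq k)) \<longlongrightarrow> 0) (at x within K1)" by simp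
    then have "((\<lambda>y. g y - g x) \<longlongrightarrow> 0) (at x within K1)"
      by (rule Lim_null_comparison[rotated]) (simp add: g_diff)
    then show "(g \<longlongrightarrow> g x) (at x within K1)" by (rule LIM_zero_cancel)
  qed
  have scaled: "\<exists>x\<in>K1. \<exists>M. norm v \<le> M \<and> N v = M * g x" if v: "v \<in> Rn d" "v \<noteq> 0" for v
  proof -
    have v_out: "v k = 0" if "\<not> k < d" for k using v(1) that unfolding Rn_def by simp
    obtain k0 where k0: "v k0 \<noteq> 0" using v(2) bcontfun_eqI[of v 0] by auto
    then have "k0 < d" using v_out by blast
    then have "finite ((\<lambda>k. \<bar>v k\<bar>) ` {..<d})" "(\<lambda>k. \<bar>v k\<bar>) ` {..<d} \<noteq> {}" by auto
    note fin = this
    obtain k where "k < d" "Max ((\<lambda>k. \<bar>v k\<bar>) ` {..<d}) = \<bar>v k\<bar>" using Max_in[OF fin] by auto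
    then have k: "k < d" "\<And>j. j < d \<Longrightarrow> \<bar>v j\<bar> \<le> \<bar>v k\<bar>" using Max_ge[OF fin(1)] by auto
    define M where "M = \<bar>v k\<bar>"
    have M: "0 < M" using k(2)[OF \<open>k0 < d\<close>] k0 unfolding M_def by auto
    have le: "\<bar>v j\<bar> \<le> M" for j
    proof (cases "j < d")
      case True then show ?thesis using k(2) unfolding M_def by blast
    next
      case False then show ?thesis using v_out[of j] M by simp
    qed
    have "norm v \<le> M" using le by (intro norm_bound) simp
    moreover have "(\<lambda>j. v j / M) \<in> K1"
    proof -
      have "\<bar>v j / M\<bar> \<le> 1" for j using le[of j] M by (simp add: abs_divide)
      then have "-1 \<le> v j / M \<and> v j / M \<le> 1" for j by (metis abs_le_iff minus_le_iff)
      then have "v j / M \<in> (if j < d then {-1..1} else {0})" for j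
        using v_out[of j] by (cases "j < d") simp_all
      then have "(\<lambda>j. v j / M) \<in> K" unfolding K_def by (simp add: PiE_UNIV_domain)
      moreover have "\<bar>v k / M\<bar> = 1" using M unfolding M_def by (simp add: abs_divide)
      ultimately show ?thesis unfolding K1_def using k(1) by blast
    qed
    moreover have "N v = M * g (\<lambda>j. v j / M)"
    proof -
      have "(\<Sum>j<d. (v j / M) *\<^sub>R unit_seq j) = (1 / M) *\<^sub>R (\<Sum>j<d. v j *\<^sub>R unit_seq j)"
        by (simp add: scaleR_sum_right)
      then show ?thesis using M v(1) unfolding g_def
        by (simp add: Rn_expand is_norm_on_scale[OF N v(1)])
    qed
    ultimately show ?thesis by blast
  qed
  show ?thesis
  proof (cases "K1 = {}")
    case True
    then show ?thesis using scaled that[of 1]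
      by (metis all_not_in_conv is_norm_on_zero[OF N] mult_zero_right norm_zero order.refl
          zero_less_one)
  next
    case False
    then obtain x0 where x0: "x0 \<in> K1" "\<And>x. x \<in> K1 \<Longrightarrow> g x0 \<le> g x"
      using continuous_attains_inf[OF cK1 _ \<open>continuous_on K1 g\<close>] by blast
    have Rn_x0: "(\<Sum>k<d. x0 k *\<^sub>R unit_seq k) \<in> Rn d" by (intro Rn_sum Rn_scaleR unit_seq_Rn) simp
    obtain k where k: "k < d" "\<bar>x0 k\<bar> = 1" using x0(1) unfolding K1_def by auto
    then have "(\<Sum>k<d. x0 k *\<^sub>R unit_seq k) k \<noteq> 0"
      by (auto simp: sum_apply_bcontfun if_distrib cong: if_cong)
    then have "(\<Sum>k<d. x0 k *\<^sub>R unit_seq k) \<noteq> 0" by auto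
    then have "g x0 \<noteq> 0" unfolding g_def using is_norm_on_eq_0[OF N Rn_x0] by blast
    then have pos: "0 < g x0" using is_norm_on_nonneg[OF N Rn_x0] unfolding g_def by simp
    show ?thesis
    proof (rule that[of "1 / g x0"])
      show "0 < 1 / g x0" using pos by simp
      fix v assume v: "v \<in> Rn d"
      show "norm v \<le> 1 / g x0 * N v"
      proof (cases "v = 0")
        case True then show ?thesis by (simp add: is_norm_on_zero[OF N])
      next
        case False
        obtain x M where x: "x \<in> K1" "norm v \<le> M" "N v = M * g x" using scaled[OF v False] by blast
        have "0 \<le> M" using x(2) norm_ge_zero order_trans by blast
        then have "norm v * g x0 \<le> N v"
          using x x0(2)[OF x(1)] pos by (auto intro!: mult_mono)
        then show ?thesis using pos by (simp add: field_simps)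
      qed
    qed
  qed
qed

locale lsup =
  fixes d :: "nat \<Rightarrow> nat" and N :: "nat \<Rightarrow> linf \<Rightarrow> real"
  assumes N: "is_norm_on (Rn (d i)) (N i)"
begin

abbreviation "X \<equiv> lsup_space d N"
abbreviation "dst \<equiv> lsup_dist d N"

sublocale M: Metric_space X dst
  by (rule lsup_Metric_space[OF N])

lemma mem_Rn: "x \<in> X \<Longrightarrow> x i \<in> Rn (d i)"
  unfolding lsup_space_def by simp

lemma N_le_norm: "x \<in> X \<Longrightarrow> N i (x i) \<le> lsup_norm N x"
  unfolding lsup_norm_def lsup_space_def by (auto intro: cSUP_upper)

lemma norm_least: "(\<And>i. N i (x i) \<le> c) \<Longrightarrow> lsup_norm N x \<le> c"
  unfolding lsup_norm_def by (rule cSUP_least) auto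

lemma norm_nonneg: "x \<in> X \<Longrightarrow> 0 \<le> lsup_norm N x"
  using is_norm_on_nonneg[OF N mem_Rn] N_le_norm order_trans by blast

lemma memI: "(\<And>i. x i \<in> Rn (d i)) \<Longrightarrow> (\<And>i. N i (x i) \<le> c) \<Longrightarrow> x \<in> X"
  unfolding lsup_space_def bdd_above_def by auto

lemma zero_mem: "(\<lambda>_. 0) \<in> X"
  by (rule memI[of _ 0]) (simp_all add: is_norm_on_zero[OF N])

lemma N_diff_triangle: "x \<in> X \<Longrightarrow> y \<in> X \<Longrightarrow> N i (x i - y i) \<le> N i (x i) + N i (y i)"
  using is_norm_on_diff_triangle[OF N mem_Rn Rn_zero mem_Rn, of x y i]
    is_norm_on_diff_commute[OF N Rn_zero mem_Rn, of y i] by simp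

lemma diff_mem: "x \<in> X \<Longrightarrow> y \<in> X \<Longrightarrow> (\<lambda>i. x i - y i) \<in> X"
  by (rule memI[of _ "lsup_norm N x + lsup_norm N y"])
    (auto intro: Rn_diff mem_Rn order_trans[OF N_diff_triangle] add_mono N_le_norm)

lemma dst_eq: "x \<in> X \<Longrightarrow> y \<in> X \<Longrightarrow> dst x y = lsup_norm N (\<lambda>i. x i - y i)"
  unfolding lsup_dist_def by simp

lemma dst_zero: "x \<in> X \<Longrightarrow> dst x (\<lambda>_. 0) = lsup_norm N x"
  by (simp add: dst_eq zero_mem)

lemma N_le_dst: "x \<in> X \<Longrightarrow> y \<in> X \<Longrightarrow> N i (x i - y i) \<le> dst x y"
  using N_le_norm[OF diff_mem] by (simp add: dst_eq)

lemma norm_le_dst: "x \<in> X \<Longrightarrow> y \<in> X \<Longrightarrow> lsup_norm N x \<le> lsup_norm N y + dst x y"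
  using M.triangle[of x y "\<lambda>_. 0"] by (simp add: dst_zero zero_mem)

lemma limitin_dst:
  assumes "limitin (lsup_topology d N) f l sequentially"
  shows "l \<in> X" "(\<lambda>k. dst (f k) l) \<longlonglongrightarrow> 0"
proof -
  have l: "l \<in> X" "\<And>\<epsilon>. \<epsilon> > 0 \<Longrightarrow> \<forall>\<^sub>F k in sequentially. f k \<in> X \<and> dst (f k) l < \<epsilon>"
    using assms unfolding lsup_topology_def M.limitin_metric by auto
  show "l \<in> X" by fact
  show "(\<lambda>k. dst (f k) l) \<longlonglongrightarrow> 0"
  proof (rule tendstoI)
    fix \<epsilon> :: real assume "0 < \<epsilon>"
    from l(2)[OF this] show "\<forall>\<^sub>F k in sequentially. dist (dst (f k) l) 0 < \<epsilon>"
      by (rule eventually_mono) simp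
  qed
qed

end

section \<open>Increments of Bochner primitives\<close>

lemma borel_measurable_ennreal_extend:
  fixes h :: "'a \<Rightarrow> ennreal"
  assumes "h \<in> borel_measurable (restrict_space M S)" "S \<in> sets M"
  shows "(\<lambda>t. h t * indicator S t) \<in> borel_measurable M"
  using assms borel_measurable_restrict_space_iff_ennreal[of S M h] by simp

lemma measure_lebesgue_on_Icc:
  assumes "A \<subseteq> {0..b}"
  shows "measure (lebesgue_on {0..b::real}) A = measure lebesgue A"
  using assms by (intro measure_restrict_space) auto

context lsup
begin

lemma simple_function_N:
  assumes "simple_function M p"
  shows "simple_function M (\<lambda>t. p t i)"
  using simple_function_compose1[OF assms, of "\<lambda>v. v i"] by simp

text \<open>Each component of \<open>simple_integral_on\<close> sums over the values of the whole family instead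
of those of the component. The finer partition does not change the integral, and linearity
carries over.\<close>

lemma simple_integral_on_eq:
  assumes p: "simple_function (lebesgue_on {0..b}) p"
  shows "simple_integral_on {0..b} p i =
      Bochner_Integration.simple_bochner_integral (lebesgue_on {0..b}) (\<lambda>t. p t i)"
    and "Bochner_Integration.simple_bochner_integrable (lebesgue_on {0..b}) (\<lambda>t. p t i)"
proof -
  interpret finite_measure "lebesgue_on {0..b}" by (rule finite_measure_lebesgue_on) simp
  show sbi: "Bochner_Integration.simple_bochner_integrable (lebesgue_on {0..b}) (\<lambda>t. p t i)"
    using simple_function_N[OF p] emeasure_finite by (auto simp: simple_bochner_integrable.simps)
  show "simple_integral_on {0..b} p i =
      Bochner_Integration.simple_bochner_integral (lebesgue_on {0..b}) (\<lambda>t. p t i)"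
    unfolding simple_integral_on_def
    by (subst simple_bochner_integral_partition[OF sbi p, of "\<lambda>v. v i"]) auto
qed

text \<open>The triangle inequality for integrals of simple functions, with respect to the given
norms \<open>N i\<close>.\<close>

lemma N_simple_integral_on_le:
  assumes p: "simple_function (lebesgue_on {0..b}) p" and X: "\<And>t. t \<in> {0..b} \<Longrightarrow> p t \<in> X"
  shows "simple_integral_on {0..b} p \<in> X"
    and "ennreal (N i (simple_integral_on {0..b} p i)) \<le>
        (\<integral>\<^sup>+t. ennreal (lsup_norm N (p t)) \<partial>lebesgue_on {0..b})"
proof -
  interpret finite_measure "lebesgue_on {0..b}" by (rule finite_measure_lebesgue_on) simp
  let ?M = "lebesgue_on {0..b}"
  let ?m = "\<lambda>v. measure ?M {t \<in> {0..b}. p t = v}"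
  have Rn: "simple_integral_on {0..b} p i \<in> Rn (d i)" for i
    unfolding simple_integral_on_def using X by (intro Rn_sum Rn_scaleR) (auto intro: mem_Rn)
  have le: "N i (simple_integral_on {0..b} p i) \<le> (\<Sum>v\<in>p ` {0..b}. ?m v * lsup_norm N v)" for i
  proof -
    have "N i (simple_integral_on {0..b} p i) \<le> (\<Sum>v\<in>p ` {0..b}. \<bar>?m v\<bar> * N i (v i))"
      unfolding simple_integral_on_def using X by (intro is_norm_on_sum[OF N]) (auto intro: mem_Rn)
    also have "\<dots> \<le> (\<Sum>v\<in>p ` {0..b}. ?m v * lsup_norm N v)"
      using X by (auto intro!: sum_mono mult_left_mono N_le_norm)
    finally show ?thesis .
  qed
  show "simple_integral_on {0..b} p \<in> X" by (rule memI[OF Rn le])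
  have "ennreal (N i (simple_integral_on {0..b} p i)) \<le> ennreal (\<Sum>v\<in>p ` {0..b}. ?m v * lsup_norm N v)"
    by (rule ennreal_leI[OF le])
  also have "\<dots> = (\<Sum>v\<in>p ` {0..b}. ennreal (?m v * lsup_norm N v))"
    using X by (intro sum_ennreal[symmetric]) (auto intro!: mult_nonneg_nonneg norm_nonneg)
  also have "\<dots> = (\<Sum>v\<in>p ` {0..b}. ennreal (lsup_norm N v) * emeasure ?M {t \<in> {0..b}. p t = v})"
    using X
    by (intro sum.cong) (auto simp: ennreal_mult norm_nonneg emeasure_eq_measure mult.commute)
  also have "\<dots> = simple_integral ?M (\<lambda>t. ennreal (lsup_norm N (p t)))"
    using simple_function_partition[of ?M "\<lambda>t. ennreal (lsup_norm N (p t))"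
        p "\<lambda>v. ennreal (lsup_norm N v)"]
      p simple_function_compose1[OF p, of "\<lambda>v. ennreal (lsup_norm N v)"]
    by simp
  also have "\<dots> = (\<integral>\<^sup>+t. ennreal (lsup_norm N (p t)) \<partial>?M)"
    by (rule nn_integral_eq_simple_integral[symmetric]) (rule simple_function_compose1[OF p])
  finally show "ennreal (N i (simple_integral_on {0..b} p i)) \<le>
      (\<integral>\<^sup>+t. ennreal (lsup_norm N (p t)) \<partial>?M)" .
qed

text \<open>The functions \<open>t \<mapsto> dst (s k t) (g t)\<close> need not be known to be measurable, but they agree
almost everywhere with the limits of the measurable functions \<open>t \<mapsto> dst (s k t) (s j t)\<close> for
\<open>j \<rightarrow> \<infinity>\<close>. The representatives \<open>h k\<close> make it possible to add their integrals.\<close>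

lemma bochner_approximation:
  assumes "has_bochner_integral_on d N {0..b} g y"
  obtains s h where "\<And>k. simple_function (lebesgue_on {0..b}) (s k)"
    "\<And>k t. t \<in> {0..b} \<Longrightarrow> s k t \<in> X"
    "\<And>k. h k \<in> borel_measurable lebesgue"
    "\<And>k. AE t in lebesgue. t \<in> {0..b} \<longrightarrow> ennreal (dst (s k t) (g t)) = h k t"
    "(\<lambda>k. \<integral>\<^sup>+t. h k t \<partial>lebesgue) \<longlonglongrightarrow> 0"
    "(\<lambda>k. dst (simple_integral_on {0..b} (s k)) y) \<longlonglongrightarrow> 0" "y \<in> X"
proof -
  let ?M = "lebesgue_on {0..b}"
  from assms obtain s where s0: "\<forall>k. simple_function ?M (s k) \<and> (\<forall>t\<in>{0..b}. s k t \<in> X)"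
    "AE t in ?M. limitin (lsup_topology d N) (\<lambda>k. s k t) (g t) sequentially"
    "(\<lambda>k. \<integral>\<^sup>+t. ennreal (dst (s k t) (g t)) \<partial>?M) \<longlonglongrightarrow> 0"
    "limitin (lsup_topology d N) (\<lambda>k. simple_integral_on {0..b} (s k)) y sequentially"
    unfolding has_bochner_integral_on_def by (elim conjE exE) (rule that)
  have s: "\<And>k. simple_function ?M (s k)" "\<And>k t. t \<in> {0..b} \<Longrightarrow> s k t \<in> X"
    using s0(1) by blast+
  note s = s s0(2-4)
  have g: "\<And>t. t \<in> {0..b} \<Longrightarrow> g t \<in> X"
    using assms unfolding has_bochner_integral_on_def by (elim conjE) (rule bspec)
  define h0 where "h0 k t = limsup (\<lambda>j. ennreal (dst (s k t) (s j t)))" for k t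
  define h where "h k t = h0 k t * indicator {0..b} t" for k t
  have "h0 k \<in> borel_measurable ?M" for k
    unfolding h0_def
  proof (rule borel_measurable_limsup)
    fix j
    have "simple_function ?M (\<lambda>t. ennreal (dst (s k t) (s j t)))"
      by (rule simple_function_compose2[OF s(1) s(1)])
    then show "(\<lambda>t. ennreal (dst (s k t) (s j t))) \<in> borel_measurable ?M"
      by (rule borel_measurable_simple_function)
  qed
  then have h_meas: "h k \<in> borel_measurable lebesgue" for k
    unfolding h_def by (rule borel_measurable_ennreal_extend) simp
  have lim: "h0 k t = ennreal (dst (s k t) (g t))"
    if t: "t \<in> {0..b}" and l: "limitin (lsup_topology d N) (\<lambda>k. s k t) (g t) sequentially" for k t
  proof -
    have "(\<lambda>j. dst (s k t) (s j t)) \<longlonglongrightarrow> dst (s k t) (g t)"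
    proof (rule LIM_zero_cancel, rule Lim_null_comparison[OF _ limitin_dst(2)[OF l]])
      have "norm (dst (s k t) (s j t) - dst (s k t) (g t)) \<le> dst (s j t) (g t)" for j
        using M.triangle[of "s k t" "s j t" "g t"] M.triangle[of "s k t" "g t" "s j t"]
          M.commute[of "s j t" "g t"] s(2)[OF t] g[OF t] by (simp add: abs_le_iff)
      then show "\<forall>\<^sub>F j in sequentially. norm (dst (s k t) (s j t) - dst (s k t) (g t)) \<le>
          dst (s j t) (g t)"
        by simp
    qed
    then have "(\<lambda>j. ennreal (dst (s k t) (s j t))) \<longlonglongrightarrow> ennreal (dst (s k t) (g t))"
      by (rule tendsto_ennrealI)
    then show ?thesis unfolding h0_def by (intro lim_imp_Limsup) simp_all
  qed
  have AE_M: "AE t in ?M. h0 k t = ennreal (dst (s k t) (g t))" for k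
    using s(3) AE_space by eventually_elim (use lim in auto)
  have AE: "AE t in lebesgue. t \<in> {0..b} \<longrightarrow> ennreal (dst (s k t) (g t)) = h k t" for k
    using AE_M[of k] unfolding h_def
    by (subst (asm) AE_restrict_space_iff) (auto elim!: eventually_mono)
  have "(\<integral>\<^sup>+t. h k t \<partial>lebesgue) = (\<integral>\<^sup>+t. ennreal (dst (s k t) (g t)) \<partial>?M)" for k
  proof -
    have "(\<integral>\<^sup>+t. h k t \<partial>lebesgue) = (\<integral>\<^sup>+t. h0 k t \<partial>?M)"
      unfolding h_def by (simp add: nn_integral_restrict_space)
    also have "\<dots> = (\<integral>\<^sup>+t. ennreal (dst (s k t) (g t)) \<partial>?M)"
      by (rule nn_integral_cong_AE[OF AE_M])
    finally show ?thesis .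
  qed
  then have "(\<lambda>k. \<integral>\<^sup>+t. h k t \<partial>lebesgue) \<longlonglongrightarrow> 0" using s(4) by simp
  from that[OF s(1,2) h_meas AE this limitin_dst(2,1)[OF s(5)]] show ?thesis .
qed

text \<open>For extending an approximation on \<open>[0, a]\<close> by a constant to \<open>[0, b]\<close>.\<close>

lemma simple_glue:
  assumes q: "simple_function (lebesgue_on {0..a}) q" and ab: "0 \<le> a" "a \<le> b"
  shows "simple_function (lebesgue_on {0..b}) (\<lambda>t. if t \<le> a then q t else w)"
    and "simple_integral_on {0..b} (\<lambda>t. if t \<le> a then q t else w) i =
      simple_integral_on {0..a} q i + (b - a) *\<^sub>R w i"
proof -
  let ?M = "lebesgue_on {0..b}"
  \<comment> \<open>The partition has to separate \<open>w\<close> from values of \<open>q\<close> that equal \<open>w\<close>; hence the options.\<close>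
  define g where "g t = (if t \<le> a then Some (q t) else None)" for t
  have q_sets: "{t \<in> {0..a}. q t = v} \<in> sets lebesgue" and fin: "finite (q ` {0..a})" for v
  proof -
    show "finite (q ` {0..a})" using q unfolding simple_function_def by simp
    have "q -` {v} \<inter> space (lebesgue_on {0..a}) \<in> sets (lebesgue_on {0..a})"
      using q by (rule simple_functionD(2))
    then have "q -` {v} \<inter> {0..a} \<in> sets lebesgue" by (simp add: sets_restrict_space_iff)
    moreover have "q -` {v} \<inter> {0..a} = {t \<in> {0..a}. q t = v}" by auto
    ultimately show "{t \<in> {0..a}. q t = v} \<in> sets lebesgue" by simp
  qed
  have g_Some: "{t \<in> {0..b}. g t = Some v} = {t \<in> {0..a}. q t = v}" for v
    using ab unfolding g_def by auto
  have g_None: "{t \<in> {0..b}. g t = None} = {a<..b}"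
    using ab unfolding g_def by auto
  have g_img: "g ` {0..b} \<subseteq> insert None (Some ` q ` {0..a})" unfolding g_def by auto
  have g: "simple_function ?M g"
    unfolding simple_function_def
  proof (intro conjI ballI)
    show "finite (g ` space ?M)" using finite_subset[OF g_img] fin by simp
    fix v assume "v \<in> g ` space ?M"
    have "g -` {v} \<inter> space ?M = {t \<in> {0..b}. g t = v}" by auto
    also have "\<dots> \<in> sets lebesgue"
      by (cases v) (use g_None g_Some q_sets in \<open>simp_all add: lmeasurable_iff_integrable\<close>)
    finally show "g -` {v} \<inter> space ?M \<in> sets ?M"
      by (auto simp: sets_restrict_space_iff)
  qed
  define val where "val = case_option w (\<lambda>v. v)"
  have val: "(if t \<le> a then q t else w) = val (g t)" for t
    unfolding g_def val_def by simp
  show sf: "simple_function ?M (\<lambda>t. if t \<le> a then q t else w)"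
    unfolding val by (rule simple_function_compose1[OF g])
  have "simple_integral_on {0..b} (\<lambda>t. val (g t)) i =
      Bochner_Integration.simple_bochner_integral ?M (\<lambda>t. val (g t) i)"
    using simple_integral_on_eq(1)[OF sf] unfolding val .
  also have "\<dots> = (\<Sum>v\<in>g ` space ?M. measure ?M {t \<in> space ?M. g t = v} *\<^sub>R val v i)"
    by (rule simple_bochner_integral_partition[OF _ g])
      (use simple_integral_on_eq(2)[OF sf] in \<open>simp_all add: val\<close>)
  also have "\<dots> = (\<Sum>v\<in>insert None (Some ` q ` {0..a}). measure ?M {t \<in> {0..b}. g t = v} *\<^sub>R val v i)"
  proof (rule sum.mono_neutral_cong_left)
    show "finite (insert None (Some ` q ` {0..a}))" using fin by simp
    show "g ` space ?M \<subseteq> insert None (Some ` q ` {0..a})" using g_img by simp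
    show "\<forall>v\<in>insert None (Some ` q ` {0..a}) - g ` space ?M. measure ?M {t \<in> {0..b}. g t =
        v} *\<^sub>R val v i = 0"
    proof
      fix v assume "v \<in> insert None (Some ` q ` {0..a}) - g ` space ?M"
      then have empty: "{t \<in> {0..b}. g t = v} = {}" by auto
      show "measure ?M {t \<in> {0..b}. g t = v} *\<^sub>R val v i = 0" unfolding empty by simp
    qed
  qed simp
  also have "\<dots> = measure ?M {a<..b} *\<^sub>R w i + (\<Sum>v\<in>q ` {0..a}. measure ?M {t \<in> {0..a}. q t =
      v} *\<^sub>R v i)"
    using fin by (simp add: g_None[simplified] g_Some[simplified] val_def sum.reindex image_iff)
  also have "measure ?M {a<..b} = b - a"
    using ab by (subst measure_lebesgue_on_Icc) auto
  also have "(\<Sum>v\<in>q ` {0..a}. measure ?M {t \<in> {0..a}. q t = v} *\<^sub>R v i) = simple_integral_on {0..a} q i"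
    unfolding simple_integral_on_def using ab
    by (intro sum.cong refl) (subst measure_lebesgue_on_Icc, force, subst measure_lebesgue_on_Icc,
        auto)
  finally show "simple_integral_on {0..b} (\<lambda>t. if t \<le> a then q t else w) i =
      simple_integral_on {0..a} q i + (b - a) *\<^sub>R w i" unfolding val by simp
qed

text \<open>On \<open>[0, b]\<close> let \<open>s k\<close> approximate \<open>g\<close> in the integral defining \<open>y\<close>, and let \<open>s' k\<close>
approximate \<open>g\<close> on \<open>[0, a]\<close> in the one defining \<open>z\<close>. The integral of \<open>s k - q\<close>, where \<open>q\<close>
equals \<open>s' k\<close> up to \<open>a\<close> and \<open>w\<close> afterwards, tends to \<open>y - z - (b - a) w\<close>. On \<open>[0, a]\<close> the
integrand is small in the mean because both sequences approximate \<open>g\<close>, and on \<open>(a, b]\<close> it is at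
most \<open>H\<close> up to the approximation error. Comparing \<open>g\<close> with a constant \<open>w\<close> serves two purposes:
\<open>w = 0\<close> yields continuity of primitives, and \<open>w = g a\<close> their derivative.\<close>

lemma bochner_increment:
  assumes gz: "has_bochner_integral_on d N {0..a} g z" and gy: "has_bochner_integral_on d N {0..b} g y"
    and ab: "0 \<le> a" "a \<le> b" and w: "w \<in> X"
    and H: "H \<in> borel_measurable lebesgue"
      "AE t in lebesgue. a < t \<and> t \<le> b \<longrightarrow> ennreal (dst (g t) w) \<le> H t"
  shows "ennreal (N i (y i - z i - (b - a) *\<^sub>R w i)) \<le> (\<integral>\<^sup>+t. H t * indicator {a<..b} t \<partial>lebesgue)"
proof -
  let ?M = "lebesgue_on {0..b}"
  obtain s h where s: "\<And>k. simple_function ?M (s k)" "\<And>k t. t \<in> {0..b} \<Longrightarrow> s k t \<in> X"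
    and h: "\<And>k. h k \<in> borel_measurable lebesgue"
      "\<And>k. AE t in lebesgue. t \<in> {0..b} \<longrightarrow> ennreal (dst (s k t) (g t)) = h k t"
      "(\<lambda>k. \<integral>\<^sup>+t. h k t \<partial>lebesgue) \<longlonglongrightarrow> 0"
    and y: "(\<lambda>k. dst (simple_integral_on {0..b} (s k)) y) \<longlonglongrightarrow> 0" "y \<in> X"
    by (rule bochner_approximation[OF gy]) (rule that)
  obtain s' h' where s': "\<And>k. simple_function (lebesgue_on {0..a}) (s' k)"
      "\<And>k t. t \<in> {0..a} \<Longrightarrow> s' k t \<in> X"
    and h': "\<And>k. h' k \<in> borel_measurable lebesgue"
      "\<And>k. AE t in lebesgue. t \<in> {0..a} \<longrightarrow> ennreal (dst (s' k t) (g t)) = h' k t"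
      "(\<lambda>k. \<integral>\<^sup>+t. h' k t \<partial>lebesgue) \<longlonglongrightarrow> 0"
    and z: "(\<lambda>k. dst (simple_integral_on {0..a} (s' k)) z) \<longlonglongrightarrow> 0" "z \<in> X"
    by (rule bochner_approximation[OF gz]) (rule that)
  have g: "g t \<in> X" if "t \<in> {0..b}" for t using gy that unfolding has_bochner_integral_on_def
    by blast
  let ?I = "\<integral>\<^sup>+t. H t * indicator {a<..b} t \<partial>lebesgue"
  have bound: "ennreal (N i (y i - z i - (b - a) *\<^sub>R w i)) \<le>
      ennreal (dst (simple_integral_on {0..b} (s k)) y) +
          ennreal (dst (simple_integral_on {0..a} (s' k)) z)
      + ((\<integral>\<^sup>+t. h k t \<partial>lebesgue) + (\<integral>\<^sup>+t. h' k t \<partial>lebesgue) + ?I)" for k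
  proof -
    define q where "q t = (if t \<le> a then s' k t else w)" for t
    define p where "p t = (\<lambda>i. s k t i - q t i)" for t
    have q: "simple_function ?M q" "\<And>i. simple_integral_on {0..b} q i =
        simple_integral_on {0..a} (s' k) i + (b - a) *\<^sub>R w i"
      unfolding q_def using simple_glue[OF s'(1) ab] by auto
    have qX: "q t \<in> X" if "t \<in> {0..b}" for t using that s'(2) w unfolding q_def by auto
    have p: "simple_function ?M p"
      unfolding p_def by (rule simple_function_compose2[OF s(1) q(1)])
    have pX: "p t \<in> X" if "t \<in> {0..b}" for t
      unfolding p_def by (intro diff_mem s(2) qX that)
    have int_p: "simple_integral_on {0..b} p i =
        simple_integral_on {0..b} (s k) i - simple_integral_on {0..a} (s' k) i - (b - a) *\<^sub>R w i"
      unfolding simple_integral_on_eq(1)[OF p]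
      unfolding p_def
      by (subst simple_bochner_integral_diff[OF simple_integral_on_eq(2)[OF s(1)]
          simple_integral_on_eq(2)[OF q(1)]])
        (simp add: simple_integral_on_eq(1)[OF s(1), symmetric] simple_integral_on_eq(1)[OF q(1),
            symmetric] q(2))
    have AE_p: "AE t in lebesgue. ennreal (lsup_norm N (p t)) * indicator {0..b} t \<le> h k t +
        h' k t + H t * indicator {a<..b} t"
      using h(2)[of k] h'(2)[of k] H(2)
    proof eventually_elim
      case (elim t)
      show ?case
      proof (cases "t \<in> {0..b}")
        case True
        note memb = s(2)[OF True, of k] g[OF True] qX[OF True]
        have "lsup_norm N (p t) = dst (s k t) (q t)" using memb unfolding p_def
          by (simp add: dst_eq)
        also have "\<dots> \<le> dst (s k t) (g t) + dst (q t) (g t)"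
          using M.triangle[of "s k t" "g t" "q t"] M.commute[of "g t" "q t"] memb by simp
        finally have "ennreal (lsup_norm N (p t)) \<le> ennreal (dst (s k t) (g t)) +
            ennreal (dst (q t) (g t))"
          by (metis M.nonneg ennreal_leI ennreal_plus)
        also have "ennreal (dst (s k t) (g t)) = h k t" using elim True by blast
        also have "ennreal (dst (q t) (g t)) \<le> h' k t + H t * indicator {a<..b} t"
        proof (cases "t \<le> a")
          case True
          then show ?thesis using elim \<open>t \<in> {0..b}\<close> by (simp add: q_def)
        next
          case False
          then have "ennreal (dst w (g t)) \<le> H t" using elim \<open>t \<in> {0..b}\<close> by (simp add: M.commute)
          then show ?thesis using False \<open>t \<in> {0..b}\<close> by (simp add: q_def add_increasing)
        qed
        finally show ?thesis using True by (simp add: add.assoc add_left_mono)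
      qed simp
    qed
    have "ennreal (N i (simple_integral_on {0..b} p i)) \<le> (\<integral>\<^sup>+t. ennreal (lsup_norm N (p t)) \<partial>?M)"
      by (rule N_simple_integral_on_le(2)[OF p pX])
    also have "\<dots> = (\<integral>\<^sup>+t. ennreal (lsup_norm N (p t)) * indicator {0..b} t \<partial>lebesgue)"
      by (simp add: nn_integral_restrict_space)
    also have "\<dots> \<le> (\<integral>\<^sup>+t. h k t + h' k t + H t * indicator {a<..b} t \<partial>lebesgue)"
      by (rule nn_integral_mono_AE[OF AE_p])
    also have "\<dots> = (\<integral>\<^sup>+t. h k t \<partial>lebesgue) + (\<integral>\<^sup>+t. h' k t \<partial>lebesgue) + ?I"
    proof -
      have [measurable]: "{a<..b} \<in> sets lebesgue" by simp
      have [measurable]: "h k \<in> borel_measurable lebesgue" "h' k \<in> borel_measurable lebesgue"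
        by (fact h(1) h'(1))+
      have [measurable]: "(\<lambda>t. H t * indicator {a<..b} t) \<in> borel_measurable lebesgue"
        using H(1) by (intro borel_measurable_times_ennreal borel_measurable_indicator) simp_all
      have "(\<lambda>t. h k t + h' k t) \<in> borel_measurable lebesgue"
        by (intro borel_measurable_add h(1) h'(1))
      then show ?thesis
        by (subst nn_integral_add) (simp_all add: nn_integral_add h(1) h'(1))
    qed
    finally have P: "ennreal (N i (simple_integral_on {0..b} p i)) \<le> \<dots>" .
    let ?S = "simple_integral_on {0..b} (s k)" and ?S' = "simple_integral_on {0..a} (s' k)"
    have S: "?S \<in> X" by (rule N_simple_integral_on_le(1)[OF s])
    have S': "?S' \<in> X" by (rule N_simple_integral_on_le(1)[OF s'])
    have pI: "simple_integral_on {0..b} p \<in> X" by (rule N_simple_integral_on_le(1)[OF p pX])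
    have "y i - z i - (b - a) *\<^sub>R w i = simple_integral_on {0..b} p i + ((y i - ?S i) - (z i - ?S' i))"
      unfolding int_p by simp
    also have "N i \<dots> \<le> N i (simple_integral_on {0..b} p i) + N i ((y i - ?S i) - (z i - ?S' i))"
      by (intro is_norm_on_triangle[OF N] Rn_diff mem_Rn pI S S' y(2) z(2))
    also have "N i ((y i - ?S i) - (z i - ?S' i)) \<le> N i (y i - ?S i) + N i (z i - ?S' i)"
      using N_diff_triangle[OF diff_mem[OF y(2) S] diff_mem[OF z(2) S']] .
    also have "N i (y i - ?S i) \<le> dst ?S y" using N_le_dst[OF y(2) S] by (simp add: M.commute)
    also have "N i (z i - ?S' i) \<le> dst ?S' z" using N_le_dst[OF z(2) S'] by (simp add: M.commute)
    finally have "ennreal (N i (y i - z i - (b - a) *\<^sub>R w i))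
        \<le> ennreal (N i (simple_integral_on {0..b} p i) + (dst ?S y + dst ?S' z))"
      by (intro ennreal_leI) simp
    also have "\<dots> = ennreal (dst ?S y) + ennreal (dst ?S' z) +
        ennreal (N i (simple_integral_on {0..b} p i))"
      using is_norm_on_nonneg[OF N mem_Rn[OF pI]] by (simp add: add.commute)
    also have "\<dots> \<le> ennreal (dst ?S y) + ennreal (dst ?S' z)
        + ((\<integral>\<^sup>+t. h k t \<partial>lebesgue) + (\<integral>\<^sup>+t. h' k t \<partial>lebesgue) + ?I)"
      by (rule add_left_mono[OF P])
    finally show ?thesis .
  qed
  show ?thesis
  proof (rule LIMSEQ_le_const)
    show "(\<lambda>k. ennreal (dst (simple_integral_on {0..b} (s k)) y) +
        ennreal (dst (simple_integral_on {0..a} (s' k)) z)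
      + ((\<integral>\<^sup>+t. h k t \<partial>lebesgue) + (\<integral>\<^sup>+t. h' k t \<partial>lebesgue) + ?I)) \<longlonglongrightarrow> ?I"
      using tendsto_add[OF tendsto_add[OF tendsto_ennrealI[OF y(1)] tendsto_ennrealI[OF z(1)]]
        tendsto_add[OF tendsto_add[OF h(3) h'(3)] tendsto_const[of ?I]]] by simp
    show "\<exists>K. \<forall>k\<ge>K. ennreal (N i (y i - z i - (b - a) *\<^sub>R w i)) \<le>
      ennreal (dst (simple_integral_on {0..b} (s k)) y) +
          ennreal (dst (simple_integral_on {0..a} (s' k)) z)
      + ((\<integral>\<^sup>+t. h k t \<partial>lebesgue) + (\<integral>\<^sup>+t. h' k t \<partial>lebesgue) + ?I)"
      using bound by blast
  qed
qed

end

section \<open>Continuity of primitives and the size of inputs\<close>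

context lsup
begin

lemma primitive_increment:
  assumes prim: "has_bochner_integral_on d N {0..a} g z" "has_bochner_integral_on d N {0..b} g y"
    and ab: "0 \<le> a" "a \<le> b" and w: "w \<in> X" and \<eta>: "0 \<le> \<eta>"
    and near: "\<And>t. a < t \<Longrightarrow> t \<le> b \<Longrightarrow> dst (g t) w \<le> \<eta>"
  shows "N i (y i - z i - (b - a) *\<^sub>R w i) \<le> \<eta> * (b - a)"
proof -
  have "ennreal (N i (y i - z i - (b - a) *\<^sub>R w i)) \<le>
      (\<integral>\<^sup>+t. ennreal \<eta> * indicator {a<..b} t \<partial>lebesgue)"
    by (rule bochner_increment[OF prim ab w]) (auto intro!: AE_I2 ennreal_leI near)
  also have "\<dots> = ennreal (\<eta> * (b - a))"
    using ab \<eta> by (subst nn_integral_cmult_indicator) (simp_all add: ennreal_mult)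
  finally show ?thesis using \<eta> ab by (subst (asm) ennreal_le_iff) auto
qed

text \<open>The integrand need not be bounded, but a fixed simple function \<open>s k\<close> is, and \<open>g\<close> differs
from it by little in the mean.\<close>

lemma primitive_uniformly_continuous:
  assumes prim: "\<And>t. 0 \<le> t \<Longrightarrow> t \<le> c \<Longrightarrow> has_bochner_integral_on d N {0..t} g (y t)"
    and c: "0 \<le> c" and \<epsilon>: "0 < \<epsilon>"
  obtains \<delta> where "0 < \<delta>"
    "\<And>a b i. 0 \<le> a \<Longrightarrow> a \<le> b \<Longrightarrow> b \<le> c \<Longrightarrow> b - a < \<delta> \<Longrightarrow> N i (y b i - y a i) \<le> \<epsilon>"
proof -
  obtain s h where s: "\<And>k. simple_function (lebesgue_on {0..c}) (s k)" "\<And>k t. t \<in> {0..c} \<Longrightarrow> s k t \<in> X"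
    and h: "\<And>k. h k \<in> borel_measurable lebesgue"
      "\<And>k. AE t in lebesgue. t \<in> {0..c} \<longrightarrow> ennreal (dst (s k t) (g t)) = h k t"
      "(\<lambda>k. \<integral>\<^sup>+t. h k t \<partial>lebesgue) \<longlonglongrightarrow> 0"
    and yX: "(\<lambda>k. dst (simple_integral_on {0..c} (s k)) (y c)) \<longlonglongrightarrow> 0" "y c \<in> X"
    by (rule bochner_approximation[OF prim[OF c order.refl]]) (rule that)
  have "\<forall>\<^sub>F k in sequentially. (\<integral>\<^sup>+t. h k t \<partial>lebesgue) < ennreal (\<epsilon>/2)"
    using h(3) \<epsilon> by (intro order_tendstoD(2)) auto
  then obtain k where k: "(\<integral>\<^sup>+t. h k t \<partial>lebesgue) \<le> ennreal (\<epsilon>/2)"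
    by (auto simp: eventually_sequentially intro: less_imp_le)
  have fin: "finite (s k ` {0..c})" using s(1)[of k] unfolding simple_function_def by simp
  obtain K where K: "0 < K" "\<And>t. t \<in> {0..c} \<Longrightarrow> lsup_norm N (s k t) \<le> K"
  proof (rule that[of "Max (insert 0 (lsup_norm N ` s k ` {0..c})) + 1"])
    have "0 \<le> Max (insert 0 (lsup_norm N ` s k ` {0..c}))" using fin by (intro Max_ge) auto
    then show "0 < Max (insert 0 (lsup_norm N ` s k ` {0..c})) + 1" by simp
    fix t assume "t \<in> {0..c}"
    then have "lsup_norm N (s k t) \<le> Max (insert 0 (lsup_norm N ` s k ` {0..c}))"
      using fin by (intro Max_ge) auto
    then show "lsup_norm N (s k t) \<le> Max (insert 0 (lsup_norm N ` s k ` {0..c})) + 1" by simp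
  qed
  have g: "g t \<in> X" if "t \<in> {0..c}" for t
    using prim[OF c order.refl] that unfolding has_bochner_integral_on_def
    by (elim conjE) (rule bspec)
  show ?thesis
  proof (rule that[of "\<epsilon> / (2 * K)"])
    show "0 < \<epsilon> / (2 * K)" using \<epsilon> K by simp
    fix a b i assume ab: "0 \<le> a" "a \<le> b" "b \<le> c" "b - a < \<epsilon> / (2 * K)"
    have ae: "AE t in lebesgue. a < t \<and> t \<le> b \<longrightarrow> ennreal (dst (g t) (\<lambda>_. 0)) \<le> ennreal K + h k t"
      using h(2)[of k]
    proof eventually_elim
      case (elim t)
      show ?case
      proof
        assume "a < t \<and> t \<le> b"
        then have t: "t \<in> {0..c}" using ab by simp
        have "dst (g t) (\<lambda>_. 0) \<le> K + dst (s k t) (g t)"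
          using norm_le_dst[OF g[OF t] s(2)[OF t], of k] K(2)[OF t]
            M.commute[of "s k t" "g t"] by (simp add: dst_zero[OF g[OF t]])
        then have "ennreal (dst (g t) (\<lambda>_. 0)) \<le> ennreal K + ennreal (dst (s k t) (g t))"
          using ennreal_leI ennreal_plus[of K "dst (s k t) (g t)"] K(1) M.nonneg[of "s k t" "g t"]
          by (metis less_imp_le)
        with elim t show "ennreal (dst (g t) (\<lambda>_. 0)) \<le> ennreal K + h k t" by simp
      qed
    qed
    have meas: "(\<lambda>t. ennreal K + h k t) \<in> borel_measurable lebesgue"
      by (intro borel_measurable_add h(1) borel_measurable_const)
    have "ennreal (N i (y b i - y a i - (b - a) *\<^sub>R 0)) \<le> (\<integral>\<^sup>+t. (ennreal K +
        h k t) * indicator {a<..b} t \<partial>lebesgue)"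
      using ab
      by (intro bochner_increment[where w = "\<lambda>_. 0", OF _ _ _ _ zero_mem meas ae] prim) auto
    also have "\<dots> \<le> (\<integral>\<^sup>+t. ennreal K * indicator {a<..b} t + h k t \<partial>lebesgue)"
      by (intro nn_integral_mono) (auto simp: indicator_def)
    also have "\<dots> = (\<integral>\<^sup>+t. ennreal K * indicator {a<..b} t \<partial>lebesgue) + (\<integral>\<^sup>+t. h k t \<partial>lebesgue)"
      by (rule nn_integral_add[OF _ h(1)]) (intro borel_measurable_times_ennreal
          borel_measurable_indicator, simp_all)
    also have "(\<integral>\<^sup>+t. ennreal K * indicator {a<..b} t \<partial>lebesgue) = ennreal (K * (b - a))"
      using ab K(1) by (subst nn_integral_cmult_indicator) (simp_all add: ennreal_mult)
    also have "ennreal (K * (b - a)) + (\<integral>\<^sup>+t. h k t \<partial>lebesgue) \<le> ennreal (\<epsilon>/2) + ennreal (\<epsilon>/2)"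
      using ab K(1) by (intro add_mono k ennreal_leI) (simp add: field_simps)
    also have "\<dots> = ennreal \<epsilon>" using \<epsilon> by (subst ennreal_plus[symmetric]) auto
    finally show "N i (y b i - y a i) \<le> \<epsilon>" using \<epsilon> by (subst (asm) ennreal_le_iff) auto
  qed
qed

lemma bochner_integral_on_point:
  assumes "has_bochner_integral_on d N {0..0} g y"
  shows "y = (\<lambda>_. 0)"
proof -
  obtain s h where s: "(\<lambda>k. dst (simple_integral_on {0..0} (s k)) y) \<longlonglongrightarrow> 0" "y \<in> X"
    by (rule bochner_approximation[OF assms]) (rule that)
  have "simple_integral_on {0..0} (s k) = (\<lambda>_. 0)" for k
  proof -
    have m: "measure (lebesgue_on {0..0}) A = 0" if "A \<subseteq> {0::real}" for A
      using that measure_lebesgue_on_Icc[of A 0] by (auto dest!: subset_singletonD)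
    have "measure (lebesgue_on {0..0}) {t \<in> {0..0}. s k t = v} = 0" for v by (rule m) auto
    then show ?thesis unfolding simple_integral_on_def
      by (intro ext sum.neutral ballI) (simp only: scaleR_zero_left)
  qed
  with s have "dst (\<lambda>_. 0) y = 0" by (simp add: LIMSEQ_const_iff)
  then show ?thesis using s(2) zero_mem by simp
qed

lemma continuous_map_real_to_lsup:
  "continuous_map (top_of_set T) (lsup_topology d N) x \<longleftrightarrow>
    (\<forall>t\<in>T. x t \<in> X) \<and> (\<forall>t\<in>T. \<forall>\<epsilon>>0. \<exists>r>0. \<forall>s\<in>T. \<bar>s - t\<bar> < r \<longrightarrow> dst (x t) (x s) < \<epsilon>)"
  for T :: "real set"
proof -
  interpret T: Submetric UNIV dist T by unfold_locales simp
  have "top_of_set T = Metric_space.mtopology T dist" by (simp add: T.mtopology_submetric)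
  then show ?thesis
    unfolding lsup_topology_def
    by
        (simp add: Metric_space.metric_continuous_map[OF T.sub.Metric_space_axioms
            M.Metric_space_axioms]
      dist_real_def abs_minus_commute image_subset_iff Ball_def imp_conjL)
qed

lemma continuous_map_from_lsup:
  fixes V :: "(nat \<Rightarrow> linf) \<Rightarrow> real"
  assumes "\<And>x \<epsilon>. x \<in> X \<Longrightarrow> 0 < \<epsilon> \<Longrightarrow> \<exists>\<delta>>0. \<forall>y\<in>X. dst x y < \<delta> \<longrightarrow> \<bar>V y - V x\<bar> < \<epsilon>"
  shows "continuous_map (lsup_topology d N) euclideanreal V"
  unfolding lsup_topology_def M.continuous_map_from_metric
proof (intro conjI ballI allI impI)
  fix x U assume x: "x \<in> X" and U: "openin euclideanreal U \<and> V x \<in> U"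
  then obtain \<epsilon> where e: "0 < \<epsilon>" "\<And>r. \<bar>r - V x\<bar> < \<epsilon> \<Longrightarrow> r \<in> U"
    by (auto simp: open_dist dist_real_def)
  from assms[OF x e(1)] obtain \<delta> where d: "\<delta> > 0" "\<And>y. y \<in> X \<Longrightarrow> dst x y < \<delta> \<Longrightarrow> \<bar>V y - V x\<bar> < \<epsilon>"
    by blast
  show "\<exists>r>0. \<forall>y. y \<in> X \<and> dst x y < r \<longrightarrow> V y \<in> U"
    using d e(2) by blast
qed simp

text \<open>If the bound failed at \<open>t\<close>, then by right-continuity it would fail on a whole interval
\<open>[t, t + q]\<close>, which is not a null set.\<close>

lemma input_le_norm:
  assumes u: "u \<in> inputs d N" and t: "0 \<le> t"
  shows "lsup_norm N (u t) \<le> input_norm N u"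
proof -
  define E where "E = esssup (lebesgue_on {0..}) (\<lambda>t. ereal (lsup_norm N (u t)))"
  have E: "E < \<infinity>" using u unfolding inputs_def E_def by simp
  obtain a where a: "a 0 = 0" "strict_mono a" "filterlim a at_top sequentially"
    "\<And>k. continuous_map (top_of_set {a k..<a (Suc k)}) (lsup_topology d N) u"
    using u unfolding inputs_def by blast
  have "\<exists>j. t < a j"
    using a(3) unfolding filterlim_at_top_dense by (auto simp: eventually_sequentially)
  \<comment> \<open>Locates the interval of continuity that contains \<open>t\<close>.\<close>
  define j where "j = (LEAST j. t < a j)"
  have j: "t < a j" unfolding j_def using \<open>\<exists>j. t < a j\<close> by (rule LeastI_ex)
  then have "j \<noteq> 0" using a(1) t by (metis not_less)
  then obtain k where k: "j = Suc k" using not0_implies_Suc by blast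
  have "\<not> t < a k" using not_less_Least[of k "\<lambda>j. t < a j"] k unfolding j_def by simp
  then have tk: "t \<in> {a k..<a (Suc k)}" using j k by simp
  note cont = a(4)[of k, unfolded continuous_map_real_to_lsup]
  have uX: "u s \<in> X" if "0 \<le> s" for s using u that unfolding inputs_def by simp
  have "ereal (lsup_norm N (u t)) \<le> E"
  proof (rule ccontr)
    assume "\<not> ereal (lsup_norm N (u t)) \<le> E"
    then have "E < ereal (lsup_norm N (u t))" by simp
    then obtain z where "E < ereal z" "ereal z < ereal (lsup_norm N (u t))"
      using ereal_dense2 by blast
    then have z: "E < ereal z" "z < lsup_norm N (u t)" by simp_all
    obtain r where r: "r > 0" "\<And>s. s \<in> {a k..<a (Suc k)} \<Longrightarrow> \<bar>s - t\<bar> < r \<Longrightarrow>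
        dst (u t) (u s) < lsup_norm N (u t) - z"
      using cont tk z(2) by (metis diff_gt_0_iff_gt)
    define q where "q = min (r / 2) ((a (Suc k) - t) / 2)"
    have q: "0 < q" "q < r" "t + q < a (Suc k)" using r(1) tk unfolding q_def
      by (auto simp: min_def field_simps)
    have big: "\<not> ereal (lsup_norm N (u s)) \<le> E" if s: "s \<in> {t..t+q}" for s
    proof -
      have "dst (u t) (u s) < lsup_norm N (u t) - z" using s q tk by (intro r(2)) auto
      then have "z < lsup_norm N (u s)"
        using norm_le_dst[of "u t" "u s"] uX[of t] uX[of s] t s by auto
      then have "E < ereal (lsup_norm N (u s))" using z(1)
        by (meson ereal_less_eq(3) less_imp_le order_less_le_trans)
      then show ?thesis by simp
    qed
    have "AE s in lebesgue_on {0..}. ereal (lsup_norm N (u s)) \<le> E" unfolding E_def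
      by (rule esssup_AE)
    then have "AE s in lebesgue. s \<in> {0..} \<longrightarrow> ereal (lsup_norm N (u s)) \<le> E"
      by (simp add: AE_restrict_space_iff)
    then have "AE s in lebesgue. s \<notin> {t..t+q}" using big t by (auto elim!: eventually_mono)
    then have "{t..t+q} \<in> null_sets lebesgue" by (subst AE_iff_null_sets) auto
    then show False using q(1) by (auto simp: null_sets_def)
  qed
  moreover have "0 \<le> ereal (lsup_norm N (u t))" using norm_nonneg[OF uX[OF t]] by simp
  ultimately show ?thesis using E unfolding input_norm_def E_def[symmetric] by (cases E) auto
qed

end

section \<open>Local behaviour of the flow\<close>

locale infinite_system = X: lsup n nx + U: lsup m nu
  for n m :: "nat \<Rightarrow> nat" and nx nu :: "nat \<Rightarrow> linf \<Rightarrow> real" +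
  fixes F :: "(nat \<Rightarrow> linf) \<Rightarrow> (nat \<Rightarrow> linf) \<Rightarrow> (nat \<Rightarrow> linf)"
  assumes F_cont: "continuous_map (prod_topology (lsup_topology n nx) (lsup_topology m nu))
               (lsup_topology n nx) (\<lambda>(x, u). F x u)"
    and F_bound: "0 < R \<Longrightarrow> \<exists>C. \<forall>x\<in>lsup_space n nx. \<forall>v\<in>lsup_space m nu.
               lsup_norm nx x \<le> R \<and> lsup_norm nu v \<le> R \<longrightarrow> lsup_norm nx (F x v) \<le> C"
    and wp: "well_posed n nx m nu F"
begin

lemma flow_eq:
  assumes x0: "x0 \<in> X.X" "u \<in> inputs m nu" and sol: "is_solution n nx F x0 u T x"
    and t: "0 \<le> t" "ereal t < T"
  shows "flow n nx F t x0 u = x t"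
  unfolding flow_def
proof (rule the_equality)
  show "\<exists>T y. is_solution n nx F x0 u T y \<and> ereal t < T \<and> y t = x t" using sol t by blast
  fix y assume "\<exists>T x. is_solution n nx F x0 u T x \<and> ereal t < T \<and> x t = y"
  then show "y = x t" using wp x0 sol t unfolding well_posed_def by blast
qed

text \<open>As long as \<open>t\<close> stays in the first interval of continuity of the input, the right-hand
side along the trajectory is continuous in the supremum norm, hence each component is
differentiable there. The estimate of the displacement by a bound \<open>C\<close> of the right-hand side is
uniform over all components.\<close>

lemma local_flow:
  assumes x0: "x0 \<in> X.X" and u: "u \<in> inputs m nu"
  defines "z \<equiv> \<lambda>t. flow n nx F t x0 u"
  obtains \<delta> where "0 < \<delta>" "z 0 = x0" "\<And>t. 0 \<le> t \<Longrightarrow> t < \<delta> \<Longrightarrow> z t \<in> X.X"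
    "\<And>\<epsilon>. 0 < \<epsilon> \<Longrightarrow> \<exists>r>0. \<forall>t. 0 \<le> t \<and> t < r \<longrightarrow> X.dst (z t) x0 < \<epsilon>"
    "\<And>t i. 0 \<le> t \<Longrightarrow> t < \<delta> \<Longrightarrow>
      ((\<lambda>t. z t i) has_vector_derivative F (z t) (u t) i) (at t within {0..<\<delta>})"
    "\<And>t C. 0 \<le> t \<Longrightarrow> t < \<delta> \<Longrightarrow> 0 \<le> C \<Longrightarrow>
      \<forall>s\<in>{0<..t}. lsup_norm nx (F (z s) (u s)) \<le> C \<Longrightarrow> X.dst (z t) x0 \<le> C * t"
proof -
  obtain T x where sol: "is_solution n nx F x0 u T x"
    using wp x0 u unfolding well_posed_def by blast
  then have T: "0 < T" unfolding is_solution_def by blast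
  obtain c where c: "0 < c" "ereal c < T" using ereal_dense2[OF T] by auto
  obtain a where a: "a 0 = 0" "strict_mono a"
    "\<And>k. continuous_map (top_of_set {a k..<a (Suc k)}) (lsup_topology m nu) u"
    using u unfolding inputs_def by blast
  have a1: "0 < a 1" using strict_monoD[OF a(2), of 0 1] a(1) by simp
  define \<delta> where "\<delta> = min (a 1) c"
  have \<delta>: "0 < \<delta>" "\<delta> \<le> a 1" "\<delta> \<le> c" using a1 c unfolding \<delta>_def by auto
  define G where "G t = F (x t) (u t)" for t
  have lt_T: "ereal t < T" if "t \<le> c" for t using that c(2)
    by (meson ereal_less_eq(3) order_le_less_trans)
  have prim: "has_bochner_integral_on n nx {0..t} G (\<lambda>i. x t i - x0 i)" and xX: "x t \<in> X.X"
    if "0 \<le> t" "t \<le> c" for t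
    using sol lt_T[OF that(2)] that(1) unfolding is_solution_def G_def by auto
  have zx: "z t = x t" if "0 \<le> t" "t \<le> c" for t
    unfolding z_def using flow_eq[OF x0 u sol that(1) lt_T[OF that(2)]] .
  have x_0: "x 0 = x0"
    using X.bochner_integral_on_point[OF prim[of 0]] c by (simp add: fun_eq_iff)
  have x_dst: "X.dst (x t) (x s) \<le> e"
    if "0 \<le> s" "s \<le> t" "t \<le> c" "\<And>i. nx i (x t i - x s i) \<le> e" for s t e
    using that xX[of s] xX[of t] by (subst X.dst_eq) (auto intro: X.norm_least)
  have x_unif: "\<exists>r>0. \<forall>s t. 0 \<le> s \<and> s \<le> t \<and> t \<le> c \<and> t - s < r \<longrightarrow> X.dst (x t) (x s) < \<epsilon>"
      if \<epsilon>: "0 < \<epsilon>" for \<epsilon>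
  proof -
    obtain r where r: "0 < r" "\<And>a b i. 0 \<le> a \<Longrightarrow> a \<le> b \<Longrightarrow> b \<le> c \<Longrightarrow> b - a < r \<Longrightarrow>
        nx i ((x b i - x0 i) - (x a i - x0 i)) \<le> \<epsilon> / 2"
      by (rule X.primitive_uniformly_continuous[of c G "\<lambda>t i. x t i - x0 i" "\<epsilon>/2"])
        (use prim c \<epsilon> in auto)
    show ?thesis
    proof (intro exI[of _ r] conjI allI impI r(1))
      fix s t assume st: "0 \<le> s \<and> s \<le> t \<and> t \<le> c \<and> t - s < r"
      then have "X.dst (x t) (x s) \<le> \<epsilon> / 2" using r(2)[of s t] by (intro x_dst) auto
      then show "X.dst (x t) (x s) < \<epsilon>" using \<epsilon> by simp
    qed
  qed
  have x_cont: "continuous_map (top_of_set {0..<\<delta>}) (lsup_topology n nx) x"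
    unfolding X.continuous_map_real_to_lsup
  proof (intro conjI ballI allI impI)
    fix t assume t: "t \<in> {0..<\<delta>}"
    show "x t \<in> X.X" using t \<delta> by (intro xX) auto
    fix \<epsilon> :: real assume "0 < \<epsilon>"
    from x_unif[OF this] obtain r where r: "r > 0"
      "\<And>s t. 0 \<le> s \<and> s \<le> t \<and> t \<le> c \<and> t - s < r \<Longrightarrow> X.dst (x t) (x s) < \<epsilon>" by blast
    show "\<exists>r>0. \<forall>s\<in>{0..<\<delta>}. \<bar>s - t\<bar> < r \<longrightarrow> X.dst (x t) (x s) < \<epsilon>"
    proof (intro exI[of _ r] conjI ballI impI r(1))
      fix s assume "s \<in> {0..<\<delta>}" "\<bar>s - t\<bar> < r"
      then show "X.dst (x t) (x s) < \<epsilon>"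
        using t \<delta> r(2)[of s t] r(2)[of t s] X.M.commute[of "x t" "x s"] by (cases "s \<le> t") auto
    qed
  qed
  have "continuous_map (top_of_set {0..<\<delta>}) (lsup_topology m nu) u"
  proof -
    have "{0..<\<delta>} \<subseteq> {a 0..<a (Suc 0)}" using \<delta> a(1) by auto
    then show ?thesis using a(3)[of 0] unfolding U.continuous_map_real_to_lsup
      by (meson subsetD)
  qed
  from continuous_map_compose[OF continuous_map_pairedI[OF x_cont this] F_cont]
  have G_cont: "continuous_map (top_of_set {0..<\<delta>}) (lsup_topology n nx) G"
    by (simp add: o_def G_def[abs_def])
  have GX: "G t \<in> X.X" if "t \<in> {0..<\<delta>}" for t
    using G_cont that unfolding X.continuous_map_real_to_lsup by blast
  have incr: "nx i (x t i - x s i - (t - s) *\<^sub>R w i) \<le> \<eta> * (t - s)"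
    if "0 \<le> s" "s \<le> t" "t \<le> c" "w \<in> X.X" "0 \<le> \<eta>" "\<And>\<tau>. s < \<tau> \<Longrightarrow> \<tau> \<le> t \<Longrightarrow> X.dst (G \<tau>) w \<le> \<eta>" for s t w \<eta> i
    using X.primitive_increment[OF prim[of s] prim[of t], of w \<eta> i] that by simp
  have deriv: "((\<lambda>t. x t i) has_vector_derivative G t i) (at t within {0..<\<delta>})"
      if t: "t \<in> {0..<\<delta>}" for t i
    unfolding has_vector_derivative_def has_derivative_within_alt
  proof (intro conjI allI impI)
    show "bounded_linear (\<lambda>s. s *\<^sub>R G t i)" by (rule bounded_linear_scaleR_left)
    fix e :: real assume e: "0 < e"
    obtain k where k: "0 < k" "\<And>v. v \<in> Rn (n i) \<Longrightarrow> norm v \<le> k * nx i v"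
      using norm_le_is_norm_on[OF X.N[of i]] by blast
    have "0 < e / k" using e k by simp
    then obtain r where r: "r > 0" "\<And>s. s \<in> {0..<\<delta>} \<Longrightarrow> \<bar>s - t\<bar> < r \<Longrightarrow> X.dst (G t) (G s) < e / k"
      using G_cont t unfolding X.continuous_map_real_to_lsup by meson
    show "\<exists>d>0. \<forall>s\<in>{0..<\<delta>}. norm (s - t) < d \<longrightarrow>
        norm (x s i - x t i - (s - t) *\<^sub>R G t i) \<le> e * norm (s - t)"
    proof (intro exI[of _ r] conjI ballI impI r(1))
      fix s assume s: "s \<in> {0..<\<delta>}" "norm (s - t) < r"
      have near: "X.dst (G \<tau>) (G t) \<le> e / k" if "\<tau> \<in> {0..<\<delta>}" "\<bar>\<tau> - t\<bar> < r" for \<tau>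
        using r(2)[OF that] X.M.commute[of "G t" "G \<tau>"] by simp
      have mem: "x s i \<in> Rn (n i)" "x t i \<in> Rn (n i)" "G t i \<in> Rn (n i)"
        using xX[of s] xX[of t] GX[OF t] s t \<delta> by (auto intro: X.mem_Rn)
      have mem': "x s i - x t i - (s - t) *\<^sub>R G t i \<in> Rn (n i)"
          "x t i - x s i - (t - s) *\<^sub>R G t i \<in> Rn (n i)"
        by (intro Rn_diff Rn_scaleR mem)+
      have "norm (x s i - x t i - (s - t) *\<^sub>R G t i) \<le> k * (e / k * \<bar>s - t\<bar>)"
      proof (cases "t \<le> s")
        case True
        have "nx i (x s i - x t i - (s - t) *\<^sub>R G t i) \<le> e / k * (s - t)"
          using True t s \<delta> e k by (intro incr GX near) auto
        then have "k * nx i (x s i - x t i - (s - t) *\<^sub>R G t i) \<le> k * (e / k * \<bar>s - t\<bar>)"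
          using k True by (intro mult_left_mono) auto
        with k(2)[OF mem'(1)] show ?thesis by (rule order_trans)
      next
        case False
        have "nx i (x t i - x s i - (t - s) *\<^sub>R G t i) \<le> e / k * (t - s)"
          using False t s \<delta> e k by (intro incr GX near) auto
        then have "k * nx i (x t i - x s i - (t - s) *\<^sub>R G t i) \<le> k * (e / k * \<bar>s - t\<bar>)"
          using k False by (intro mult_left_mono) auto
        with k(2)[OF mem'(2)] have "norm (x t i - x s i - (t - s) *\<^sub>R G t i) \<le> k * (e / k * \<bar>s - t\<bar>)"
          by (rule order_trans)
        moreover have "x s i - x t i - (s - t) *\<^sub>R G t i = - (x t i - x s i - (t - s) *\<^sub>R G t i)"
          by (simp add: algebra_simps)
        ultimately show ?thesis by (simp only: norm_minus_cancel)
      qed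
      then show "norm (x s i - x t i - (s - t) *\<^sub>R G t i) \<le> e * norm (s - t)" using k by simp
    qed
  qed
  show ?thesis
  proof (rule that[OF \<delta>(1)])
    show "z 0 = x0" using zx[of 0] x_0 c by simp
    show "z t \<in> X.X" if "0 \<le> t" "t < \<delta>" for t using zx[of t] xX[of t] that \<delta> by simp
    show "\<exists>r>0. \<forall>t. 0 \<le> t \<and> t < r \<longrightarrow> X.dst (z t) x0 < \<epsilon>" if "0 < \<epsilon>" for \<epsilon>
    proof -
      from x_unif[OF that] obtain r where r: "r > 0"
        "\<And>s t. 0 \<le> s \<and> s \<le> t \<and> t \<le> c \<and> t - s < r \<Longrightarrow> X.dst (x t) (x s) < \<epsilon>" by blast
      show ?thesis
      proof (intro exI[of _ "min r c"] conjI allI impI)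
        fix t assume "0 \<le> t \<and> t < min r c"
        then show "X.dst (z t) x0 < \<epsilon>" using r(2)[of 0 t] zx[of t] x_0 by simp
      qed (use r c in simp)
    qed
    show "((\<lambda>t. z t i) has_vector_derivative F (z t) (u t) i) (at t within {0..<\<delta>})"
      if "0 \<le> t" "t < \<delta>" for t i
    proof -
      have "((\<lambda>t. z t i) has_vector_derivative F (x t) (u t) i) (at t within {0..<\<delta>})"
      proof (rule has_vector_derivative_transform)
        show "t \<in> {0..<\<delta>}" using that by simp
        then show "((\<lambda>t. x t i) has_vector_derivative F (x t) (u t) i) (at t within {0..<\<delta>})"
          using deriv[of t i] unfolding G_def by simp
        show "z s i = x s i" if "s \<in> {0..<\<delta>}" for s using zx[of s] that \<delta> by simp
      qed
      then show ?thesis using zx[of t] that \<delta> by simp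
    qed
    show "X.dst (z t) x0 \<le> C * t"
      if t: "0 \<le> t" "t < \<delta>" and C: "0 \<le> C" "\<forall>s\<in>{0<..t}. lsup_norm nx (F (z s) (u s)) \<le> C" for t C
    proof -
      have "X.dst (G \<tau>) (\<lambda>_. 0) \<le> C" if "0 < \<tau>" "\<tau> \<le> t" for \<tau>
        using bspec[OF C(2), of \<tau>] zx[of \<tau>] that t \<delta> GX[of \<tau>] by (simp add: X.dst_zero G_def)
      then have "nx i (x t i - x 0 i) \<le> C * t" for i
        using incr[of 0 t "\<lambda>_. 0" C i] t \<delta> C X.zero_mem by simp
      then show ?thesis using x_dst[of 0 t "C * t"] t \<delta> zx[of t] x_0 by simp
    qed
  qed
qed

end

section \<open>The weighted supremum of the component functions\<close>

lemma has_real_derivative_at_right: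
  assumes "(f has_real_derivative D) (at x)"
  shows "((\<lambda>h. (f (x + h) - f x) / h) \<longlongrightarrow> D) (at_right 0)"
  using assms unfolding DERIV_def by (rule tendsto_within_subset) simp

lemma upper_dini_leI:
  assumes "0 < r" and le: "\<And>t. 0 < t \<Longrightarrow> t < r \<Longrightarrow> V (flow n nx F t x u) - V x \<le> \<omega> t"
    and lim: "((\<lambda>t. \<omega> t / t) \<longlongrightarrow> l) (at_right 0)"
  shows "upper_dini n nx F V u x \<le> ereal l"
proof -
  have "\<forall>\<^sub>F t in at_right 0. 0 < t \<and> t < r"
    using assms(1) by (auto simp: eventually_at_right_field)
  then have "\<forall>\<^sub>F t in at_right 0. ereal ((V (flow n nx F t x u) - V x) / t) \<le> ereal (\<omega> t / t)"
    by eventually_elim (simp add: divide_right_mono le)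
  then have "upper_dini n nx F V u x \<le> Limsup (at_right 0) (\<lambda>t. ereal (\<omega> t / t))"
    unfolding upper_dini_def by (rule Limsup_mono)
  also have "\<dots> = ereal l"
    using lim by (intro lim_imp_Limsup) simp_all
  finally show ?thesis .
qed

text \<open>Bounds and regularity of the \<open>V\<^sub>i\<close>, uniform in \<open>i\<close>. They determine how the weighted
supremum depends on the state and how fast it can grow along trajectories, but not that it ever
decreases.\<close>

locale component_functions = infinite_system n m nx nu F
  for n m :: "nat \<Rightarrow> nat" and nx nu :: "nat \<Rightarrow> linf \<Rightarrow> real"
    and F :: "(nat \<Rightarrow> linf) \<Rightarrow> (nat \<Rightarrow> linf) \<Rightarrow> (nat \<Rightarrow> linf)" +
  fixes V :: "nat \<Rightarrow> linf \<Rightarrow> real" and s :: linf and \<psi>1 \<psi>2 :: "real \<Rightarrow> real"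
  assumes s_ge: "\<And>i. 1 \<le> s i"
    and \<psi>1: "class_K_inf \<psi>1" and \<psi>2: "class_K_inf \<psi>2"
    and V_bounds: "\<And>i v. v \<in> Rn (n i) \<Longrightarrow> \<psi>1 (nx i v) \<le> V i v \<and> V i v \<le> \<psi>2 (nx i v)"
    and V_diff: "\<And>i v. v \<in> Rn (n i) \<Longrightarrow> V i differentiable (at v within Rn (n i))"
    and V_lip: "\<And>R. 0 < R \<Longrightarrow> \<exists>L>0. \<forall>i. \<forall>v\<in>Rn (n i). \<forall>w\<in>Rn (n i).
          nx i v < R \<longrightarrow> nx i w < R \<longrightarrow> \<bar>V i v - V i w\<bar> \<le> L * nx i (v - w)"
    and V_lip_small: "\<And>\<epsilon>. 0 < \<epsilon> \<Longrightarrow> \<exists>R>0. \<forall>i. \<forall>v\<in>Rn (n i). \<forall>w\<in>Rn (n i).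
          nx i v < R \<longrightarrow> nx i w < R \<longrightarrow> \<bar>V i v - V i w\<bar> \<le> \<epsilon> * nx i (v - w)"
begin

abbreviation "W \<equiv> sup_lyapunov s V"

abbreviation "V_lipschitz R L \<equiv> \<forall>i. \<forall>v\<in>Rn (n i). \<forall>w\<in>Rn (n i).
  nx i v < R \<longrightarrow> nx i w < R \<longrightarrow> \<bar>V i v - V i w\<bar> \<le> L * nx i (v - w)"

abbreviation "F_bounded R C \<equiv> \<forall>y\<in>X.X. \<forall>v\<in>U.X.
  lsup_norm nx y \<le> R \<and> lsup_norm nu v \<le> R \<longrightarrow> lsup_norm nx (F y v) \<le> C"

lemma V_nonneg: "v \<in> Rn (n i) \<Longrightarrow> 0 \<le> V i v"
  using V_bounds[of v i] class_P_nonneg[OF class_K_inf_D(2)[OF \<psi>1]] is_norm_on_nonneg[OF X.N]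
      order_trans
  by blast

lemma s_pos: "0 < s i" using s_ge[of i] by simp

lemma s_le: "s i \<le> norm s" using linf_le_norm[of s i] by simp

lemma norm_s: "1 \<le> norm s" using s_le[of 0] s_ge[of 0] by simp

lemma norm_s_pos: "0 < norm s" using norm_s by linarith

lemma V_le: "x \<in> X.X \<Longrightarrow> V i (x i) \<le> \<psi>2 (lsup_norm nx x)"
  using V_bounds[OF X.mem_Rn, of x i] class_K_mono[OF class_K_inf_D(1)[OF \<psi>2] _ X.N_le_norm]
    is_norm_on_nonneg[OF X.N X.mem_Rn] order_trans by blast

lemma div_s_le: "0 \<le> c \<Longrightarrow> c / s i \<le> c"
  using s_ge[of i] by (simp add: divide_le_eq mult_le_cancel_left1)

lemma W_upper: "x \<in> X.X \<Longrightarrow> V i (x i) / s i \<le> W x"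
proof -
  assume x: "x \<in> X.X"
  have "1 / s i * V i (x i) \<le> \<psi>2 (lsup_norm nx x)" for i
    using div_s_le[OF V_nonneg[OF X.mem_Rn[OF x]], of i i] V_le[OF x, of i] by simp
  then have "bdd_above (range (\<lambda>i. 1 / s i * V i (x i)))" by (rule bdd_aboveI2)
  from cSUP_upper[OF UNIV_I this, of i] show ?thesis unfolding sup_lyapunov_def by simp
qed

lemma W_least: "(\<And>i. V i (x i) / s i \<le> c) \<Longrightarrow> W x \<le> c"
  unfolding sup_lyapunov_def by (rule cSUP_least) auto

lemma W_nonneg: "x \<in> X.X \<Longrightarrow> 0 \<le> W x"
  using W_upper[of x 0] V_nonneg[OF X.mem_Rn, of x 0] s_pos[of 0]
  by (meson divide_nonneg_pos order_trans)

lemma W_le: "x \<in> X.X \<Longrightarrow> W x \<le> \<psi>2 (lsup_norm nx x)"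
  using div_s_le[OF V_nonneg[OF X.mem_Rn]] V_le order_trans by (intro W_least) blast

text \<open>Since the supremum norm need not be attained, \<open>\<psi>1\<close> is evaluated at components whose norm
is close to it.\<close>

lemma W_ge:
  assumes x: "x \<in> X.X"
  shows "\<psi>1 (lsup_norm nx x) \<le> norm s * W x"
proof (rule ccontr)
  assume neg: "\<not> \<psi>1 (lsup_norm nx x) \<le> norm s * W x"
  define \<epsilon> where "\<epsilon> = \<psi>1 (lsup_norm nx x) - norm s * W x"
  have "0 < \<epsilon>" using neg unfolding \<epsilon>_def by simp
  then obtain d where d: "0 < d"
    "\<And>r. r \<in> {0..} \<Longrightarrow> dist r (lsup_norm nx x) < d \<Longrightarrow> dist (\<psi>1 r) (\<psi>1 (lsup_norm nx x)) < \<epsilon>"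
    using class_K_inf_D(3)[OF \<psi>1, unfolded continuous_on_iff, rule_format, of "lsup_norm nx x" \<epsilon>]
      X.norm_nonneg[OF x] by auto
  have "\<exists>i. lsup_norm nx x - d < nx i (x i)"
  proof (rule ccontr)
    assume "\<not> ?thesis"
    then have "lsup_norm nx x \<le> lsup_norm nx x - d" by (intro X.norm_least) (simp add: not_less)
    then show False using d(1) by simp
  qed
  then obtain i where i: "lsup_norm nx x - d < nx i (x i)" by blast
  have nn: "0 \<le> nx i (x i)" by (rule is_norm_on_nonneg[OF X.N X.mem_Rn[OF x]])
  have "dist (nx i (x i)) (lsup_norm nx x) < d"
    using X.N_le_norm[OF x, of i] i d(1) by (simp add: dist_real_def)
  then have "norm s * W x < \<psi>1 (nx i (x i))"
    using d(2)[of "nx i (x i)"] nn unfolding \<epsilon>_def dist_real_def by auto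
  also have "\<dots> \<le> V i (x i)" using V_bounds[OF X.mem_Rn[OF x]] by blast
  also have "\<dots> \<le> s i * W x" using W_upper[OF x, of i] s_pos[of i]
    by (simp add: divide_le_eq mult.commute)
  also have "\<dots> \<le> norm s * W x" by (rule mult_right_mono[OF s_le W_nonneg[OF x]])
  finally show False by simp
qed

lemma component_diff:
  assumes lip: "V_lipschitz R L"
    and L: "0 \<le> L"
    and xy: "x \<in> X.X" "y \<in> X.X" "lsup_norm nx x < R" "lsup_norm nx y < R"
  shows "V i (x i) / s i \<le> V i (y i) / s i + L * X.dst x y"
proof -
  have "V i (x i) \<le> V i (y i) + L * nx i (x i - y i)"
    using lip[rule_format, OF X.mem_Rn[OF xy(1)] X.mem_Rn[OF xy(2)], of i]
      X.N_le_norm[OF xy(1), of i] X.N_le_norm[OF xy(2), of i] xy(3,4) by simp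
  also have "L * nx i (x i - y i) \<le> L * X.dst x y"
    by (rule mult_left_mono[OF X.N_le_dst[OF xy(1,2)] L])
  also have "L * X.dst x y \<le> s i * (L * X.dst x y)"
    using mult_right_mono[OF s_ge[of i], of "L * X.dst x y"] L by simp
  finally show ?thesis using s_pos[of i] by (simp add: field_simps)
qed

lemma W_diff:
  assumes lip: "V_lipschitz R L"
    and L: "0 \<le> L"
    and xy: "x \<in> X.X" "y \<in> X.X" "lsup_norm nx x < R" "lsup_norm nx y < R"
  shows "W x \<le> W y + L * X.dst x y"
  using component_diff[OF lip L xy] W_upper[OF xy(2)]
  by (intro W_least) (meson add_right_mono order_trans)

lemma W_continuous: "continuous_map (lsup_topology n nx) euclideanreal W"
proof (rule X.continuous_map_from_lsup)
  fix x and \<epsilon> :: real assume x: "x \<in> X.X" and e: "0 < \<epsilon>"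
  define R where "R = lsup_norm nx x + 1"
  have "0 < R" using X.norm_nonneg[OF x] unfolding R_def by simp
  from V_lip[OF this] obtain L where L: "L > 0" and lip: "V_lipschitz R L" by blast
  show "\<exists>\<delta>>0. \<forall>y\<in>X.X. X.dst x y < \<delta> \<longrightarrow> \<bar>W y - W x\<bar> < \<epsilon>"
  proof (intro exI[of _ "min 1 (\<epsilon> / L)"] conjI ballI impI)
    show "0 < min 1 (\<epsilon> / L)" using e L by simp
    fix y assume y: "y \<in> X.X" "X.dst x y < min 1 (\<epsilon> / L)"
    have "lsup_norm nx y < R" "lsup_norm nx x < R"
      using X.norm_le_dst[OF y(1) x] X.M.commute[of x y] y(2) unfolding R_def by auto
    then have "\<bar>W y - W x\<bar> \<le> L * X.dst x y"
      using W_diff[OF lip less_imp_le[OF L] x y(1)] W_diff[OF lip less_imp_le[OF L] y(1) x]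
        X.M.commute[of x y] by simp
    also have "\<dots> < \<epsilon>" using y(2) L by (simp add: pos_less_divide_eq mult.commute)
    finally show "\<bar>W y - W x\<bar> < \<epsilon>" .
  qed
qed

lemma candidate_compose:
  assumes \<xi>: "class_K_inf \<xi>"
  shows "lyapunov_candidate n nx (\<xi> \<circ> W)"
  unfolding lyapunov_candidate_def
proof (intro conjI)
  show "\<forall>x\<in>X.X. 0 \<le> (\<xi> \<circ> W) x"
    using class_P_nonneg[OF class_K_inf_D(2)[OF \<xi>]] W_nonneg by simp
  have top: "topspace (lsup_topology n nx) = X.X" unfolding lsup_topology_def by simp
  have "continuous_map (lsup_topology n nx) (top_of_set {0..}) W"
    using W_continuous W_nonneg unfolding continuous_map_in_subtopology by (auto simp: top)
  moreover have "continuous_map (top_of_set {0..}) euclideanreal \<xi>"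
    using class_K_inf_D(3)[OF \<xi>] by simp
  ultimately show "continuous_map (lsup_topology n nx) euclideanreal (\<xi> \<circ> W)"
    by (rule continuous_map_compose)
  have "class_K_inf (\<lambda>r. (1 / norm s) * \<psi>1 r)"
    using norm_s by (intro class_K_inf_scale \<psi>1) auto
  then have "class_K_inf (\<xi> \<circ> (\<lambda>r. (1 / norm s) * \<psi>1 r))" "class_K_inf (\<xi> \<circ> \<psi>2)"
    by (intro class_K_inf_compose \<xi> \<psi>2; assumption)+
  moreover have "\<xi> ((1 / norm s) * \<psi>1 (lsup_norm nx x)) \<le> \<xi> (W x) \<and> \<xi> (W x) \<le> \<xi> (\<psi>2 (lsup_norm nx x))"
    if x: "x \<in> X.X" for x
    using W_ge[OF x] W_le[OF x] W_nonneg[OF x] norm_s class_P_nonneg[OF class_K_inf_D(2)[OF \<psi>1]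
        X.norm_nonneg[OF x]]
    by (auto intro!: class_K_mono[OF class_K_inf_D(1)[OF \<xi>]]
        simp: pos_divide_le_eq[OF norm_s_pos] mult.commute)
  ultimately show "\<exists>\<psi>1 \<psi>2. class_K_inf \<psi>1 \<and> class_K_inf \<psi>2 \<and>
      (\<forall>x\<in>X.X. \<psi>1 (lsup_norm nx x) \<le> (\<xi> \<circ> W) x \<and> (\<xi> \<circ> W) x \<le> \<psi>2 (lsup_norm nx x))"
    unfolding comp_def by blast
qed

lemma input_norm_nonneg: "u \<in> inputs m nu \<Longrightarrow> 0 \<le> input_norm nu u"
  using U.input_le_norm[of u 0] U.norm_nonneg[of "u 0"] by (auto simp: inputs_def)

lemma W_lyapunov_candidate: "lyapunov_candidate n nx W"
  using candidate_compose[OF class_K_inf_id] by (simp add: o_def)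

lemma state_norm_less:
  assumes x: "x \<in> X.X" and p: "0 \<le> p" "norm s * W x < \<psi>1 p"
  shows "lsup_norm nx x < p"
  using W_ge[OF x] p class_K_less_iff[OF class_K_inf_D(1)[OF \<psi>1] X.norm_nonneg[OF x] p(1)] by simp

text \<open>An upper bound that is also available where nothing dissipates: Lipschitz constant times
the speed of the trajectory.\<close>

lemma flow_growth:
  assumes x: "x \<in> X.X" and u: "u \<in> inputs m nu" and R: "lsup_norm nx x < R" "R \<le> R'"
      "input_norm nu u \<le> R'"
    and lip: "V_lipschitz R L"
    and L: "0 \<le> L"
    and C: "F_bounded R' C"
      "0 \<le> C"
  shows "\<exists>r>0. \<forall>t. 0 < t \<and> t < r \<longrightarrow>
    flow n nx F t x u \<in> X.X \<and> W (flow n nx F t x u) \<le> W x + L * C * t"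
proof -
  define z where "z t = flow n nx F t x u" for t
  obtain \<delta> where \<delta>: "0 < \<delta>" "z 0 = x" "\<And>t. 0 \<le> t \<Longrightarrow> t < \<delta> \<Longrightarrow> z t \<in> X.X"
    and z_cont: "\<And>\<epsilon>. 0 < \<epsilon> \<Longrightarrow> \<exists>r>0. \<forall>t. 0 \<le> t \<and> t < r \<longrightarrow> X.dst (z t) x < \<epsilon>"
    and z_deriv: "\<And>t i. 0 \<le> t \<Longrightarrow> t < \<delta> \<Longrightarrow>
      ((\<lambda>t. z t i) has_vector_derivative F (z t) (u t) i) (at t within {0..<\<delta>})"
    and z_incr: "\<And>t C. 0 \<le> t \<Longrightarrow> t < \<delta> \<Longrightarrow> 0 \<le> C \<Longrightarrow>
      \<forall>s\<in>{0<..t}. lsup_norm nx (F (z s) (u s)) \<le> C \<Longrightarrow> X.dst (z t) x \<le> C * t"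
    by (rule local_flow[OF x u, folded z_def]) (rule that)
  obtain r where r: "r > 0" "\<And>t. 0 \<le> t \<Longrightarrow> t < r \<Longrightarrow> X.dst (z t) x < R - lsup_norm nx x"
    using z_cont[of "R - lsup_norm nx x"] R(1) by auto
  show ?thesis
  proof (intro exI[of _ "min r \<delta>"] conjI[of "0 < min r \<delta>"] allI impI)
    show "0 < min r \<delta>" using r \<delta> by simp
    fix t assume "0 < t \<and> t < min r \<delta>"
    then have t: "0 < t" "t < min r \<delta>" by simp_all
    have zX: "z \<tau> \<in> X.X" and z_small: "lsup_norm nx (z \<tau>) < R" if "0 \<le> \<tau>" "\<tau> \<le> t" for \<tau>
    proof -
      show "z \<tau> \<in> X.X" using that t \<delta>(3) by simp
      from X.norm_le_dst[OF this x] show "lsup_norm nx (z \<tau>) < R" using r(2)[of \<tau>] that t by simp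
    qed
    have "lsup_norm nx (F (z \<tau>) (u \<tau>)) \<le> C" if "0 < \<tau>" "\<tau> \<le> t" for \<tau>
    proof (rule C(1)[rule_format])
      show "u \<tau> \<in> U.X" using u that unfolding inputs_def by simp
      show "lsup_norm nx (z \<tau>) \<le> R' \<and> lsup_norm nu (u \<tau>) \<le> R'"
        using U.input_le_norm[OF u, of \<tau>] z_small[of \<tau>] that R(2,3) by simp
    qed (use zX[of \<tau>] that in auto)
    then have "X.dst (z t) x \<le> C * t" using t C(2) by (intro z_incr) auto
    then have "L * X.dst (z t) x \<le> L * (C * t)" by (rule mult_left_mono[OF _ L])
    then show "flow n nx F t x u \<in> X.X \<and> W (flow n nx F t x u) \<le> W x + L * C * t"
      using W_diff[OF lip L zX[of t] x z_small[of t] R(1)] zX[of t] t unfolding z_def by simp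
  qed
qed

text \<open>Monotonicity of \<open>\<xi>'\<close> gives \<open>\<xi>(v + h) \<le> \<xi>(v) + h \<xi>'(v + 1)\<close> for \<open>h \<le> 1\<close>, which also covers
\<open>v = 0\<close>, where \<open>\<xi>\<close> is only known to be continuous.\<close>

lemma dini_growth:
  assumes x: "x \<in> X.X" and u: "u \<in> inputs m nu" and R: "lsup_norm nx x < R" "R \<le> R'"
      "input_norm nu u \<le> R'"
    and lip: "V_lipschitz R L"
    and L: "0 \<le> L"
    and C: "F_bounded R' C"
      "0 \<le> C"
    and \<xi>: "class_K_inf \<xi>" "\<And>s. 0 < s \<Longrightarrow> (\<xi> has_real_derivative \<xi>' s) (at s)" "mono_on {0<..} \<xi>'"
  shows "upper_dini n nx F (\<xi> \<circ> W) u x \<le> ereal (L * C * \<xi>' (W x + 1))"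
proof -
  obtain r where r: "0 < r" "\<And>t. 0 < t \<Longrightarrow> t < r \<Longrightarrow>
      flow n nx F t x u \<in> X.X \<and> W (flow n nx F t x u) \<le> W x + L * C * t"
    using flow_growth[OF x u R lip L C] by blast
  have LC: "0 \<le> L * C" using L C(2) by simp
  have step: "\<xi> (v + h) \<le> \<xi> v + h * \<xi>' (v + 1)" if v: "0 \<le> v" and h: "0 \<le> h" "h \<le> 1" for v h
  proof (cases "h = 0")
    case False
    have "\<exists>l z. v < z \<and> z < v + h \<and> DERIV \<xi> z :> l \<and> \<xi> (v + h) - \<xi> v = (v + h - v) * l"
    proof (rule MVT)
      show "continuous_on {v..v + h} \<xi>"
        using class_K_inf_D(3)[OF \<xi>(1)] by (rule continuous_on_subset) (use v in auto)
      show "\<xi> differentiable (at z)" if "v < z" for z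
        using \<xi>(2)[of z] that v by (auto simp: real_differentiable_def)
    qed (use h False in simp)
    then obtain l z where z: "v < z" "z < v + h" "DERIV \<xi> z :> l" "\<xi> (v + h) - \<xi> v = h * l" by auto
    have "l = \<xi>' z" using DERIV_unique[OF z(3) \<xi>(2)] z v by simp
    also have "\<dots> \<le> \<xi>' (v + 1)" using z h v by (intro mono_onD[OF \<xi>(3)]) auto
    finally have "h * l \<le> h * \<xi>' (v + 1)" using h by (intro mult_left_mono) auto
    then show ?thesis using z(4) by simp
  qed simp
  show ?thesis
  proof (rule upper_dini_leI)
    show "0 < min r (1 / (L * C + 1))" using r LC by simp
    fix t assume t: "0 < t" "t < min r (1 / (L * C + 1))"
    have "t * (L * C + 1) < 1" using t LC by (simp add: pos_less_divide_eq)
    then have h: "L * C * t \<le> 1" using t by (simp add: algebra_simps)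
    have "\<xi> (W (flow n nx F t x u)) \<le> \<xi> (W x + L * C * t)"
      using r(2)[of t] t
      by (intro class_K_mono[OF class_K_inf_D(1)[OF \<xi>(1)]]) (auto intro: W_nonneg)
    also have "\<dots> \<le> \<xi> (W x) + L * C * t * \<xi>' (W x + 1)"
      using t LC by (intro step W_nonneg x h) simp
    finally show "(\<xi> \<circ> W) (flow n nx F t x u) - (\<xi> \<circ> W) x \<le> t * (L * C * \<xi>' (W x + 1))"
      by (simp add: algebra_simps)
  next
    show "((\<lambda>t. t * (L * C * \<xi>' (W x + 1)) / t) \<longlongrightarrow> L * C * \<xi>' (W x + 1)) (at_right 0)"
      by (rule tendsto_eventually) (simp add: eventually_at_filter)
  qed
qed

end

text \<open>The small-gain condition in the form in which it is used: a component dissipates as soon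
as its weighted value is large in comparison with the weighted supremum and with the input.\<close>

locale dissipating_components = component_functions +
  fixes \<kappa> :: real and g \<alpha> :: "real \<Rightarrow> real"
  assumes \<kappa>: "0 < \<kappa>" "\<kappa> < 1"
    and g: "class_K g" and \<alpha>: "class_P \<alpha>"
    and dissipation: "\<And>i x v. x \<in> lsup_space n nx \<Longrightarrow> v \<in> lsup_space m nu \<Longrightarrow>
          \<kappa> * sup_lyapunov s V x < V i (x i) / s i \<Longrightarrow> g (lsup_norm nu v) < V i (x i) / s i \<Longrightarrow>
          grad_app (n i) (V i) (x i) (F x v i) \<le> - \<alpha> (V i (x i))"
begin

text \<open>Components with \<open>V\<^sub>i(x\<^sub>i) / s\<^sub>i < W x - 2 \<eta>\<close> cannot climb above \<open>W x - \<eta>\<close> within a short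
time that does not depend on \<open>i\<close>. The others remain above \<open>W x - 3 \<eta>\<close>, which by the choice of
\<open>\<eta>\<close> exceeds both \<open>\<kappa> (W x + \<eta>)\<close> and the input gain. Therefore they dissipate during the whole
interval, at the rate \<open>s\<^sub>i \<beta>\<close> at least.\<close>

lemma flow_decay:
  assumes x: "x \<in> X.X" and u: "u \<in> inputs m nu" and large: "g (input_norm nu u) < W x"
    and b: "0 \<le> \<beta>" "\<And>\<theta>. \<theta> \<in> {1/2..2 * norm s} \<Longrightarrow> \<beta> \<le> \<alpha> (\<theta> * W x) / norm s"
  shows "\<exists>r>0. \<forall>t. 0 < t \<and> t < r \<longrightarrow>
    flow n nx F t x u \<in> X.X \<and> W (flow n nx F t x u) \<le> W x - t * \<beta>"
proof -
  define z where "z t = flow n nx F t x u" for t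
  obtain \<delta> where \<delta>: "0 < \<delta>" "z 0 = x" "\<And>t. 0 \<le> t \<Longrightarrow> t < \<delta> \<Longrightarrow> z t \<in> X.X"
    and z_cont: "\<And>\<epsilon>. 0 < \<epsilon> \<Longrightarrow> \<exists>r>0. \<forall>t. 0 \<le> t \<and> t < r \<longrightarrow> X.dst (z t) x < \<epsilon>"
    and z_deriv: "\<And>t i. 0 \<le> t \<Longrightarrow> t < \<delta> \<Longrightarrow>
      ((\<lambda>t. z t i) has_vector_derivative F (z t) (u t) i) (at t within {0..<\<delta>})"
    by (rule local_flow[OF x u, folded z_def]) (rule that)
  have g0: "0 \<le> g (input_norm nu u)"
    by (rule class_P_nonneg[OF class_K_D(1)[OF g] input_norm_nonneg[OF u]])
  then have c: "0 < W x" using large by simp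
  define \<eta> where "\<eta> = min ((1 - \<kappa>) * W x / 8) (min ((W x - g (input_norm nu u)) / 4) (W x / 6))"
  have \<eta>: "0 < \<eta>" "\<eta> \<le> (1 - \<kappa>) * W x / 8" "\<eta> \<le> (W x - g (input_norm nu u)) / 4" "\<eta> \<le> W x / 6"
  proof -
    show "0 < \<eta>" using c large \<kappa> unfolding \<eta>_def by auto
    show "\<eta> \<le> (1 - \<kappa>) * W x / 8" unfolding \<eta>_def by (rule min.cobounded1)
    show "\<eta> \<le> (W x - g (input_norm nu u)) / 4" unfolding \<eta>_def
      by (rule min.coboundedI2[OF min.cobounded1])
    show "\<eta> \<le> W x / 6" unfolding \<eta>_def by (rule min.coboundedI2[OF min.cobounded2])
  qed
  have "\<kappa> * \<eta> \<le> \<eta>" using \<kappa> \<eta>(1) by simp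
  then have "\<kappa> * (W x + \<eta>) \<le> \<kappa> * W x + \<eta>" by (simp add: distrib_left)
  moreover have "8 * \<eta> \<le> W x - \<kappa> * W x" using \<eta>(2) by (simp add: left_diff_distrib)
  ultimately have \<kappa>\<eta>: "\<kappa> * (W x + \<eta>) < W x - 3 * \<eta>" using \<eta>(1) by linarith
  define R where "R = lsup_norm nx x + 1"
  have R: "0 < R" "lsup_norm nx x < R" using X.norm_nonneg[OF x] unfolding R_def by simp_all
  from V_lip[OF R(1)] obtain L where L: "L > 0" and lip: "V_lipschitz R L" by blast
  have "0 < min 1 (\<eta> / L)" using \<eta>(1) L by simp
  from z_cont[OF this] obtain r1 where r1: "r1 > 0"
    "\<And>t. 0 \<le> t \<Longrightarrow> t < r1 \<Longrightarrow> X.dst (z t) x < min 1 (\<eta> / L)" by blast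
  \<comment> \<open>The last bound ensures \<open>t \<beta> \<le> \<eta>\<close>, so that components starting below
    \<open>W x - 2 \<eta>\<close> respect the claimed bound.\<close>
  define r where "r = min (min r1 \<delta>) (\<eta> / (\<beta> + 1))"
  have r: "0 < r" "r \<le> r1" "r \<le> \<delta>" "r \<le> \<eta> / (\<beta> + 1)"
    using r1 \<delta> \<eta> b(1) unfolding r_def by (auto simp: min_le_iff_disj)
  have zX: "z t \<in> X.X" if "0 \<le> t" "t < r" for t using \<delta>(3) that r(3) by simp
  have near: "V i (z t i) / s i \<le> V i (x i) / s i + \<eta>" "V i (x i) / s i \<le> V i (z t i) / s i + \<eta>"
    if t: "0 \<le> t" "t < r" for t i
  proof -
    have d: "X.dst (z t) x < min 1 (\<eta> / L)" using r1(2)[of t] t r(2) by simp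
    then have "L * X.dst (z t) x \<le> \<eta>" using L by (simp add: field_simps)
    moreover have "lsup_norm nx (z t) < R" using X.norm_le_dst[OF zX[OF t] x] d unfolding R_def
      by simp
    ultimately show "V i (z t i) / s i \<le> V i (x i) / s i + \<eta>" "V i (x i) / s i \<le> V i (z t i) / s i + \<eta>"
      using component_diff[OF lip less_imp_le[OF L] zX[OF t] x, of i] R(2)
        component_diff[OF lip less_imp_le[OF L] x zX[OF t], of i] X.M.commute[of x "z t"] by auto
  qed
  have component: "V i (z t i) / s i \<le> W x - t * \<beta>" if t: "0 < t" "t < r" for t i
  proof (cases "V i (x i) / s i < W x - 2 * \<eta>")
    case True
    have "t \<le> \<eta> / (\<beta> + 1)" using t r(4) by linarith
    then have "t * (\<beta> + 1) \<le> \<eta>" using b(1) by (simp add: pos_le_divide_eq)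
    then have "t * \<beta> \<le> \<eta>" using t by (simp add: algebra_simps)
    then show ?thesis using near(1)[of t i] True t by simp
  next
    case False
    define D where "D \<tau> = grad_app (n i) (V i) (z \<tau> i) (F (z \<tau>) (u \<tau>) i)" for \<tau>
    have D_le: "D \<tau> \<le> - (s i * \<beta>)" if \<tau>: "0 \<le> \<tau>" "\<tau> < r" for \<tau>
    proof -
      have w: "W x - 3 * \<eta> \<le> V i (z \<tau> i) / s i" "V i (z \<tau> i) / s i \<le> W x + \<eta>"
        using near[OF \<tau>, of i] False W_upper[OF x, of i] by simp_all
      have uU: "u \<tau> \<in> U.X" using u \<tau>(1) unfolding inputs_def by simp
      have "W (z \<tau>) \<le> W x + \<eta>"
        using near(1)[OF \<tau>] W_upper[OF x] by (intro W_least) (meson add_right_mono order_trans)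
      then have "\<kappa> * W (z \<tau>) \<le> \<kappa> * (W x + \<eta>)" using \<kappa> by simp
      then have *: "\<kappa> * W (z \<tau>) < V i (z \<tau> i) / s i" using \<kappa>\<eta> w(1) by linarith
      have "g (lsup_norm nu (u \<tau>)) \<le> g (input_norm nu u)"
        by (rule class_K_mono[OF g U.norm_nonneg[OF uU] U.input_le_norm[OF u \<tau>(1)]])
      also have "\<dots> < W x - 3 * \<eta>" using \<eta>(1,3) by simp
      finally have **: "g (lsup_norm nu (u \<tau>)) < V i (z \<tau> i) / s i" using w(1) by linarith
      have "D \<tau> \<le> - \<alpha> (V i (z \<tau> i))"
        unfolding D_def by (rule dissipation[OF zX[OF \<tau>] uU * **])
      moreover have "norm s * \<beta> \<le> \<alpha> (V i (z \<tau> i))"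
      proof -
        define \<theta> where "\<theta> = V i (z \<tau> i) / W x"
        have v1: "W x / 2 \<le> V i (z \<tau> i) / s i" "V i (z \<tau> i) / s i \<le> 2 * W x" using w \<eta>(4) c
          by linarith+
        have "W x / 2 \<le> V i (z \<tau> i)"
          using order_trans[OF v1(1) div_s_le[OF V_nonneg[OF X.mem_Rn[OF zX[OF \<tau>]]]]] .
        moreover have "V i (z \<tau> i) \<le> 2 * norm s * W x"
        proof -
          have "V i (z \<tau> i) \<le> s i * (2 * W x)" using v1(2) s_pos[of i]
            by (simp add: divide_le_eq mult.commute)
          also have "\<dots> \<le> norm s * (2 * W x)" using c by (intro mult_right_mono s_le) simp
          finally show ?thesis by simp
        qed
        ultimately have "\<theta> \<in> {1/2..2 * norm s}" using c unfolding \<theta>_def by (simp add: field_simps)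
        from b(2)[OF this] show ?thesis
          using c unfolding \<theta>_def by (simp add: pos_le_divide_eq[OF norm_s_pos] mult.commute)
      qed
      moreover have "s i * \<beta> \<le> norm s * \<beta>" by (rule mult_right_mono[OF s_le b(1)])
      ultimately show ?thesis by linarith
    qed
    have deriv: "((\<lambda>\<tau>. V i (z \<tau> i)) has_derivative (\<lambda>h. h * D \<tau>)) (at \<tau> within {0..t})"
        if \<tau>: "0 \<le> \<tau>" "\<tau> \<le> t" for \<tau>
    proof -
      let ?fd = "frechet_derivative (V i) (at (z \<tau> i) within Rn (n i))"
      have sub: "{0..t} \<subseteq> {0..<\<delta>}" using t r(3) by auto
      have z': "((\<lambda>\<tau>. z \<tau> i) has_derivative (\<lambda>h. h *\<^sub>R F (z \<tau>) (u \<tau>) i)) (at \<tau> within {0..t})"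
        using has_vector_derivative_within_subset[OF z_deriv sub] \<tau> t r(3)
        unfolding has_vector_derivative_def by simp
      have "(V i has_derivative ?fd) (at (z \<tau> i) within Rn (n i))"
        using V_diff[OF X.mem_Rn[OF zX]] \<tau> t unfolding frechet_derivative_works by simp
      moreover have "(\<lambda>\<tau>. z \<tau> i) ` {0..t} \<subseteq> Rn (n i)" using zX t by (auto intro: X.mem_Rn)
      ultimately have V': "(V i has_derivative ?fd) (at (z \<tau> i) within (\<lambda>\<tau>. z \<tau> i) ` {0..t})"
        by (rule has_derivative_subset)
      have "?fd (h *\<^sub>R F (z \<tau>) (u \<tau>) i) = h * D \<tau>" for h
        using linear_scale[OF has_derivative_linear[OF V']] unfolding D_def grad_app_def by simp
      then show ?thesis using diff_chain_within[OF z' V'] by (simp add: o_def)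
    qed
    obtain \<tau> where \<tau>: "\<tau> \<in> {0<..<t}" "V i (z t i) - V i (z 0 i) = (t - 0) * D \<tau>"
      using mvt_simple[OF t(1), of "\<lambda>\<tau>. V i (z \<tau> i)" "\<lambda>\<tau> h. h * D \<tau>"] deriv by auto
    have "t * D \<tau> \<le> t * - (s i * \<beta>)" using \<tau>(1) t by (intro mult_left_mono D_le) auto
    then have "V i (z t i) \<le> V i (x i) - s i * (t * \<beta>)" using \<tau>(2) \<delta>(2) by (simp add: mult_ac)
    then have "V i (z t i) / s i \<le> (V i (x i) - s i * (t * \<beta>)) / s i"
      using s_pos[of i] by (intro divide_right_mono) auto
    also have "\<dots> = V i (x i) / s i - t * \<beta>"
      using s_pos[of i] by (simp add: diff_divide_distrib)
    finally have "V i (z t i) / s i \<le> V i (x i) / s i - t * \<beta>" .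
    then show ?thesis using W_upper[OF x, of i] by simp
  qed
  show ?thesis
    using r(1) component zX unfolding z_def by (intro exI[of _ r]) (auto intro: W_least)
qed

end

section \<open>From decay to the dissipative form\<close>

context dissipating_components
begin

text \<open>The decay rate may depend on \<open>W x\<close> only. It has to bound \<open>\<alpha>\<close> from below at all values
that a component close to the supremum can have; these are \<open>\<theta> W x\<close> with \<open>\<theta>\<close> between \<open>1/2\<close> and
twice the supremum of the weights.\<close>

lemma decay_rate:
  obtains b where "class_P b" "\<And>r s. \<bar>b r - b s\<bar> \<le> \<bar>r - s\<bar>"
    "\<And>x u. x \<in> X.X \<Longrightarrow> u \<in> inputs m nu \<Longrightarrow> g (input_norm nu u) < W x \<Longrightarrow>
      \<exists>r>0. \<forall>t. 0 < t \<and> t < r \<longrightarrow>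
        flow n nx F t x u \<in> X.X \<and> W (flow n nx F t x u) \<le> W x - t * b (W x)"
proof -
  have "class_P (\<lambda>r. \<alpha> r / norm s)"
    using \<alpha> norm_s_pos unfolding class_P_def by (auto intro!: continuous_intros)
  moreover have "1/2 \<le> 2 * norm s" using norm_s by simp
  ultimately obtain b where b: "class_P b" "\<And>r s. \<bar>b r - b s\<bar> \<le> \<bar>r - s\<bar>"
    "\<And>r \<theta>. 0 \<le> r \<Longrightarrow> \<theta> \<in> {1/2..2 * norm s} \<Longrightarrow> b r \<le> \<alpha> (\<theta> * r) / norm s"
    using class_P_lipschitz_minorant[of "\<lambda>r. \<alpha> r / norm s" "1/2" "2 * norm s"] by auto
  show ?thesis
  proof (rule that[OF b(1,2)])
    fix x u assume x: "x \<in> X.X" and u: "u \<in> inputs m nu" and large: "g (input_norm nu u) < W x"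
    show "\<exists>r>0. \<forall>t. 0 < t \<and> t < r \<longrightarrow>
        flow n nx F t x u \<in> X.X \<and> W (flow n nx F t x u) \<le> W x - t * b (W x)"
      by (rule flow_decay[OF x u large class_P_nonneg[OF b(1) W_nonneg[OF x]] b(3)[OF W_nonneg[OF x]]])
  qed
qed

text \<open>Where \<open>W x\<close> exceeds the input gain, the chain rule and \<open>\<xi>' b = \<xi>\<close> turn the decay of \<open>W\<close>
into \<open>D\<^sup>+ \<le> - \<xi> (W x)\<close>. Elsewhere \<open>D\<^sup>+ + \<xi> (W x)\<close> is bounded in terms of the input norm and
tends to \<open>0\<close> with it, and a majorant of class \<open>K\<close> serves as \<open>\<rho>\<close>.\<close>

lemma scaled_dissipative:
  assumes b: "\<And>x u. x \<in> X.X \<Longrightarrow> u \<in> inputs m nu \<Longrightarrow> g (input_norm nu u) < W x \<Longrightarrow>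
      \<exists>r>0. \<forall>t. 0 < t \<and> t < r \<longrightarrow>
        flow n nx F t x u \<in> X.X \<and> W (flow n nx F t x u) \<le> W x - t * b (W x)"
    and \<xi>: "class_K_inf \<xi>" "\<And>s. 0 < s \<Longrightarrow> (\<xi> has_real_derivative \<xi>' s) (at s)"
      "\<And>s. 0 < s \<Longrightarrow> 0 < \<xi>' s" "mono_on {0<..} \<xi>'" "\<And>s. 0 < s \<Longrightarrow> \<xi>' s * b s = \<xi> s"
  shows "ISS_Lyapunov_dissipative n nx m nu F (\<xi> \<circ> W)"
proof -
  note K\<xi> = class_K_inf_D(1)[OF \<xi>(1)] and K\<psi> = class_K_inf_D(1)[OF \<psi>1]
  have dini_large: "upper_dini n nx F (\<xi> \<circ> W) u x \<le> ereal (- \<xi> (W x))"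
    if x: "x \<in> X.X" and u: "u \<in> inputs m nu" and large: "g (input_norm nu u) < W x" for x u
  proof -
    have pos: "0 < W x"
      using large class_P_nonneg[OF class_K_D(1)[OF g] input_norm_nonneg[OF u]] by simp
    obtain r where r: "0 < r" "\<And>t. 0 < t \<Longrightarrow> t < r \<Longrightarrow>
        flow n nx F t x u \<in> X.X \<and> W (flow n nx F t x u) \<le> W x - t * b (W x)"
      using b[OF x u large] by blast
    have "((\<lambda>t. \<xi> (W x - t * b (W x))) has_real_derivative \<xi>' (W x) * - b (W x)) (at 0)"
    proof (rule DERIV_chain2[where f = \<xi>])
      show "(\<xi> has_real_derivative \<xi>' (W x)) (at (W x - 0 * b (W x)))" using \<xi>(2)[OF pos] by simp
    qed (auto intro!: derivative_eq_intros)
    from has_real_derivative_at_right[OF this] \<xi>(5)[OF pos]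
    have lim: "((\<lambda>t. (\<xi> (W x - t * b (W x)) - \<xi> (W x)) / t) \<longlongrightarrow> - \<xi> (W x)) (at_right 0)" by simp
    show ?thesis
    proof (rule upper_dini_leI[OF r(1) _ lim])
      fix t assume t: "0 < t" "t < r"
      from r(2)[OF this] have "0 \<le> W (flow n nx F t x u)" "W (flow n nx F t x u) \<le> W x - t * b (W x)"
        using W_nonneg by auto
      then have "\<xi> (W (flow n nx F t x u)) \<le> \<xi> (W x - t * b (W x))" by (rule class_K_mono[OF K\<xi>])
      then show "(\<xi> \<circ> W) (flow n nx F t x u) - (\<xi> \<circ> W) x \<le> \<xi> (W x - t * b (W x)) - \<xi> (W x)" by simp
    qed
  qed
  have \<xi>0: "0 \<le> \<xi> r" if "0 \<le> r" for r by (rule class_P_nonneg[OF class_K_inf_D(2)[OF \<xi>(1)] that])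
  define A where "A = {(x, u). x \<in> X.X \<and> u \<in> inputs m nu \<and> W x \<le> g (input_norm nu u)}"
  define size where "size = (\<lambda>(x::nat \<Rightarrow> linf, u). input_norm nu u)"
  define D where "D = (\<lambda>(x, u). upper_dini n nx F (\<xi> \<circ> W) u x + ereal (\<xi> (W x)))"
  have C_ex: "\<exists>C\<ge>0. F_bounded R C"
    if R: "0 < R" for R
  proof -
    obtain C where C: "F_bounded R C"
      using F_bound[OF R] by blast
    show ?thesis by (rule exI[of _ "max C 0"]) (use C in \<open>auto simp: le_max_iff_disj\<close>)
  qed
  have D_bound: "D a \<le> ereal (L * C * \<xi>' (g r + 1) + \<xi> (g r))"
    if a: "a \<in> A" "size a \<le> r" and p: "0 < p" "norm s * g r < \<psi>1 p" and R': "p \<le> R'" "r \<le> R'"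
      and L: "0 \<le> L" "V_lipschitz p L"
      and C: "0 \<le> C" "F_bounded R' C"
    for a r p R' L C
  proof -
    obtain x u where xu: "a = (x, u)" "x \<in> X.X" "u \<in> inputs m nu" "W x \<le> g (input_norm nu u)"
        "input_norm nu u \<le> r"
      using a unfolding A_def size_def by auto
    have "g (input_norm nu u) \<le> g r" by (rule class_K_mono[OF g input_norm_nonneg[OF xu(3)] xu(5)])
    then have W: "W x \<le> g r" using xu(4) by simp
    have "norm s * W x \<le> norm s * g r" using W by (intro mult_left_mono) auto
    then have small: "lsup_norm nx x < p" using p by (intro state_norm_less xu(2)) auto
    have "upper_dini n nx F (\<xi> \<circ> W) u x \<le> ereal (L * C * \<xi>' (W x + 1))"
      using xu(5) R'(2)
      by (intro dini_growth[OF xu(2,3) small R'(1) _ L(2,1) C(2,1) \<xi>(1,2,4)]) simp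
    then have "D a \<le> ereal (L * C * \<xi>' (W x + 1)) + ereal (\<xi> (W x))"
      unfolding D_def xu(1) prod.case by (rule add_right_mono)
    also have "\<dots> \<le> ereal (L * C * \<xi>' (g r + 1) + \<xi> (g r))"
    proof -
      have "\<xi>' (W x + 1) \<le> \<xi>' (g r + 1)" using W W_nonneg[OF xu(2)]
        by (intro mono_onD[OF \<xi>(4)]) auto
      then have "L * C * \<xi>' (W x + 1) \<le> L * C * \<xi>' (g r + 1)" using L(1) C(1)
        by (intro mult_left_mono) auto
      moreover have "\<xi> (W x) \<le> \<xi> (g r)" by (rule class_K_mono[OF K\<xi> W_nonneg[OF xu(2)] W])
      ultimately show ?thesis by simp
    qed
    finally show ?thesis .
  qed
  have "\<exists>\<rho>. class_K \<rho> \<and> (\<forall>a\<in>A. D a \<le> ereal (\<rho> (size a)))"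
  proof (rule class_K_majorant[of A size D])
    show "0 \<le> size a" if "a \<in> A" for a
      using that input_norm_nonneg unfolding A_def size_def by auto
  next
    fix r :: real assume r: "0 < r"
    obtain p0 where p0: "0 \<le> p0" "norm s * g r < \<psi>1 p0" using class_K_inf_unbounded[OF \<psi>1] by blast
    define p where "p = p0 + 1"
    have p: "0 < p" "norm s * g r < \<psi>1 p"
      using p0 class_K_mono[OF K\<psi>, of p0 p] unfolding p_def by auto
    obtain L where L: "L > 0" "V_lipschitz p L"
      using V_lip[OF p(1)] by blast
    have "0 < max p r" using r by simp
    from C_ex[OF this] obtain C where C: "C \<ge> 0"
      "F_bounded (max p r) C" by blast
    show "\<exists>B. \<forall>a\<in>A. size a \<le> r \<longrightarrow> D a \<le> ereal B"
      using D_bound[OF _ _ p _ _ less_imp_le[OF L(1)] L(2) C]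
      by (meson max.cobounded1 max.cobounded2)
  next
    fix \<epsilon> :: real assume e: "0 < \<epsilon>"
    obtain C where C: "C \<ge> 0"
      "F_bounded 1 C"
      using C_ex[of 1] by auto
    have g1: "0 \<le> g r" if "0 \<le> r" for r by (rule class_P_nonneg[OF class_K_D(1)[OF g] that])
    define K where "K = C * \<xi>' (g 1 + 1)"
    have K: "0 \<le> K" unfolding K_def using C(1) \<xi>(3)[of "g 1 + 1"] g1[of 1] by simp
    \<comment> \<open>\<open>K\<close> bounds the growth per unit of Lipschitz constant for states and inputs of norm at most \<open>1\<close>. A
      small constant \<open>L\<close> compensates for it.\<close>
    define L where "L = \<epsilon> / (2 * (K + 1))"
    have L: "0 < L" "L * K \<le> \<epsilon> / 2"
    proof -
      show "0 < L" unfolding L_def using e K by simp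
      have "L * (K + 1) = \<epsilon> / 2" unfolding L_def using K by (simp add: field_simps)
      then show "L * K \<le> \<epsilon> / 2" using \<open>0 < L\<close> by (simp add: algebra_simps)
    qed
    obtain p0 where p0: "p0 > 0" "V_lipschitz p0 L"
      using V_lip_small[OF L(1)] by blast
    define p where "p = min p0 1"
    have p: "0 < p" "p \<le> 1" and lip: "V_lipschitz p L"
      using p0 unfolding p_def by auto
    obtain d where d: "0 < d" "\<And>r. 0 \<le> r \<Longrightarrow> r \<le> d \<Longrightarrow> \<xi> r < \<epsilon> / 2"
      using class_K_small[OF K\<xi>, of "\<epsilon> / 2"] e by auto
    have "0 < \<psi>1 p" using class_K_inf_D(2)[OF \<psi>1] p unfolding class_P_def by simp
    then have "0 < min d (\<psi>1 p / norm s)" using d norm_s_pos by simp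
    then obtain \<delta> where \<delta>: "0 < \<delta>" "\<And>r. 0 \<le> r \<Longrightarrow> r \<le> \<delta> \<Longrightarrow> g r < min d (\<psi>1 p / norm s)"
      using class_K_small[OF g] by blast
    define r where "r = min \<delta> 1"
    have r: "0 < r" "r \<le> 1" "g r < d" "norm s * g r < \<psi>1 p"
      using \<delta>(1) \<delta>(2)[of r] norm_s_pos unfolding r_def
      by (auto simp: pos_less_divide_eq mult.commute)
    have "L * C * \<xi>' (g r + 1) + \<xi> (g r) \<le> \<epsilon>"
    proof -
      have "\<xi>' (g r + 1) \<le> \<xi>' (g 1 + 1)"
        using class_K_mono[OF g, of r 1] r g1[of r] g1[of 1] by (intro mono_onD[OF \<xi>(4)]) auto
      then have "L * C * \<xi>' (g r + 1) \<le> L * K"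
        unfolding K_def using L(1) C(1) by (simp add: mult.assoc mult_left_mono)
      then show ?thesis using L(2) d(2)[of "g r"] r g1[of r] by simp
    qed
    then have "\<forall>a\<in>A. size a \<le> r \<longrightarrow> D a \<le> ereal \<epsilon>"
      using D_bound[OF _ _ p(1) r(4) p(2) r(2) less_imp_le[OF L(1)] lip C]
      by (meson ereal_less_eq(3) order_trans)
    then show "\<exists>\<delta>>0. \<forall>a\<in>A. size a \<le> \<delta> \<longrightarrow> D a \<le> ereal \<epsilon>" using r(1) by blast
  qed blast
  then obtain \<rho> where \<rho>: "class_K \<rho>" "\<And>a. a \<in> A \<Longrightarrow> D a \<le> ereal (\<rho> (size a))" by blast
  have "upper_dini n nx F (\<xi> \<circ> W) u x \<le> ereal (- (\<xi> \<circ> W) x + \<rho> (input_norm nu u))"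
    if x: "x \<in> X.X" and u: "u \<in> inputs m nu" for x u
  proof (cases "g (input_norm nu u) < W x")
    case True
    have "0 \<le> \<rho> (input_norm nu u)"
      by (rule class_P_nonneg[OF class_K_D(1)[OF \<rho>(1)] input_norm_nonneg[OF u]])
    then have "ereal (- \<xi> (W x)) \<le> ereal (- (\<xi> \<circ> W) x + \<rho> (input_norm nu u))" by simp
    with dini_large[OF x u True] show ?thesis by (rule order_trans)
  next
    case False
    then have "(x, u) \<in> A" using x u unfolding A_def by simp
    from \<rho>(2)[OF this] have "upper_dini n nx F (\<xi> \<circ> W) u x + ereal (\<xi> (W x)) \<le>
        ereal (\<rho> (input_norm nu u))"
      unfolding D_def size_def by simp
    then show ?thesis by (cases "upper_dini n nx F (\<xi> \<circ> W) u x") auto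
  qed
  then show ?thesis
    unfolding ISS_Lyapunov_dissipative_def
    using candidate_compose[OF \<xi>(1)] class_K_inf_id \<rho>(1) by blast
qed

lemma ISS_Lyapunov:
  "ISS_Lyapunov_implication n nx m nu F W \<and>
    (\<exists>\<xi>. nonlinear_scaling \<xi> \<and> ISS_Lyapunov_dissipative n nx m nu F (\<xi> \<circ> W))"
proof -
  obtain b where b: "class_P b" "\<And>r s. \<bar>b r - b s\<bar> \<le> \<bar>r - s\<bar>"
    and decay: "\<And>x u. x \<in> X.X \<Longrightarrow> u \<in> inputs m nu \<Longrightarrow> g (input_norm nu u) < W x \<Longrightarrow>
      \<exists>r>0. \<forall>t. 0 < t \<and> t < r \<longrightarrow>
        flow n nx F t x u \<in> X.X \<and> W (flow n nx F t x u) \<le> W x - t * b (W x)"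
    by (rule decay_rate) (rule that)
  have "upper_dini n nx F W u x \<le> ereal (- b (W x))"
    if x: "x \<in> X.X" and u: "u \<in> inputs m nu" and large: "W x > g (input_norm nu u)" for x u
  proof -
    obtain r where r: "0 < r" "\<And>t. 0 < t \<and> t < r \<Longrightarrow>
        flow n nx F t x u \<in> X.X \<and> W (flow n nx F t x u) \<le> W x - t * b (W x)"
      using decay[OF x u large] by blast
    show ?thesis
    proof (rule upper_dini_leI[OF r(1)])
      show "W (flow n nx F t x u) - W x \<le> t * - b (W x)" if "0 < t" "t < r" for t
        using r(2)[of t] that by simp
      show "((\<lambda>t. t * - b (W x) / t) \<longlongrightarrow> - b (W x)) (at_right 0)"
        by (rule tendsto_eventually) (simp add: eventually_at_filter)
    qed
  qed
  then have "ISS_Lyapunov_implication n nx m nu F W"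
    unfolding ISS_Lyapunov_implication_def using W_lyapunov_candidate g b(1) by blast
  moreover obtain \<xi> \<xi>' where \<xi>: "nonlinear_scaling \<xi>"
    "\<And>s. 0 < s \<Longrightarrow> (\<xi> has_real_derivative \<xi>' s) (at s)"
    "\<And>s. 0 < s \<Longrightarrow> 0 < \<xi>' s" "mono_on {0<..} \<xi>'" "\<And>s. 0 < s \<Longrightarrow> \<xi>' s * b s = \<xi> s"
    by (rule scaling_exists[OF b]) (rule that)
  moreover have "class_K_inf \<xi>" using \<xi>(1) unfolding nonlinear_scaling_def by blast
  ultimately show ?thesis using scaled_dissipative[OF decay _ \<xi>(2-5)] by blast
qed

end

section \<open>The network\<close>

theorem proposition14:
  fixes n m :: "nat \<Rightarrow> nat"
    and I :: "nat \<Rightarrow> nat set"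
    and nx nu :: "nat \<Rightarrow> linf \<Rightarrow> real"
    and f :: "nat \<Rightarrow> linf \<Rightarrow> (nat \<Rightarrow> linf) \<Rightarrow> linf \<Rightarrow> linf"
    and V :: "nat \<Rightarrow> linf \<Rightarrow> real"
    and \<psi>1i \<psi>2i :: "nat \<Rightarrow> real \<Rightarrow> real"
    and \<mu> :: "nat \<Rightarrow> linf \<Rightarrow> ennreal"
    and \<gamma> :: "nat \<Rightarrow> nat \<Rightarrow> real"
    and \<gamma>u \<alpha> :: "nat \<Rightarrow> real \<Rightarrow> real"
  assumes net: "network n m I nx nu f"
    and hyp_a1: "well_posed n nx m nu (network_rhs I f)"
    and hyp_a2: "boundedness_implies_continuation n nx m nu (network_rhs I f)"
    and hyp_b_V: "\<And>i. continuous_on (Rn (n i)) (V i) \<and> (\<forall>v\<in>Rn (n i). 0 \<le> V i v)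
               \<and> C1_on (n i) (Rn (n i) - {0}) (V i)"
    and hyp_b_L1: "\<And>i. class_K_inf (\<psi>1i i) \<and> class_K_inf (\<psi>2i i)
               \<and> (\<forall>v\<in>Rn (n i). \<psi>1i i (nx i v) \<le> V i v \<and> V i v \<le> \<psi>2i i (nx i v))"
    and hyp_b_L2_data: "\<And>i. aggregation_function (\<mu> i) \<and> (\<forall>j. 0 \<le> \<gamma> i j) \<and> (\<forall>j. j \<notin> I i \<longrightarrow> \<gamma> i j = 0)
               \<and> class_K (\<gamma>u i) \<and> class_P (\<alpha> i)"
    and hyp_b_L2: "\<And>i x u. x \<in> lsup_space n nx \<Longrightarrow> u \<in> lsup_space m nu \<Longrightarrow>
               ennreal (V i (x i)) >
                 max (\<mu> i (weighted (\<gamma> i) (\<lambda>j. V j (x j)))) (ennreal (\<gamma>u i (nu i (u i)))) \<Longrightarrow>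
               grad_app (n i) (V i) (x i) (f i (x i) (restrict x (I i)) (u i)) \<le> - \<alpha> i (V i (x i))"
    and hyp_b_unif: "\<exists>\<psi>1 \<psi>2. class_K_inf \<psi>1 \<and> class_K_inf \<psi>2
               \<and> (\<forall>i. \<forall>r\<ge>0. \<psi>1 r \<le> \<psi>1i i r \<and> \<psi>2i i r \<le> \<psi>2 r)"
    and hyp_c1: "gain_well_defined \<mu> \<gamma>"
    and hyp_c2: "\<exists>\<gamma>max. class_K \<gamma>max \<and> (\<forall>i. \<forall>r\<ge>0. \<gamma>u i r \<le> \<gamma>max r)"
    and hyp_d: "cone_spectral_radius (gain_operator \<mu> \<gamma>) < 1"
    and hyp_e: "\<forall>R>0. \<exists>L>0. \<forall>i. \<forall>v\<in>Rn (n i). \<forall>w\<in>Rn (n i). nx i v < R \<longrightarrow> nx i w < R \<longrightarrow>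
               \<bar>V i v - V i w\<bar> \<le> L * nx i (v - w)"
    and hyp_f: "\<exists>\<alpha>t. class_P \<alpha>t \<and> (\<forall>i. \<forall>r\<ge>0. \<alpha>t r \<le> \<alpha> i r)"
    and hyp_i1: "\<forall>x\<in>lsup_space n nx. \<forall>u\<in>lsup_space m nu. network_rhs I f x u \<in> lsup_space n nx"
    and hyp_i2: "continuous_map (prod_topology (lsup_topology n nx) (lsup_topology m nu))
               (lsup_topology n nx) (\<lambda>(x, u). network_rhs I f x u)"
    and hyp_i3: "\<forall>R>0. bdd_above {lsup_norm nx (network_rhs I f x u) | x u.
               x \<in> lsup_space n nx \<and> u \<in> lsup_space m nu \<and>
               max (lsup_norm nx x) (lsup_norm nu u) \<le> R}"
    and hyp_ii1: "\<And>i. C1_on (n i) (Rn (n i)) (V i)"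
    and hyp_ii2: "\<exists>L::real \<Rightarrow> real. continuous_on {0<..} L \<and> (L \<longlongrightarrow> 0) (at_right 0) \<and>
               (\<forall>R>0. L R > 0 \<and> (\<forall>i. \<forall>v\<in>Rn (n i). \<forall>w\<in>Rn (n i). nx i v < R \<longrightarrow> nx i w < R \<longrightarrow>
                  \<bar>V i v - V i w\<bar> \<le> L R * nx i (v - w)))"
  shows "\<exists>s0\<in>interior linf_pos.
           ISS_Lyapunov_implication n nx m nu (network_rhs I f) (sup_lyapunov s0 V) \<and>
           (\<exists>\<xi>. nonlinear_scaling \<xi> \<and>
              ISS_Lyapunov_dissipative n nx m nu (network_rhs I f) (\<xi> \<circ> sup_lyapunov s0 V))"
proof -
  have Nx: "is_norm_on (Rn (n i)) (nx i)" and Nu: "is_norm_on (Rn (m i)) (nu i)"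
      and finI: "finite (I i)" for i
    using net unfolding network_def by blast+
  interpret infinite_system n m nx nu "network_rhs I f"
  proof
    show "\<exists>C. \<forall>x\<in>lsup_space n nx. \<forall>v\<in>lsup_space m nu. lsup_norm nx x \<le> R \<and> lsup_norm nu v \<le> R \<longrightarrow>
        lsup_norm nx (network_rhs I f x v) \<le> C" if "0 < R" for R
    proof -
      from hyp_i3 that obtain C where "\<And>y. y \<in> {lsup_norm nx (network_rhs I f x u) | x u.
               x \<in> lsup_space n nx \<and> u \<in> lsup_space m nu \<and> max (lsup_norm nx x) (lsup_norm nu u) \<le>
                   R} \<Longrightarrow> y \<le> C"
        unfolding bdd_above_def by blast
      then show ?thesis by (intro exI[of _ C]) auto
    qed
  qed (fact Nx Nu hyp_i2 hyp_a1)+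
  interpret gain_network \<mu> \<gamma> I
    by unfold_locales (use finI hyp_b_L2_data hyp_c1 in auto)
  obtain s c where s: "\<And>i. 1 \<le> apply_bcontfun s i" and c: "0 < c" "c < 1"
    and s_gain: "\<And>i. gain i (apply_bcontfun s) \<le> ennreal (c * s i)"
    by (rule contraction_weight[OF hyp_d]) (rule that)
  obtain \<psi>1 \<psi>2 where \<psi>: "class_K_inf \<psi>1" "class_K_inf \<psi>2"
    and \<psi>_unif: "\<And>i r. 0 \<le> r \<Longrightarrow> \<psi>1 r \<le> \<psi>1i i r \<and> \<psi>2i i r \<le> \<psi>2 r"
    using hyp_b_unif by blast
  obtain g where g: "class_K g" "\<And>i r. 0 \<le> r \<Longrightarrow> \<gamma>u i r \<le> g r" using hyp_c2 by blast
  obtain \<alpha>t where \<alpha>t: "class_P \<alpha>t" "\<And>i r. 0 \<le> r \<Longrightarrow> \<alpha>t r \<le> \<alpha> i r" using hyp_f by blast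
  interpret component_functions n m nx nu "network_rhs I f" V s \<psi>1 \<psi>2
  proof
    fix i v assume v: "v \<in> Rn (n i)"
    have "0 \<le> nx i v" by (rule is_norm_on_nonneg[OF Nx v])
    then show "\<psi>1 (nx i v) \<le> V i v \<and> V i v \<le> \<psi>2 (nx i v)"
      using hyp_b_L1[of i] \<psi>_unif[of "nx i v" i] v by (meson order_trans)
    show "V i differentiable (at v within Rn (n i))"
      using hyp_ii1[of i] v unfolding C1_on_def by blast
  next
    fix \<epsilon> :: real assume e: "0 < \<epsilon>"
    obtain L where L: "(L \<longlongrightarrow> 0) (at_right (0::real))"
      "\<And>R. R > 0 \<Longrightarrow> \<forall>i. \<forall>v\<in>Rn (n i). \<forall>w\<in>Rn (n i). nx i v < R \<longrightarrow> nx i w < R \<longrightarrow>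
                  \<bar>V i v - V i w\<bar> \<le> L R * nx i (v - w)"
      using hyp_ii2 by blast
    have "\<forall>\<^sub>F R in at_right 0. L R < \<epsilon>" using L(1) e by (rule order_tendstoD)
    then obtain b where b: "0 < b" "\<And>R. 0 < R \<Longrightarrow> R < b \<Longrightarrow> L R < \<epsilon>"
      by (auto simp: eventually_at_right_field)
    have "\<bar>V i v - V i w\<bar> \<le> \<epsilon> * nx i (v - w)"
      if "v \<in> Rn (n i)" "w \<in> Rn (n i)" "nx i v < b / 2" "nx i w < b / 2" for i v w
    proof -
      have "\<bar>V i v - V i w\<bar> \<le> L (b / 2) * nx i (v - w)" using L(2)[of "b / 2"] b(1) that by simp
      also have "\<dots> \<le> \<epsilon> * nx i (v - w)"
        using b(2)[of "b / 2"] b(1) is_norm_on_nonneg[OF Nx Rn_diff[OF that(1,2)]]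
        by (intro mult_right_mono) auto
      finally show ?thesis .
    qed
    then show "\<exists>R>0. \<forall>i. \<forall>v\<in>Rn (n i). \<forall>w\<in>Rn (n i).
          nx i v < R \<longrightarrow> nx i w < R \<longrightarrow> \<bar>V i v - V i w\<bar> \<le> \<epsilon> * nx i (v - w)"
      using b(1) by (intro exI[of _ "b / 2"]) simp
  qed (use s \<psi> hyp_e in blast)+
  interpret dissipating_components n m nx nu "network_rhs I f" V s \<psi>1 \<psi>2 c g \<alpha>t
  proof
    fix i x v assume x: "x \<in> X.X" and v: "v \<in> U.X"
      and gain: "c * W x < V i (x i) / s i" and input: "g (lsup_norm nu v) < V i (x i) / s i"
    have V0: "0 \<le> V j (x j)" for j by (rule V_nonneg[OF X.mem_Rn[OF x]])
    \<comment> \<open>By definition of the supremum \<open>V\<^sub>j(x\<^sub>j) \<le> W x s\<^sub>j\<close>, and the weights are contracted.\<close>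
    have "gain i (\<lambda>j. V j (x j)) \<le> gain i (\<lambda>j. W x * s j)"
      using W_upper[OF x] s_pos V0 by (intro gain_mono) (simp_all add: pos_divide_le_eq)
    also have "\<dots> = ennreal (W x) * gain i (apply_bcontfun s)"
      using s_pos W_nonneg[OF x] by (intro gain_scale) (auto intro: less_imp_le)
    also have "\<dots> \<le> ennreal (W x) * ennreal (c * s i)" by (intro mult_left_mono s_gain) simp
    also have "\<dots> = ennreal (c * W x * s i)"
      using W_nonneg[OF x] by (simp add: ennreal_mult'[symmetric] mult_ac)
    also have "\<dots> < ennreal (V i (x i))"
      using gain s_pos[of i] W_nonneg[OF x] c
      by (intro ennreal_lessI) (auto simp: pos_less_divide_eq intro: le_less_trans[rotated])
    finally have small_gain: "gain i (\<lambda>j. V j (x j)) < ennreal (V i (x i))" .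
    have "\<gamma>u i (nu i (v i)) \<le> g (nu i (v i))"
      by (rule g(2)[OF is_norm_on_nonneg[OF Nu U.mem_Rn[OF v]]])
    also have "\<dots> \<le> g (lsup_norm nu v)"
      by (rule class_K_mono[OF g(1) is_norm_on_nonneg[OF Nu U.mem_Rn[OF v]] U.N_le_norm[OF v]])
    also have "\<dots> < V i (x i) / s i" by (rule input)
    also have "\<dots> \<le> V i (x i)" by (rule div_s_le[OF V0])
    finally have "\<gamma>u i (nu i (v i)) < V i (x i)" .
    moreover have "0 \<le> \<gamma>u i (nu i (v i))"
      using hyp_b_L2_data[of i] class_P_nonneg[OF class_K_D(1)] is_norm_on_nonneg[OF Nu U.mem_Rn[OF v]]
      by blast
    ultimately have "ennreal (\<gamma>u i (nu i (v i))) < ennreal (V i (x i))"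
      by (intro ennreal_lessI) auto
    with small_gain hyp_b_L2[OF x v, of i]
    have "grad_app (n i) (V i) (x i) (network_rhs I f x v i) \<le> - \<alpha> i (V i (x i))"
      unfolding network_rhs_def by simp
    then show "grad_app (n i) (V i) (x i) (network_rhs I f x v i) \<le> - \<alpha>t (V i (x i))"
      using \<alpha>t(2)[OF V0, of i i] by simp
  qed (use c g(1) \<alpha>t(1) in auto)
  show ?thesis
    using ISS_Lyapunov interior_linf_posI[OF s] by blast
qed

end
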